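(* Let $k$ be a field of characteristic zero, $n\ge2$, and let $\Lambda$ be the exterior algebra over $k$ on $n$ generators. Then for all $m\ge0$, $$\dim_kHC_m(\Lambda)=\sum_{i=0}^m(-1)^{m-i}2^{n-1}\binom{n+i-1}{n-1}+\begin{cases}1,&\text{if }m\text{ is even};\\0,&\text{if }m\text{ is odd}.\end{cases}$$
   Context: The exterior algebra is the ungraded associative $k$-algebra $\Lambda=k\langle x_1,\dots,x_n\rangle/(x_i^2\ (1\le i\le n),\ x_ix_j+x_jx_i\ (1\le i<j\le n))$. $HC_m(\Lambda)$ denotes the $m$-th cyclic homology group of the (ungraded) $k$-algebra $\Lambda$, as in Loday's book "Cyclic homology". *)

theory Defs
  imports
    "HOL-Algebra.QuotRing"
    "Jordan_Normal_Form.VS_Connect"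
begin

section \<open>Free modules, quotients, and the exterior algebra\<close>

text \<open>
  The ground field is a type of class \<open>field\<close>, turned into a ring record by \<open>class_ring\<close>.
  Vector spaces and algebras are \<open>module\<close> records; an algebra also uses the
  fields \<open>mult\<close> and \<open>one\<close>, which carry no information for a mere vector space.
\<close>

definition free_module :: "'s set \<Rightarrow> ('k::field, 's \<Rightarrow> 'k) module"
  where "free_module S =
    \<lparr>carrier = {f. finite {s. f s \<noteq> 0} \<and> {s. f s \<noteq> 0} \<subseteq> S},
     mult = undefined, one = undefined,
     zero = (\<lambda>s. 0), add = (\<lambda>f g s. f s + g s), smult = (\<lambda>c f s. c * f s)\<rparr>"

definition basis_vec :: "'s \<Rightarrow> 's \<Rightarrow> 'k::field"
  where "basis_vec s = (\<lambda>t. if t = s then 1 else 0)"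

definition linear_ext :: "('s \<Rightarrow> 't \<Rightarrow> 'k::field) \<Rightarrow> ('s \<Rightarrow> 'k) \<Rightarrow> ('t \<Rightarrow> 'k)"
  where "linear_ext \<phi> f = (\<lambda>t. \<Sum>s | f s \<noteq> 0. f s * \<phi> s t)"

text \<open>
  Used both for the quotient of an algebra by a two-sided ideal and for the quotient of a
  vector space by a subspace (where the inherited \<open>mult\<close> and \<open>one\<close> are irrelevant).
\<close>

definition quotient_module ::
    "('k, 'a, 'm) module_scheme \<Rightarrow> 'a set \<Rightarrow> ('k, 'a set) module"
  where "quotient_module M N =
    ring.extend (M Quot N)
      (module.fields (\<lambda>c X. \<Union>x\<in>X. N +>\<^bsub>M\<^esub> (c \<odot>\<^bsub>M\<^esub> x)))"

text \<open>The free associative algebra on \<open>x\<^sub>1, \<dots>, x\<^sub>n\<close>: its basis consists of the words in \<open>{1..n}\<close>.\<close>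

definition free_algebra :: "nat \<Rightarrow> ('k::field, nat list \<Rightarrow> 'k) module"
  where "free_algebra n = (free_module (lists {1..n}))
    \<lparr>mult := (\<lambda>f g w. \<Sum>(u, v) | u @ v = w. f u * g v), one := basis_vec []\<rparr>"

definition gen :: "nat \<Rightarrow> nat list \<Rightarrow> 'k::field"
  where "gen i = basis_vec [i]"

definition exterior_relations :: "nat \<Rightarrow> (nat list \<Rightarrow> 'k::field) set"
  where "exterior_relations n =
    (let F = free_algebra n in
      {gen i \<otimes>\<^bsub>F\<^esub> gen i | i. 1 \<le> i \<and> i \<le> n} \<union>
      {(gen i \<otimes>\<^bsub>F\<^esub> gen j) \<oplus>\<^bsub>F\<^esub> (gen j \<otimes>\<^bsub>F\<^esub> gen i) | i j. 1 \<le> i \<and> i < j \<and> j \<le> n})"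

definition exterior_algebra :: "nat \<Rightarrow> ('k::field, (nat list \<Rightarrow> 'k) set) module"
  where "exterior_algebra n =
    quotient_module (free_algebra n) (Idl\<^bsub>free_algebra n\<^esub> (exterior_relations n))"


section \<open>Tensor powers\<close>

text \<open>
  \<open>M\<^sup>\<otimes>\<^sup>r\<close> is the free vector space on the \<open>r\<close>-tuples of elements of \<open>M\<close> modulo the span of
  the multilinearity relations; the tuple \<open>xs\<close> stands for the elementary tensor
  \<open>x\<^sub>1 \<otimes> \<dots> \<otimes> x\<^sub>r\<close>.
\<close>

definition tuples :: "('k::field, 'a, 'm) module_scheme \<Rightarrow> nat \<Rightarrow> 'a list set"
  where "tuples M r = {xs \<in> lists (carrier M). length xs = r}"

definition tensor_relations ::
    "('k::field, 'a, 'm) module_scheme \<Rightarrow> nat \<Rightarrow> ('a list \<Rightarrow> 'k) set"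
  where "tensor_relations M r =
    {\<lambda>t. basis_vec (us @ (a \<oplus>\<^bsub>M\<^esub> b) # vs) t
         - basis_vec (us @ a # vs) t - basis_vec (us @ b # vs) t
      | us a b vs. us @ a # vs \<in> tuples M r \<and> b \<in> carrier M} \<union>
    {\<lambda>t. basis_vec (us @ (c \<odot>\<^bsub>M\<^esub> a) # vs) t - c * basis_vec (us @ a # vs) t
      | us c a vs. us @ a # vs \<in> tuples M r}"

definition tensor_null ::
    "('k::field, 'a, 'm) module_scheme \<Rightarrow> nat \<Rightarrow> ('a list \<Rightarrow> 'k) set"
  where "tensor_null M r =
    LinearCombinations.module.span class_ring (free_module (tuples M r)) (tensor_relations M r)"

definition tensor_power ::
    "('k::field, 'a, 'm) module_scheme \<Rightarrow> nat \<Rightarrow> ('k, ('a list \<Rightarrow> 'k) set) module"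
  where "tensor_power M r = quotient_module (free_module (tuples M r)) (tensor_null M r)"

text \<open>
  The map into \<open>M\<^sup>\<otimes>\<^sup>r\<close> induced on cosets by a linear map \<open>f\<close> of the free spaces which
  preserves the multilinearity relations.
\<close>

definition tensor_map ::
    "('k::field, 'a, 'm) module_scheme \<Rightarrow> nat \<Rightarrow> (('a list \<Rightarrow> 'k) \<Rightarrow> ('a list \<Rightarrow> 'k))
      \<Rightarrow> ('a list \<Rightarrow> 'k) set \<Rightarrow> ('a list \<Rightarrow> 'k) set"
  where "tensor_map M r f X = (\<Union>x\<in>X. tensor_null M r +>\<^bsub>free_module (tuples M r)\<^esub> f x)"


section \<open>The cyclic bicomplex and cyclic homology\<close>

text \<open>
  The conventions are those of Loday, ``Cyclic homology'', Section 2.1.  On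
  \<open>C\<^sub>q(A) = A\<^sup>\<otimes>\<^sup>(\<^sup>q\<^sup>+\<^sup>1\<^sup>)\<close>, with \<open>a = (a\<^sub>0, \<dots>, a\<^sub>q)\<close>:
  \<open>d\<^sub>i a = (a\<^sub>0, \<dots>, a\<^sub>i a\<^sub>i\<^sub>+\<^sub>1, \<dots>, a\<^sub>q)\<close> for \<open>i < q\<close>,
  \<open>d\<^sub>q a = (a\<^sub>q a\<^sub>0, a\<^sub>1, \<dots>, a\<^sub>q\<^sub>-\<^sub>1)\<close>,
  \<open>b\<close> is the alternating sum of \<open>d\<^sub>0, \<dots>, d\<^sub>q\<close>, \<open>b'\<close> that of \<open>d\<^sub>0, \<dots>, d\<^sub>q\<^sub>-\<^sub>1\<close>,
  \<open>t a = (-1)\<^sup>q (a\<^sub>q, a\<^sub>0, \<dots>, a\<^sub>q\<^sub>-\<^sub>1)\<close>, and \<open>N = 1 + t + \<dots> + t\<^sup>q\<close>.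
\<close>

definition face :: "('k, 'a, 'm) module_scheme \<Rightarrow> nat \<Rightarrow> 'a list \<Rightarrow> 'a list"
  where "face A i xs =
    (if Suc i < length xs
     then take i xs @ (xs ! i \<otimes>\<^bsub>A\<^esub> xs ! Suc i) # drop (i + 2) xs
     else (last xs \<otimes>\<^bsub>A\<^esub> hd xs) # butlast (tl xs))"

definition hochschild_b ::
    "('k::field, 'a, 'm) module_scheme \<Rightarrow> nat \<Rightarrow> ('a list \<Rightarrow> 'k) \<Rightarrow> ('a list \<Rightarrow> 'k)"
  where "hochschild_b A q =
    linear_ext (\<lambda>xs ys. \<Sum>i\<le>q. (-1) ^ i * basis_vec (face A i xs) ys)"

definition bar_b ::
    "('k::field, 'a, 'm) module_scheme \<Rightarrow> nat \<Rightarrow> ('a list \<Rightarrow> 'k) \<Rightarrow> ('a list \<Rightarrow> 'k)"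
  where "bar_b A q =
    linear_ext (\<lambda>xs ys. \<Sum>i<q. (-1) ^ i * basis_vec (face A i xs) ys)"

definition cyclic_t :: "nat \<Rightarrow> ('a list \<Rightarrow> 'k::field) \<Rightarrow> ('a list \<Rightarrow> 'k)"
  where "cyclic_t q =
    linear_ext (\<lambda>xs ys. (-1) ^ q * basis_vec (last xs # butlast xs) ys)"

definition cyclic_N :: "nat \<Rightarrow> ('a list \<Rightarrow> 'k::field) \<Rightarrow> ('a list \<Rightarrow> 'k)"
  where "cyclic_N q f = (\<lambda>ys. \<Sum>i\<le>q. (cyclic_t q ^^ i) f ys)"

text \<open>
  The bicomplex has \<open>CC\<^sub>p\<^sub>q = C\<^sub>q(A)\<close> for \<open>p, q \<ge> 0\<close>.  The vertical differential
  \<open>CC\<^sub>p\<^sub>q \<rightarrow> CC\<^sub>p\<^sub>,\<^sub>q\<^sub>-\<^sub>1\<close> is \<open>b\<close> for even \<open>p\<close> and \<open>-b'\<close> for odd \<open>p\<close>; the horizontal one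
  \<open>CC\<^sub>p\<^sub>q \<rightarrow> CC\<^sub>p\<^sub>-\<^sub>1\<^sub>,\<^sub>q\<close> is \<open>1 - t\<close> for odd \<open>p\<close> and \<open>N\<close> for even \<open>p\<close>.
\<close>

definition CC_vert ::
    "('k::field, 'a, 'm) module_scheme \<Rightarrow> nat \<Rightarrow> nat
      \<Rightarrow> ('a list \<Rightarrow> 'k) set \<Rightarrow> ('a list \<Rightarrow> 'k) set"
  where "CC_vert A p q =
    tensor_map A q (if even p then hochschild_b A q else (\<lambda>f ys. - bar_b A q f ys))"

definition CC_horiz ::
    "('k::field, 'a, 'm) module_scheme \<Rightarrow> nat \<Rightarrow> nat
      \<Rightarrow> ('a list \<Rightarrow> 'k) set \<Rightarrow> ('a list \<Rightarrow> 'k) set"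
  where "CC_horiz A p q =
    tensor_map A (Suc q) (if odd p then (\<lambda>f ys. f ys - cyclic_t q f ys) else cyclic_N q)"

text \<open>The total complex; the component of index \<open>p\<close> of a chain of degree \<open>m\<close> lies in \<open>CC\<^sub>p\<^sub>,\<^sub>m\<^sub>-\<^sub>p\<close>.\<close>

definition Tot_CC ::
    "('k::field, 'a, 'm) module_scheme \<Rightarrow> nat \<Rightarrow> ('k, nat \<Rightarrow> ('a list \<Rightarrow> 'k) set) module"
  where "Tot_CC A m =
    (let C = (\<lambda>p. tensor_power A (Suc (m - p))) in
      \<lparr>carrier = (\<Pi>\<^sub>E p\<in>{..m}. carrier (C p)),
       mult = undefined, one = undefined,
       zero = (\<lambda>p\<in>{..m}. \<zero>\<^bsub>C p\<^esub>),
       add = (\<lambda>x y. \<lambda>p\<in>{..m}. x p \<oplus>\<^bsub>C p\<^esub> y p),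
       smult = (\<lambda>c x. \<lambda>p\<in>{..m}. c \<odot>\<^bsub>C p\<^esub> x p)\<rparr>)"

definition Tot_CC_diff ::
    "('k::field, 'a, 'm) module_scheme \<Rightarrow> nat
      \<Rightarrow> (nat \<Rightarrow> ('a list \<Rightarrow> 'k) set) \<Rightarrow> (nat \<Rightarrow> ('a list \<Rightarrow> 'k) set)"
  where "Tot_CC_diff A m x =
    (\<lambda>p\<in>{..<m}. CC_vert A p (m - p) (x p)
        \<oplus>\<^bsub>tensor_power A (m - p)\<^esub> CC_horiz A (Suc p) (m - Suc p) (x (Suc p)))"

text \<open>
  Homology of a complex \<open>\<dots> \<rightarrow> C\<^sub>2 \<rightarrow> C\<^sub>1 \<rightarrow> C\<^sub>0 \<rightarrow> 0\<close>, where \<open>d m\<close> maps \<open>C\<^sub>m\<close> to \<open>C\<^sub>m\<^sub>-\<^sub>1\<close>.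
\<close>

definition cycles ::
    "(nat \<Rightarrow> ('k, 'c, 'm) module_scheme) \<Rightarrow> (nat \<Rightarrow> 'c \<Rightarrow> 'c) \<Rightarrow> nat \<Rightarrow> 'c set"
  where "cycles C d m =
    {x \<in> carrier (C m). m = 0 \<or> d m x = \<zero>\<^bsub>C (m - 1)\<^esub>}"

definition homology ::
    "(nat \<Rightarrow> ('k, 'c, 'm) module_scheme) \<Rightarrow> (nat \<Rightarrow> 'c \<Rightarrow> 'c) \<Rightarrow> nat \<Rightarrow> ('k, 'c set) module"
  where "homology C d m =
    quotient_module ((C m)\<lparr>carrier := cycles C d m\<rparr>) (d (Suc m) ` carrier (C (Suc m)))"

definition cyclic_homology ::
    "('k::field, 'a, 'm) module_scheme \<Rightarrow> nat
      \<Rightarrow> ('k, (nat \<Rightarrow> ('a list \<Rightarrow> 'k) set) set) module"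
  where "cyclic_homology A m = homology (Tot_CC A) (Tot_CC_diff A) m"

end

theory Submission
  imports Defs "HOL-Library.Poly_Mapping" "HOL-Combinatorics.Multiset_Permutations"
begin

text \<open>
  Write elementary tensors of basis vectors of \<open>\<Lambda>\<close> as lists of subsets of \<open>{1..n}\<close>.  A contraction
  removes unit entries from the Hochschild complex, and a triangular matching that splits a set at
  its maximum, or merges two descending neighbours, reduces a Hochschild cycle to a combination of
  elements \<open>(S, M)\<close>, where \<open>S\<close> is a set of generators and \<open>M\<close> a multiset of differentials.  As \<open>\<Lambda>\<close> is
  regarded as ungraded, the differential of \<open>(S, M)\<close> is twice a Koszul differential when
  \<open>w = |S| + |M|\<close> is even, and zero when \<open>w\<close> is odd: up to \<open>(\<emptyset>, \<emptyset>)\<close>, the Hochschild homology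
  is spanned by the pairs of odd weight.  There Connes' operator acts as the de Rham differential
  \<open>dd\<close>, which is exact in positive weight in characteristic zero.  Hence a total cycle \<open>z\<close> of degree
  \<open>m\<close> bounds iff the de Rham differential \<open>Th z\<close> of its first column vanishes and, for even \<open>m\<close>, so
  does its component along the unit in the last column.  The values of \<open>Th\<close> fill the exact
  forms of odd weight with \<open>|M| = m + 1\<close>.  Exactness of \<open>dd\<close> shows that the dimensions of these
  spaces in degrees \<open>m\<close> and \<open>m - 1\<close> add up to the number \<open>2\<^bsup>n-1\<^esup> \<cdot> binom(n + m - 1, n - 1)\<close> of pairs of
  odd weight with \<open>|M| = m\<close>, which gives the alternating sum.
\<close>

section \<open>Finitely supported functions\<close>

text \<open>The homology is read off from one linear map, \<open>co\<close>, on total cycles: its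
  kernel is the space of boundaries and its image consists of all vectors supported on the finite
  set \<open>ID m\<close>, so the dimension is \<open>card (ID m)\<close>. The locale
  \<open>linq\<close> turns such data into statements about coset structures; it also replaces the
  exterior algebra and its tensor powers by functions on sets and on lists of sets. Parity of the
  weight matters because generators anticommute while the cyclic face carries no Koszul sign.
  Bringing an entry of weight \<open>a\<close> from the end to the front of a tensor of weight
  \<open>w\<close> costs \<open>(-1)^(a (w - a))\<close>. For odd \<open>w\<close> this is 1, so the
  form \<open>a_0 da_1 ... da_q\<close> kills Hochschild boundaries. On \<open>(S, M)\<close> the
  sign \<open>(-1)^|M|\<close> of the cyclic face and the sign of moving a generator past
  \<open>e_S\<close> combine to \<open>(-1)^w\<close>. Characteristic zero supplies three inverses:
  of 2 for the Koszul differential, of the number of words with a given content, by which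
  \<open>phi\<close> differs from an inverse of \<open>io\<close> in odd weight, and of the length
  of a tensor, by which the norm acts on forms.\<close>

hide_const (open) Poly_Mapping.degree Poly_Mapping.range Poly_Mapping.nth Poly_Mapping.map

abbreviation "lookup \<equiv> Poly_Mapping.lookup"
abbreviation "keys \<equiv> Poly_Mapping.keys"
abbreviation bas :: "'s \<Rightarrow> ('s \<Rightarrow>\<^sub>0 'k::field)" where "bas s \<equiv> Poly_Mapping.single s 1"

definition scl :: "'k::field \<Rightarrow> ('s \<Rightarrow>\<^sub>0 'k) \<Rightarrow> ('s \<Rightarrow>\<^sub>0 'k)"
  where "scl c f = Poly_Mapping.map ((*) c) f"

lemma lookup_scl [simp]: "lookup (scl c f) s = c * lookup f s"
  unfolding scl_def by (simp add: Poly_Mapping.map.rep_eq when_def)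

lemma scl_add [simp]: "scl c (f + g) = scl c f + scl c g"
  by (rule poly_mapping_eqI) (simp add: lookup_add algebra_simps)
lemma scl_diff [simp]: "scl c (f - g) = scl c f - scl c g"
  by (rule poly_mapping_eqI) (simp add: lookup_minus algebra_simps)
lemma scl_uminus [simp]: "scl c (- f) = - scl c f"
  by (rule poly_mapping_eqI) simp
lemma scl_zero [simp]: "scl c 0 = 0"
  by (rule poly_mapping_eqI) simp
lemma scl_0 [simp]: "scl 0 f = 0"
  by (rule poly_mapping_eqI) simp
lemma scl_1 [simp]: "scl 1 f = f"
  by (rule poly_mapping_eqI) simp
lemma scl_minus_left [simp]: "scl (- c) f = - scl c f"
  by (rule poly_mapping_eqI) simp
lemma scl_scl [simp]: "scl c (scl d f) = scl (c * d) f"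
  by (rule poly_mapping_eqI) simp
lemma scl_add_left: "scl (c + d) f = scl c f + scl d f"
  by (rule poly_mapping_eqI) (simp add: lookup_add algebra_simps)
lemma scl_sum [simp]: "scl c (\<Sum>i\<in>I. f i) = (\<Sum>i\<in>I. scl c (f i))"
  by (induction I rule: infinite_finite_induct) auto
lemma scl_cancel: "c \<noteq> 0 \<Longrightarrow> scl c f = scl c g \<longleftrightarrow> f = g"
  by (auto simp: poly_mapping_eq_iff fun_eq_iff)
lemma keys_scl: "keys (scl c f) \<subseteq> keys f"
  by (auto simp: in_keys_iff)
lemma keys_diff_sub: "keys (f - g :: 's \<Rightarrow>\<^sub>0 'k::field) \<subseteq> keys f \<union> keys g"
  by (auto simp: in_keys_iff lookup_minus)
lemma keys_uminus' [simp]: "keys (- f :: 's \<Rightarrow>\<^sub>0 'k::field) = keys f"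
  by (auto simp: in_keys_iff)
lemma keys_sum_sub: "keys (\<Sum>i\<in>I. f i :: 's \<Rightarrow>\<^sub>0 'k::field) \<subseteq> (\<Union>i\<in>I. keys (f i))"
proof (induction I rule: infinite_finite_induct)
  case (insert x F)
  then show ?case using Poly_Mapping.keys_add[of "f x" "sum f F"] by auto
qed auto
lemma keys_addI: "keys f \<subseteq> B \<Longrightarrow> keys g \<subseteq> B \<Longrightarrow> keys (f + g :: 's \<Rightarrow>\<^sub>0 'k::field) \<subseteq> B"
  using Poly_Mapping.keys_add[of f g] by auto
lemma keys_diffI: "keys f \<subseteq> B \<Longrightarrow> keys g \<subseteq> B \<Longrightarrow> keys (f - g :: 's \<Rightarrow>\<^sub>0 'k::field) \<subseteq> B"
  using keys_diff_sub[of f g] by auto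
lemma keys_sclI: "keys f \<subseteq> B \<Longrightarrow> keys (scl c f) \<subseteq> B"
  using keys_scl[of c f] by auto
lemma keys_uminusI: "keys f \<subseteq> B \<Longrightarrow> keys (- f :: 's \<Rightarrow>\<^sub>0 'k::field) \<subseteq> B"
  by simp
lemma keys_sumI: "(\<And>i. i \<in> I \<Longrightarrow> keys (f i) \<subseteq> B) \<Longrightarrow> keys (\<Sum>i\<in>I. f i :: 's \<Rightarrow>\<^sub>0 'k::field) \<subseteq> B"
  using keys_sum_sub[of f I] by blast
lemma keys_zeroI: "keys (0 :: 's \<Rightarrow>\<^sub>0 'k::field) \<subseteq> B" by simp
lemma keys_basI: "s \<in> B \<Longrightarrow> keys (bas s :: 's \<Rightarrow>\<^sub>0 'k::field) \<subseteq> B" by simp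
lemmas keysI = keys_addI keys_diffI keys_sclI keys_uminusI keys_sumI keys_zeroI keys_basI

lemma pm_expand: "f = (\<Sum>s\<in>keys f. scl (lookup f s) (bas s))"
  by (rule poly_mapping_eqI)
    (auto simp: lookup_sum lookup_single when_def in_keys_iff if_distrib cong: if_cong)

lemma pm_expand_on:
  assumes "finite B" "keys f \<subseteq> B"
  shows "f = (\<Sum>s\<in>B. scl (lookup f s) (bas s))"
proof -
  have "(\<Sum>s\<in>keys f. scl (lookup f s) (bas s)) = (\<Sum>s\<in>B. scl (lookup f s) (bas s :: 'a \<Rightarrow>\<^sub>0 'b))"
    using assms by (intro sum.mono_neutral_left ballI) (simp_all add: not_in_keys_iff_lookup_eq_zero)
  then show ?thesis using pm_expand[of f] by simp
qed

section \<open>Linear maps between spaces of finitely supported functions\<close>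

definition lin :: "(('s \<Rightarrow>\<^sub>0 'k::field) \<Rightarrow> ('t \<Rightarrow>\<^sub>0 'k)) \<Rightarrow> bool"
  where "lin f \<longleftrightarrow> (\<forall>x y. f (x + y) = f x + f y) \<and> (\<forall>c x. f (scl c x) = scl c (f x))"

lemma linI: "(\<And>x y. f (x + y) = f x + f y) \<Longrightarrow> (\<And>c x. f (scl c x) = scl c (f x)) \<Longrightarrow> lin f"
  by (simp add: lin_def)
lemma lin_add: "lin f \<Longrightarrow> f (x + y) = f x + f y" by (simp add: lin_def)
lemma lin_scl: "lin f \<Longrightarrow> f (scl c x) = scl c (f x)" by (simp add: lin_def)
lemma lin_zero: "lin f \<Longrightarrow> f 0 = 0" using lin_scl[of f 0 0] by simp
lemma lin_minus: "lin f \<Longrightarrow> f (- x) = - f x" using lin_scl[of f "-1" x] by simp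
lemma lin_diff: "lin f \<Longrightarrow> f (x - y) = f x - f y"
  using lin_add[of f x "-y"] lin_minus[of f y] by simp
lemma lin_sum: "lin f \<Longrightarrow> f (\<Sum>i\<in>I. g i) = (\<Sum>i\<in>I. f (g i))"
  by (induction I rule: infinite_finite_induct) (auto simp: lin_add lin_zero)
lemmas lin_rules = lin_add lin_scl lin_zero lin_minus lin_diff lin_sum

lemma lin_id [intro!]: "lin (\<lambda>x. x)" by (simp add: lin_def)
lemma lin_const0 [intro!]: "lin (\<lambda>x. 0)" by (simp add: lin_def)
lemma lin_plus [intro!]: "lin f \<Longrightarrow> lin g \<Longrightarrow> lin (\<lambda>x. f x + g x)"
  by (simp add: lin_def algebra_simps)
lemma lin_sub [intro!]: "lin f \<Longrightarrow> lin g \<Longrightarrow> lin (\<lambda>x. f x - g x)"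
  by (simp add: lin_def algebra_simps)
lemma lin_neg [intro!]: "lin f \<Longrightarrow> lin (\<lambda>x. - f x)"
  by (simp add: lin_def)
lemma lin_scale [intro!]: "lin f \<Longrightarrow> lin (\<lambda>x. scl c (f x))"
  by (simp add: lin_def mult.commute)
lemma lin_sums [intro!]: "(\<And>i. i \<in> I \<Longrightarrow> lin (f i)) \<Longrightarrow> lin (\<lambda>x. \<Sum>i\<in>I. f i x)"
  by (simp add: lin_def sum.distrib)
lemma lin_comp: "lin f \<Longrightarrow> lin g \<Longrightarrow> lin (\<lambda>x. f (g x))"
  by (simp add: lin_def)

lemma lin_expand: "lin f \<Longrightarrow> f x = (\<Sum>s\<in>keys x. scl (lookup x s) (f (bas s)))"
  by (subst pm_expand[of x]) (simp add: lin_sum lin_scl)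

lemma lin_eq_on:
  assumes "lin f" "lin g" "\<And>s. s \<in> keys x \<Longrightarrow> f (bas s) = g (bas s)"
  shows "f x = g x"
  unfolding lin_expand[OF assms(1), of x] lin_expand[OF assms(2), of x] using assms(3) by simp

lemma lin_eqI:
  assumes "lin f" "lin g" "\<And>s. f (bas s) = g (bas s)"
  shows "f x = g x"
  using lin_eq_on assms by blast

lemma lin_keys:
  assumes "lin f" "\<And>s. s \<in> keys x \<Longrightarrow> keys (f (bas s)) \<subseteq> B"
  shows "keys (f x) \<subseteq> B"
  unfolding lin_expand[OF assms(1), of x] using assms(2) by (intro keysI) auto

definition lext :: "('s \<Rightarrow> ('t \<Rightarrow>\<^sub>0 'k)) \<Rightarrow> ('s \<Rightarrow>\<^sub>0 'k::field) \<Rightarrow> ('t \<Rightarrow>\<^sub>0 'k)"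
  where "lext \<phi> f = (\<Sum>s\<in>keys f. scl (lookup f s) (\<phi> s))"

lemma lext_on:
  assumes "finite B" "keys f \<subseteq> B"
  shows "lext \<phi> f = (\<Sum>s\<in>B. scl (lookup f s) (\<phi> s))"
  unfolding lext_def using assms
  by (intro sum.mono_neutral_left ballI) (simp_all add: not_in_keys_iff_lookup_eq_zero)

lemma lext_bas [simp]: "lext \<phi> (bas s) = \<phi> s"
  by (simp add: lext_def)

lemma lin_lext0: "lin (lext \<phi>)"
proof (rule linI)
  fix x y :: "'a \<Rightarrow>\<^sub>0 'b"
  define D where "D = keys x \<union> keys y"
  have D: "finite D" "keys x \<subseteq> D" "keys y \<subseteq> D" "keys (x + y) \<subseteq> D"
    unfolding D_def by (auto intro: Poly_Mapping.keys_add del: subsetI)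
  show "lext \<phi> (x + y) = lext \<phi> x + lext \<phi> y"
    unfolding lext_on[OF D(1,2)] lext_on[OF D(1,3)] lext_on[OF D(1,4)]
    by (simp only: lookup_add scl_add_left sum.distrib)
next
  fix c and x :: "'a \<Rightarrow>\<^sub>0 'b"
  show "lext \<phi> (scl c x) = scl c (lext \<phi> x)"
    unfolding lext_on[of "keys x" "scl c x", OF finite_keys keys_scl]
      lext_on[of "keys x" x, OF finite_keys subset_refl]
    by (simp only: lookup_scl scl_sum scl_scl)
qed

lemmas lext_simps [simp] = lin_rules[OF lin_lext0]

lemma lin_lext [intro!]: "lin g \<Longrightarrow> lin (\<lambda>x. lext \<phi> (g x))"
  using lin_comp[OF lin_lext0] .

lemma keys_lext:
  assumes "\<And>s. s \<in> keys x \<Longrightarrow> keys (\<phi> s) \<subseteq> B"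
  shows "keys (lext \<phi> x) \<subseteq> B"
  by (rule lin_keys[OF lin_lext0]) (simp add: assms)

lemma lookup_lext: "lookup (lext \<phi> x) t = (\<Sum>s\<in>keys x. lookup x s * lookup (\<phi> s) t)"
  by (simp add: lext_def lookup_sum)

text \<open>
  The algebraic core of discrete Morse theory: \<open>\<mu>\<close> pairs each source \<open>s\<close> with a basis element whose
  boundary has leading term \<open>s\<close> with respect to \<open>R\<close> among the sources.
\<close>
definition triang :: "('s \<times> 's) set \<Rightarrow> 's set \<Rightarrow> ('s \<Rightarrow> 't) \<Rightarrow>
    (('t \<Rightarrow>\<^sub>0 'k::field) \<Rightarrow> ('s \<Rightarrow>\<^sub>0 'k)) \<Rightarrow> bool"
  where "triang R Src \<mu> \<delta> \<longleftrightarrow> wf R \<and> trans R \<and> lin \<delta> \<and> inj_on \<mu> Src \<and>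
    (\<forall>s\<in>Src. \<exists>u r. u \<noteq> 0 \<and> \<delta> (bas (\<mu> s)) = scl u (bas s) + r \<and> (\<forall>K\<in>keys r. K \<in> Src \<longrightarrow> (K, s) \<in> R))"

lemma triang_subset: "triang R Src \<mu> \<delta> \<Longrightarrow> S \<subseteq> Src \<Longrightarrow> triang R S \<mu> \<delta>"
  unfolding triang_def by (meson in_mono inj_on_subset)

text \<open>Since \<open>\<delta> (bas (\<mu> s))\<close> is a nonzero multiple of \<open>s\<close>
  plus a remainder whose sources are all smaller than \<open>s\<close>, well-founded induction
  trades each source for non-sources modulo the image of \<open>\<delta>\<close>. The property
  \<open>P\<close> is closed under linear combinations, so basis vectors suffice.\<close>

lemma triang_decomp:
  fixes \<delta> :: "('t \<Rightarrow>\<^sub>0 'k::field) \<Rightarrow> ('s \<Rightarrow>\<^sub>0 'k)"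
  assumes tri: "triang R Src \<mu> \<delta>" and "Src \<subseteq> B"
    and B: "\<And>s. s \<in> Src \<Longrightarrow> keys (\<delta> (bas (\<mu> s))) \<subseteq> B"
    and f: "keys f \<subseteq> B"
  shows "\<exists>\<tau>. keys \<tau> \<subseteq> \<mu> ` Src \<and> keys (f - \<delta> \<tau>) \<subseteq> B - Src"
proof -
  have wf: "wf R" and lin: "lin \<delta>" using tri by (auto simp: triang_def)
  define P where "P f \<longleftrightarrow> (\<exists>\<tau>. keys \<tau> \<subseteq> \<mu> ` Src \<and> keys (f - \<delta> \<tau>) \<subseteq> B - Src)" for f
  have P0: "P 0" unfolding P_def by (intro exI[of _ 0]) (simp add: lin_zero[OF lin])
  have Padd: "P (f + g)" if fg: "P f" "P g" for f g
  proof -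
    obtain a b where ab: "keys a \<subseteq> \<mu> ` Src" "keys (f - \<delta> a) \<subseteq> B - Src"
      "keys b \<subseteq> \<mu> ` Src" "keys (g - \<delta> b) \<subseteq> B - Src"
      using fg unfolding P_def by blast
    have e: "f + g - \<delta> (a + b) = (f - \<delta> a) + (g - \<delta> b)"
      unfolding lin_add[OF lin] by simp
    show ?thesis unfolding P_def
      by (rule exI[of _ "a + b"], unfold e, intro conjI keys_addI ab)
  qed
  have Pscl: "P (scl c f)" if pf: "P f" for c f
  proof -
    obtain a where a: "keys a \<subseteq> \<mu> ` Src" "keys (f - \<delta> a) \<subseteq> B - Src"
      using pf unfolding P_def by blast
    have e: "scl c f - \<delta> (scl c a) = scl c (f - \<delta> a)"
      unfolding lin_scl[OF lin] by simp
    show ?thesis unfolding P_def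
      by (rule exI[of _ "scl c a"], unfold e, intro conjI keys_sclI a)
  qed
  have Psum: "P (\<Sum>i\<in>I. g i)" if "\<And>i. i \<in> I \<Longrightarrow> P (g i)" for I :: "'s set" and g
    using that by (induction I rule: infinite_finite_induct) (auto simp: P0 intro: Padd)
  have Pb: "s \<in> B \<Longrightarrow> P (bas s)" for s
  proof (induction s rule: wf_induct_rule[OF wf])
    case (1 s)
    show ?case
    proof (cases "s \<in> Src")
      case False
      then show ?thesis unfolding P_def using 1 by (intro exI[of _ 0]) (auto simp: lin_zero[OF lin])
    next
      case True
      then obtain u r where ur: "u \<noteq> 0" "\<delta> (bas (\<mu> s)) = scl u (bas s) + r"
        "\<And>K. K \<in> keys r \<Longrightarrow> K \<in> Src \<Longrightarrow> (K, s) \<in> R"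
        using tri unfolding triang_def by blast
      have "r = \<delta> (bas (\<mu> s)) - scl u (bas s)" using ur(2) by simp
      then have rB: "keys r \<subseteq> B" using B[OF True] 1(2) by (simp only:) (intro keysI)
      have "P (bas K)" if K: "K \<in> keys r" for K
      proof -
        have KB: "K \<in> B" using K rB by (rule subsetD[rotated])
        show ?thesis
        proof (cases "K \<in> Src")
          case KS: True
          have "(K, s) \<in> R" by (rule ur(3)[OF K KS])
          then show ?thesis by (rule 1(1)[OF _ KB])
        next
          case False
          have z: "keys (bas K - \<delta> 0 :: 's \<Rightarrow>\<^sub>0 'k) \<subseteq> B - Src"
            using False KB by (simp only: lin_zero[OF lin] diff_zero keys_single one_neq_zero if_False insert_subset Diff_iff not_False_eq_True empty_subsetI simp_thms)
          show ?thesis unfolding P_def by (rule exI[of _ 0], rule conjI, rule keys_zeroI, rule z)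
        qed
      qed
      then have "P r" by (subst pm_expand[of r]) (intro Psum Pscl)
      moreover have "P (\<delta> (bas (\<mu> s)))"
        unfolding P_def using True by (intro exI[of _ "bas (\<mu> s)"]) auto
      ultimately have "P (scl (inverse u) (\<delta> (bas (\<mu> s)) + scl (-1) r))"
        by (intro Pscl Padd)
      then show ?thesis using ur(1,2) by simp
    qed
  qed
  have "P f" by (subst pm_expand[of f], intro Psum Pscl Pb) (use f in blast)
  then show ?thesis unfolding P_def .
qed

text \<open>Let \<open>s\<close> be maximal among the sources matched with keys of
  \<open>\<tau>\<close>. No other \<open>\<delta> (bas (\<mu> y))\<close> contains \<open>s\<close>,
  so the coefficient of \<open>s\<close> in \<open>\<delta> \<tau>\<close> is a nonzero multiple of
  the coefficient of \<open>\<mu> s\<close> in \<open>\<tau>\<close>.\<close>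

lemma triang_unique:
  assumes tri: "triang R Src \<mu> \<delta>" and \<tau>: "keys \<tau> \<subseteq> \<mu> ` Src" "keys (\<delta> \<tau>) \<inter> Src = {}"
  shows "\<tau> = 0"
proof (rule ccontr)
  assume "\<tau> \<noteq> 0"
  have wf: "wf R" and tr: "trans R" and lin: "lin \<delta>" and inj: "inj_on \<mu> Src"
    using tri by (auto simp: triang_def)
  define X where "X = {s\<in>Src. \<mu> s \<in> keys \<tau>}"
  have Xk: "\<mu> ` X = keys \<tau>" using \<tau>(1) by (auto simp: X_def)
  have "inj_on \<mu> X" using inj by (auto simp: X_def inj_on_def)
  then have finX: "finite X" using finite_imageD[of \<mu> X] Xk by simp
  have X0: "X \<noteq> {}" using \<open>\<tau> \<noteq> 0\<close> Xk
    by (metis image_is_empty keys_eq_empty)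
  \<comment> \<open>On the finite set \<open>X\<close> the converse of \<open>R\<close> is acyclic,
    hence well-founded; a minimal element for it is an \<open>R\<close>-maximal one.\<close>
  have ac: "acyclic ((R \<inter> X \<times> X)\<inverse>)"
    using wf by (simp add: acyclic_converse) (meson acyclic_subset inf_le1 wf_acyclic)
  have "finite ((R \<inter> X \<times> X)\<inverse>)" using finX by simp
  then have "wf ((R \<inter> X \<times> X)\<inverse>)" using ac finite_acyclic_wf by blast
  then obtain s where s: "s \<in> X" "\<And>y. (y, s) \<in> (R \<inter> X \<times> X)\<inverse> \<Longrightarrow> y \<notin> X"
    using X0 wfE_min by (metis ex_in_conv)
  have max: "(s, y) \<notin> R" if "y \<in> X" for y
    using s(2)[of y] that s(1) by blast
  have sS: "s \<in> Src" using s by (simp add: X_def)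
  have "\<delta> \<tau> = (\<Sum>k\<in>keys \<tau>. scl (lookup \<tau> k) (\<delta> (bas k)))" by (rule lin_expand[OF lin])
  also have "\<dots> = (\<Sum>y\<in>X. scl (lookup \<tau> (\<mu> y)) (\<delta> (bas (\<mu> y))))"
    unfolding Xk[symmetric] using \<open>inj_on \<mu> X\<close> by (simp add: sum.reindex)
  finally have "lookup (\<delta> \<tau>) s = (\<Sum>y\<in>X. lookup \<tau> (\<mu> y) * lookup (\<delta> (bas (\<mu> y))) s)"
    by (simp add: lookup_sum)
  also have "\<dots> = (\<Sum>y\<in>X. if y = s then lookup \<tau> (\<mu> s) * lookup (\<delta> (bas (\<mu> s))) s else 0)"
  proof (rule sum.cong[OF refl])
    fix y assume y: "y \<in> X"
    then obtain u r where ur: "\<delta> (bas (\<mu> y)) = scl u (bas y) + r"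
      "\<And>K. K \<in> keys r \<Longrightarrow> K \<in> Src \<Longrightarrow> (K, y) \<in> R"
      using tri unfolding triang_def X_def by blast
    have "y \<noteq> s \<Longrightarrow> lookup (\<delta> (bas (\<mu> y))) s = 0"
      using ur max[OF y] sS by (auto simp: lookup_add lookup_single in_keys_iff when_def)
    then show "lookup \<tau> (\<mu> y) * lookup (\<delta> (bas (\<mu> y))) s =
      (if y = s then lookup \<tau> (\<mu> s) * lookup (\<delta> (bas (\<mu> s))) s else 0)" by auto
  qed
  also have "\<dots> = lookup \<tau> (\<mu> s) * lookup (\<delta> (bas (\<mu> s))) s"
    using finX s(1) by simp
  finally have e: "lookup (\<delta> \<tau>) s = lookup \<tau> (\<mu> s) * lookup (\<delta> (bas (\<mu> s))) s" .
  obtain u r where ur: "u \<noteq> 0" "\<delta> (bas (\<mu> s)) = scl u (bas s) + r"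
      "\<And>K. K \<in> keys r \<Longrightarrow> K \<in> Src \<Longrightarrow> (K, s) \<in> R"
    using tri sS unfolding triang_def by blast
  have "s \<notin> keys r" using ur(3)[of s] sS wf by auto
  then have "lookup (\<delta> (bas (\<mu> s))) s = u" using ur(2) by (simp add: lookup_add in_keys_iff)
  moreover have "lookup \<tau> (\<mu> s) \<noteq> 0" using s(1) by (auto simp: X_def in_keys_iff)
  moreover have "lookup (\<delta> \<tau>) s = 0" using \<tau>(2) sS by (auto simp: in_keys_iff)
  ultimately show False using e ur(1) by simp
qed

section \<open>The cyclic operators on tensors of basis vectors\<close>

text \<open>The parameter \<open>ty\<close> only fixes the field of coefficients.\<close>
locale grass = fixes n :: nat and ty :: "'k::field_char_0 itself"
begin

text \<open>
  With \<open>e\<^sub>S\<close> the increasing product of the generators in \<open>S\<close>, the structure constants are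
  \<open>e\<^sub>S e\<^sub>T = cc S T e\<^bsub>S \<union> T\<^esub>\<close>.  The intersections with \<open>{1..n}\<close> only make the laws of \<open>cc\<close>
  hold for arbitrary, possibly infinite, sets.
\<close>
definition invs :: "nat set \<Rightarrow> nat set \<Rightarrow> nat"
  where "invs S T = card {p \<in> (S \<inter> {1..n}) \<times> (T \<inter> {1..n}). snd p < fst p}"

definition cc :: "nat set \<Rightarrow> nat set \<Rightarrow> 'k"
  where "cc S T = (if S \<inter> T = {} then (-1) ^ invs S T else 0)"

definition cd :: "nat set \<Rightarrow> nat"
  where "cd S = card (S \<inter> {1..n})"

lemma cd_empty [simp]: "cd {} = 0" by (simp add: cd_def)

lemma cd_Un: "S \<inter> T = {} \<Longrightarrow> cd (S \<union> T) = cd S + cd T"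
  unfolding cd_def by (subst card_Un_disjoint[symmetric]) (auto simp: Int_Un_distrib2)

lemma invs_Un_left:
  assumes "S \<inter> S' = {}" shows "invs (S \<union> S') T = invs S T + invs S' T"
proof -
  have "{p \<in> ((S \<union> S') \<inter> {1..n}) \<times> (T \<inter> {1..n}). snd p < fst p} =
    {p \<in> (S \<inter> {1..n}) \<times> (T \<inter> {1..n}). snd p < fst p} \<union> {p \<in> (S' \<inter> {1..n}) \<times> (T \<inter> {1..n}). snd p < fst p}"
    by auto
  then show ?thesis unfolding invs_def
    using assms by (simp only:) (subst card_Un_disjoint, auto)
qed

lemma invs_Un_right:
  assumes "T \<inter> T' = {}" shows "invs S (T \<union> T') = invs S T + invs S T'"
proof -
  have "{p \<in> (S \<inter> {1..n}) \<times> ((T \<union> T') \<inter> {1..n}). snd p < fst p} =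
    {p \<in> (S \<inter> {1..n}) \<times> (T \<inter> {1..n}). snd p < fst p} \<union> {p \<in> (S \<inter> {1..n}) \<times> (T' \<inter> {1..n}). snd p < fst p}"
    by auto
  then show ?thesis unfolding invs_def
    using assms by (simp only:) (subst card_Un_disjoint, auto)
qed

text \<open>As no element is shared, every pair is an inversion for exactly one of the two
  orders.\<close>

lemma invs_swap:
  assumes "S \<inter> T = {}" shows "invs S T + invs T S = cd S * cd T"
proof -
  let ?A = "{p \<in> (S \<inter> {1..n}) \<times> (T \<inter> {1..n}). snd p < fst p}"
  let ?B = "{p \<in> (T \<inter> {1..n}) \<times> (S \<inter> {1..n}). snd p < fst p}"
  have "card ?B = card (prod.swap ` ?B)" by (simp add: card_image)
  also have "prod.swap ` ?B = {p \<in> (S \<inter> {1..n}) \<times> (T \<inter> {1..n}). fst p < snd p}"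
    by (auto simp: image_iff)
  finally have "invs S T + invs T S = card ?A + card {p \<in> (S \<inter> {1..n}) \<times> (T \<inter> {1..n}). fst p < snd p}"
    by (simp add: invs_def)
  also have "\<dots> = card (?A \<union> {p \<in> (S \<inter> {1..n}) \<times> (T \<inter> {1..n}). fst p < snd p})"
    by (rule card_Un_disjoint[symmetric]) auto
  also have "?A \<union> {p \<in> (S \<inter> {1..n}) \<times> (T \<inter> {1..n}). fst p < snd p} = (S \<inter> {1..n}) \<times> (T \<inter> {1..n})"
    using assms by (auto simp: set_eq_iff) (metis linorder_neqE_nat)+
  finally show ?thesis by (simp add: cd_def card_cartesian_product)
qed

lemma cc_empty [simp]: "cc {} S = 1" "cc S {} = 1"
  by (simp_all add: cc_def invs_def)

text \<open>The cocycle identity behind associativity: both sides count the inversions between each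
  two of the three sets, and vanish unless these are pairwise disjoint.\<close>

lemma cc_assoc: "cc a b * cc (a \<union> b) d = cc a (b \<union> d) * cc b d"
  by (auto simp: cc_def invs_Un_left invs_Un_right power_add Int_Un_distrib Int_Un_distrib2)

lemma cc_swap: "cc S T = (-1) ^ (cd S * cd T) * cc T S"
proof (cases "S \<inter> T = {}")
  case True
  have "(-1::'k) ^ (cd S * cd T) * (-1) ^ invs T S = (-1) ^ invs S T * ((-1) ^ invs T S * (-1) ^ invs T S)"
    by (simp add: invs_swap[OF True, symmetric] power_add mult.assoc)
  also have "(-1) ^ invs T S * (-1) ^ invs T S = (1::'k)"
    by (simp add: power_mult_distrib[symmetric])
  finally show ?thesis using True by (simp add: cc_def Int_commute)
next
  case False
  then show ?thesis by (auto simp: cc_def)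
qed

lemma cc_nz: "S \<inter> T = {} \<Longrightarrow> cc S T \<noteq> 0"
  by (simp add: cc_def)
lemma cc_z: "S \<inter> T \<noteq> {} \<Longrightarrow> cc S T = 0"
  by (simp add: cc_def)
lemma cc_sq: "S \<inter> T = {} \<Longrightarrow> cc S T * cc S T = 1"
  by (simp add: cc_def power_mult_distrib[symmetric])

text \<open>
  The list \<open>L\<close> stands for the tensor of the \<open>e\<^bsub>L ! i\<^esub>\<close>.  Then \<open>beta\<close> is Loday's \<open>b'\<close>, \<open>W\<close> is the last
  face with its sign, so that \<open>bb\<close> is \<open>b\<close>, and \<open>tt\<close>, \<open>NN\<close> are \<open>t\<close>, \<open>N\<close>, in all degrees at once.
\<close>
abbreviation cons :: "'s \<Rightarrow> ('s list \<Rightarrow>\<^sub>0 'k) \<Rightarrow> ('s list \<Rightarrow>\<^sub>0 'k)"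
  where "cons S \<equiv> lext (\<lambda>L. bas (S # L))"
abbreviation snoc :: "'s \<Rightarrow> ('s list \<Rightarrow>\<^sub>0 'k) \<Rightarrow> ('s list \<Rightarrow>\<^sub>0 'k)"
  where "snoc S \<equiv> lext (\<lambda>L. bas (L @ [S]))"
abbreviation sg :: "('s list \<Rightarrow>\<^sub>0 'k) \<Rightarrow> ('s list \<Rightarrow>\<^sub>0 'k)"
  where "sg \<equiv> lext (\<lambda>L. scl ((-1) ^ length L) (bas L))"

fun lm_b :: "nat set \<Rightarrow> nat set list \<Rightarrow> (nat set list \<Rightarrow>\<^sub>0 'k)" where
  "lm_b S [] = 0"
| "lm_b S (T # L) = scl (cc S T) (bas ((S \<union> T) # L))"
abbreviation "lm S \<equiv> lext (lm_b S)"

definition rm_b :: "nat set \<Rightarrow> nat set list \<Rightarrow> (nat set list \<Rightarrow>\<^sub>0 'k)" where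
  "rm_b S L = (if L = [] then 0 else scl (cc (last L) S) (bas (butlast L @ [last L \<union> S])))"
abbreviation "rm S \<equiv> lext (rm_b S)"

lemma rm_b_simps [simp]: "rm_b S [] = 0" "rm_b S (L @ [T]) = scl (cc T S) (bas (L @ [T \<union> S]))"
  by (simp_all add: rm_b_def)

fun beta_b :: "nat set list \<Rightarrow> (nat set list \<Rightarrow>\<^sub>0 'k)" where
  "beta_b [] = 0"
| "beta_b [S] = 0"
| "beta_b (S # T # L) = scl (cc S T) (bas ((S \<union> T) # L)) - cons S (beta_b (T # L))"
abbreviation "beta \<equiv> lext beta_b"

definition W_b :: "nat set list \<Rightarrow> (nat set list \<Rightarrow>\<^sub>0 'k)" where
  "W_b L = (if L = [] then 0 else lm (last L) (sg (bas (butlast L))))"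
abbreviation "W \<equiv> lext W_b"

lemma W_b_simps [simp]: "W_b [] = 0" "W_b (L @ [T]) = scl ((-1) ^ length L) (lm_b T L)"
  by (simp_all add: W_b_def)

definition t_b :: "'s list \<Rightarrow> ('s list \<Rightarrow>\<^sub>0 'k)" where
  "t_b L = (if L = [] then bas [] else scl ((-1) ^ (length L - 1)) (bas (last L # butlast L)))"
abbreviation "tt \<equiv> lext t_b"

lemma t_b_simps [simp]: "t_b [] = bas []" "t_b (L @ [T]) = scl ((-1) ^ length L) (bas (T # L))"
  by (simp_all add: t_b_def)

definition N_b :: "'s list \<Rightarrow> ('s list \<Rightarrow>\<^sub>0 'k)" where
  "N_b L = (\<Sum>i<length L. (tt ^^ i) (bas L))"
abbreviation "NN \<equiv> lext N_b"

abbreviation bb :: "(nat set list \<Rightarrow>\<^sub>0 'k) \<Rightarrow> (nat set list \<Rightarrow>\<^sub>0 'k)"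
  where "bb x \<equiv> beta x + W x"

lemma beta_cons: "beta (cons S x) = lm S x - cons S (beta x)"
proof (rule lin_eqI[where x=x])
  fix L show "beta (cons S (bas L)) = lm S (bas L) - cons S (beta (bas L))"
    by (cases L) auto
qed auto

lemma lm_cons: "lm S (cons T x) = scl (cc S T) (cons (S \<union> T) x)"
  by (rule lin_eqI[where x=x]) auto

lemma lm_lm: "lm S (lm T x) = scl (cc S T) (lm (S \<union> T) x)"
proof (rule lin_eqI[where x=x])
  fix L show "lm S (lm T (bas L)) = scl (cc S T) (lm (S \<union> T) (bas L))"
    by (cases L) (auto simp: cc_assoc mult.commute Un_assoc)
qed auto

lemma beta_lm: "beta (lm S x) = lm S (beta x)"
proof (rule lin_eqI[where x=x])
  fix L show "beta (lm S (bas L)) = lm S (beta (bas L))"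
  proof (cases L rule: beta_b.cases)
    case (3 T U L')
    have "cc S T * cc (S \<union> T) U = (cc T U * cc S (T \<union> U) :: 'k)"
      by (simp add: cc_assoc mult.commute)
    then show ?thesis using 3 by (simp add: lm_cons Un_assoc)
  qed auto
qed auto

text \<open>By \<open>beta_cons\<close> and \<open>beta_lm\<close> the two mixed terms
  \<open>lm S (beta x)\<close> cancel, so the square passes to the tail.\<close>

lemma beta_beta [simp]: "beta (beta x) = 0"
proof (rule lin_eqI[where x=x])
  fix L show "beta (beta (bas L)) = 0"
  proof (induction L)
    case (Cons S L)
    have "beta (beta (cons S (bas L))) = cons S (beta (beta (bas L)) :: nat set list \<Rightarrow>\<^sub>0 'k)"
      unfolding beta_cons lext_simps beta_lm by (simp add: beta_cons)
    then show ?case using Cons by simp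
  qed simp
qed auto

text \<open>A new last entry adds one inner face, the product of the last two entries. The sign of
  that face depends on the length, which is why \<open>sg\<close> appears.\<close>

lemma beta_snoc: "beta (snoc z x) = snoc z (beta x) - rm z (sg x)"
proof (rule lin_eqI[where x=x])
  fix L show "beta (snoc z (bas L)) = snoc z (beta (bas L)) - rm z (sg (bas L))"
  proof (induction L)
    case (Cons S L)
    show ?case
    proof (cases L)
      case Nil
      then show ?thesis by (simp add: rm_b_def)
    next
      case (Cons T L')
      have e: "snoc z (cons S x) = cons S (snoc z x)" for x :: "nat set list \<Rightarrow>\<^sub>0 'k"
        by (rule lin_eqI[where x=x]) auto
      have r: "rm_b z (S # L) = cons S (rm_b z L :: nat set list \<Rightarrow>\<^sub>0 'k)"
        using Cons by (simp add: rm_b_def)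
      show ?thesis using Cons.IH Cons r by (simp add: e[symmetric] flip: r)
    qed
  qed simp
qed auto

lemma sg_beta: "beta (sg x) = - sg (beta x)"
proof (rule lin_eqI[where x=x])
  fix L show "beta (sg (bas L)) = - sg (beta (bas L))"
  proof (induction L)
    case (Cons S L)
    have e: "sg (cons S x) = - cons S (sg x)" for x :: "nat set list \<Rightarrow>\<^sub>0 'k"
      by (rule lin_eqI[where x=x]) auto
    have l: "sg (lm S (bas L)) = lm S (sg (bas L) :: nat set list \<Rightarrow>\<^sub>0 'k)"
      by (cases L) (auto simp: mult.commute)
    have "beta (sg (cons S (bas L))) = - sg (beta (cons S (bas L)) :: nat set list \<Rightarrow>\<^sub>0 'k)"
      unfolding e beta_cons lext_simps l Cons by (simp add: beta_cons e Cons del: lext_bas)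
    then show ?case by simp
  qed simp
qed auto

lemma sg_lm: "sg (lm S x) = lm S (sg x)"
proof (rule lin_eqI[where x=x])
  fix L show "sg (lm S (bas L)) = lm S (sg (bas L))"
    by (cases L) (auto simp: mult.commute)
qed auto

lemma sg_cons: "sg (cons S x) = - cons S (sg x)"
  by (rule lin_eqI[where x=x]) auto

lemma W_snoc: "W (snoc z x) = lm z (sg x)"
  by (rule lin_eqI[where x=x]) auto

lemma t_snoc: "tt (snoc z x) = cons z (sg x)"
  by (rule lin_eqI[where x=x]) auto

lemma snoc_cons: "snoc u (cons z x) = cons z (snoc u x)"
  by (rule lin_eqI[where x=x]) auto

lemma W_cons: "W (cons z x) = - tt (rm z x)"
proof (rule lin_eqI[where x=x])
  fix L show "W (cons z (bas L)) = - tt (rm z (bas L))"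
  proof (cases L rule: rev_cases)
    case (snoc v u)
    then show ?thesis using W_b_simps(2)[of "z # v" u] by (simp add: mult.commute)
  next
    case Nil
    then show ?thesis by (simp add: W_b_def)
  qed
qed auto

text \<open>The first face of a rotated tensor is the old cyclic face, and its other faces are
  rotations of the old inner faces. Subtracted from \<open>bb x = beta x + W x\<close>, this gives
  \<open>b (1 - t) = (1 - t) b'\<close>.\<close>

lemma bb_t: "bb (tt x) = W x + tt (beta x)"
proof (rule lin_eqI[where x=x])
  fix L show "bb (tt (bas L)) = W (bas L) + tt (beta (bas L))"
  proof (cases L rule: rev_cases)
    case (snoc v u)
    have "bb (tt (snoc u (bas v :: nat set list \<Rightarrow>\<^sub>0 'k))) = W (snoc u (bas v)) + tt (beta (snoc u (bas v)))"
      unfolding t_snoc W_snoc beta_snoc beta_cons W_cons lext_simps sg_beta by simp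
    then show ?thesis using snoc by simp
  qed simp
qed auto

lemma bb_one_minus_t: "bb (x - tt x) = beta x - tt (beta x)"
  using bb_t[of x] by (simp add: algebra_simps)

text \<open>Associativity across the cyclic junction: \<open>z\<close> stands between the last and
  the first entry and may be multiplied into either.\<close>

lemma W_lm_rm: "W (lm z x) = W (rm z x)"
proof (rule lin_eqI[where x=x])
  fix L show "W (lm z (bas L)) = W (rm z (bas L))"
  proof (cases L rule: rev_cases)
    case (snoc v u)
    show ?thesis
    proof (cases "v = []")
      case True
      then show ?thesis using snoc by (simp add: rm_b_def W_b_def)
    next
      case False
      have "lm z (bas (v @ [u])) = snoc u (lm z (bas v) :: nat set list \<Rightarrow>\<^sub>0 'k)" using False by (cases v) auto
      then have "W (lm z (bas L)) = lm u (sg (lm z (bas v) :: nat set list \<Rightarrow>\<^sub>0 'k))" using snoc by (simp only: W_snoc)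
      also have "\<dots> = scl (cc u z) (lm (u \<union> z) (sg (bas v)))" by (simp only: sg_lm lm_lm)
      finally show ?thesis using snoc by simp
    qed
  qed simp
qed auto

text \<open>Split off the last entry \<open>u\<close>. The terms \<open>lm u (beta (sg v))\<close>
  coming from \<open>beta W\<close> and from \<open>W beta\<close> cancel by \<open>sg_beta\<close>,
  and the double products across the junction cancel by \<open>W_lm_rm\<close>.\<close>

lemma bb_bb: "bb (bb x) = 0"
proof (rule lin_eqI[where x=x])
  fix L show "bb (bb (bas L)) = 0"
  proof (cases L rule: rev_cases)
    case (snoc v u)
    have "bb (bb (snoc u (bas v :: nat set list \<Rightarrow>\<^sub>0 'k))) = 0"
      using W_lm_rm[of u "sg (bas v :: nat set list \<Rightarrow>\<^sub>0 'k)"] beta_beta[of "snoc u (bas v :: nat set list \<Rightarrow>\<^sub>0 'k)"]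
      by (simp add: beta_snoc W_snoc beta_lm sg_beta del: lext_bas)
    then show ?thesis using snoc by simp
  qed simp
qed auto

text \<open>The extra degeneracy: multiplying the new unit into the first entry restores the list.
  Hence the columns with differential \<open>beta\<close> are exact. The list \<open>[]\<close> is
  excluded because \<open>[{}]\<close> has no inner face.\<close>

lemma beta_contract: "[] \<notin> keys x \<Longrightarrow> beta (cons {} x) + cons {} (beta x) = x"
proof (rule lin_eq_on[where f="\<lambda>x. beta (cons {} x) + cons {} (beta x)"])
  fix L assume "[] \<notin> keys x" "L \<in> keys x"
  then have "L \<noteq> []" by auto
  then show "beta (cons {} (bas L)) + cons {} (beta (bas L)) = bas L"
    by (cases L) auto
qed auto

text \<open>The form by position, from which each face is recognised as a conjugate of the first one
  under rotation.\<close>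

lemma beta_index:
  "beta_b L = (\<Sum>l<length L - 1. scl ((-1) ^ l * cc (L ! l) (L ! Suc l))
     (bas (take l L @ (L ! l \<union> L ! Suc l) # drop (l + 2) L)) :: nat set list \<Rightarrow>\<^sub>0 'k)"
proof (induction L rule: beta_b.induct)
  case (3 S T L)
  have "beta_b (S # T # L) = scl (cc S T) (bas ((S \<union> T) # L)) - cons S (beta_b (T # L) :: nat set list \<Rightarrow>\<^sub>0 'k)"
    by simp
  also have "\<dots> = (\<Sum>l<Suc (length L). scl ((-1) ^ l * cc ((S # T # L) ! l) ((S # T # L) ! Suc l))
     (bas (take l (S # T # L) @ ((S # T # L) ! l \<union> (S # T # L) ! Suc l) # drop (l + 2) (S # T # L))))"
    unfolding 3 by (subst sum.lessThan_Suc_shift) (simp add: sum_negf)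
  finally show ?case by simp
qed auto

section \<open>Rotations and the norm\<close>

lemma lin_tpow: "lin (tt ^^ i :: ('s list \<Rightarrow>\<^sub>0 'k) \<Rightarrow> _)"
  by (induction i) auto

lemmas tpow_simps [simp] = lin_rules[OF lin_tpow]

lemma lin_tpow_comp [intro!]: "lin f \<Longrightarrow> lin (\<lambda>x. (tt ^^ i) (f x))"
  by (rule lin_comp[OF lin_tpow])

text \<open>Every single rotation of a list of length \<open>r\<close> contributes the sign
  \<open>(-1)^(r - 1)\<close>, and \<open>length A\<close> rotations bring the block
  \<open>A\<close> to the front.\<close>

lemma tpow_rotate:
  "(tt ^^ length A) (bas (C @ A)) = scl ((-1) ^ (length A * (length C + length A - 1))) (bas (A @ C) :: 's list \<Rightarrow>\<^sub>0 'k)"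
proof (induction A arbitrary: C rule: rev_induct)
  case (snoc z A)
  have "(tt ^^ length (A @ [z])) (bas (C @ A @ [z]) :: 's list \<Rightarrow>\<^sub>0 'k) = (tt ^^ length A) (tt (bas ((C @ A) @ [z])))"
    by (simp add: funpow_swap1)
  also have "\<dots> = scl ((-1) ^ (length C + length A)) ((tt ^^ length A) (bas ((z # C) @ A)))"
    by (simp del: append_assoc)
  also have "\<dots> = scl ((-1) ^ (length C + length A) * (-1) ^ (length A * (length C + length A))) (bas (A @ z # C))"
    unfolding snoc by simp
  also have "(-1::'k) ^ (length C + length A) * (-1) ^ (length A * (length C + length A)) =
      (-1) ^ (length (A @ [z]) * (length C + length (A @ [z]) - 1))"
    by (simp add: power_add[symmetric])
  finally show ?case by simp
qed simp

text \<open>A full turn collects the sign \<open>(-1)^(r (r - 1))\<close>, and one of two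
  consecutive numbers is even.\<close>

lemma tpow_full_bas: "(tt ^^ length L) (bas L) = (bas L :: 's list \<Rightarrow>\<^sub>0 'k)"
proof -
  have "even (length L * (length L - 1))" by (cases "length L") auto
  then show ?thesis using tpow_rotate[of L "[]"] by (simp add: uminus_power_if del: even_mult_iff)
qed

definition hom :: "nat \<Rightarrow> ('s list \<Rightarrow>\<^sub>0 'k) \<Rightarrow> bool"
  where "hom r x \<longleftrightarrow> keys x \<subseteq> {L. length L = r}"

lemma hom_bas [simp]: "hom r (bas L) \<longleftrightarrow> length L = r"
  by (simp add: hom_def)
lemma hom_scl: "hom r x \<Longrightarrow> hom r (scl c x)" unfolding hom_def by (rule keysI)
lemma hom_add: "hom r x \<Longrightarrow> hom r y \<Longrightarrow> hom r (x + y)" unfolding hom_def by (rule keysI)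
lemma hom_sum: "(\<And>i. i \<in> I \<Longrightarrow> hom r (f i)) \<Longrightarrow> hom r (\<Sum>i\<in>I. f i)" unfolding hom_def by (rule keysI)
lemma hom_0 [simp]: "hom r 0" by (simp add: hom_def)

lemma hom_lin: "lin f \<Longrightarrow> hom r x \<Longrightarrow> (\<And>L. length L = r \<Longrightarrow> hom r' (f (bas L))) \<Longrightarrow> hom r' (f x)"
  unfolding hom_def by (rule lin_keys) auto

lemma hom_tt: "hom r x \<Longrightarrow> hom r (tt x :: 's list \<Rightarrow>\<^sub>0 'k)"
  by (rule hom_lin[where f=tt]) (auto simp: t_b_def intro!: hom_scl)

lemma hom_tpow: "hom r x \<Longrightarrow> hom r ((tt ^^ i) x :: 's list \<Rightarrow>\<^sub>0 'k)"
  by (induction i) (auto intro: hom_tt)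

lemma hom_eq:
  assumes "lin f" "lin g" "hom r x" "\<And>L. length L = r \<Longrightarrow> f (bas L) = g (bas L)"
  shows "f x = g x"
proof (rule lin_eq_on[OF assms(1,2)])
  fix s assume "s \<in> keys x"
  then have "length s = r" using assms(3) unfolding hom_def by blast
  then show "f (bas s) = g (bas s)" by (rule assms(4))
qed

lemma NN_hom: "hom r x \<Longrightarrow> NN x = (\<Sum>i<r. (tt ^^ i) (x :: 's list \<Rightarrow>\<^sub>0 'k))"
  by (rule hom_eq[where f=NN]) (auto simp: N_b_def)

text \<open>The orbit sum is shifted by one place; the term that enters equals the term that leaves
  because a full turn is the identity.\<close>

lemma NN_t: "NN (tt x) = NN (x :: 's list \<Rightarrow>\<^sub>0 'k)"
proof (rule lin_eqI[where x=x])
  fix L :: "'s list"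
  have "(\<Sum>i<length L. (tt ^^ i) (tt (bas L :: _ \<Rightarrow>\<^sub>0 'k))) = (\<Sum>i<length L. (tt ^^ Suc i) (bas L))"
    by (simp add: funpow_swap1)
  also have "\<dots> = (\<Sum>i<Suc (length L). (tt ^^ i) (bas L)) - bas L"
    using sum.lessThan_Suc_shift[of "\<lambda>i. (tt ^^ i) (bas L :: _ \<Rightarrow>\<^sub>0 'k)" "length L"]
    by (simp only: funpow_0 id_apply add_diff_cancel_left')
  also have "\<dots> = (\<Sum>i<length L. (tt ^^ i) (bas L))" by (simp add: tpow_full_bas)
  finally show "NN (tt (bas L)) = NN (bas L :: _ \<Rightarrow>\<^sub>0 'k)"
    using NN_hom[OF hom_tt, of "length L" "bas L"] by (simp add: N_b_def)
qed auto

lemma t_NN: "tt (NN x) = NN (x :: 's list \<Rightarrow>\<^sub>0 'k)"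
proof -
  have "tt (NN x) = NN (tt x)"
  proof (rule lin_eqI[where x=x])
    fix L :: "'s list"
    show "tt (NN (bas L)) = NN (tt (bas L :: _ \<Rightarrow>\<^sub>0 'k))"
      using NN_hom[OF hom_tt, of "length L" "bas L"] by (simp add: N_b_def funpow_swap1)
  qed auto
  then show ?thesis by (simp add: NN_t)
qed

lemma tpow_NN: "(tt ^^ i) (NN x) = NN (x :: 's list \<Rightarrow>\<^sub>0 'k)"
  by (induction i) (auto simp: t_NN)

lemma NN_tpow: "NN ((tt ^^ i) x) = NN (x :: 's list \<Rightarrow>\<^sub>0 'k)"
  by (induction i) (auto simp: NN_t)

lemma hom_NN: "hom r x \<Longrightarrow> hom r (NN x :: 's list \<Rightarrow>\<^sub>0 'k)"
  by (subst NN_hom) (auto intro!: hom_sum hom_tpow)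

section \<open>Faces as conjugates of the first face, and the relation
  \<open>b' N = N b\<close>\<close>

fun d0_b :: "nat set list \<Rightarrow> (nat set list \<Rightarrow>\<^sub>0 'k)" where
  "d0_b (S # L) = lm_b S L"
| "d0_b [] = 0"
abbreviation "d0 \<equiv> lext d0_b"

lemma W_d0: "W x = d0 (tt x)"
proof (rule lin_eqI[where x=x])
  fix L show "W (bas L) = d0 (tt (bas L))" by (cases L rule: rev_cases) auto
qed auto

text \<open>The face at position \<open>l\<close> is \<open>t^l d_0 t^(-l)\<close>. On lists of
  length \<open>r\<close> the inner power is \<open>t^(r - l)\<close>; the outer one acts on lists
  that are shorter by one, and the difference in the rotation signs is exactly the sign
  \<open>(-1)^l\<close> of the face.\<close>

lemma beta_rot_bas:
  "beta_b L = (\<Sum>l<length L - 1. (tt ^^ l) (d0 ((tt ^^ (length L - l)) (bas L))))"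
  unfolding beta_index
proof (rule sum.cong[OF refl])
  fix l assume "l \<in> {..<length L - 1}"
  then have l: "Suc l < length L" by auto
  define A where "A = take l L"
  define u where "u = L ! l" define v where "v = L ! Suc l"
  define B where "B = drop (l + 2) L"
  have L: "L = A @ u # v # B"
    unfolding A_def u_def v_def B_def using l
    by (metis Cons_nth_drop_Suc Suc_lessD add_2_eq_Suc' append_take_drop_id)
  have lA: "length A = l" using l by (simp add: A_def)
  have 1: "length L - l = length (u # v # B)" using L lA by simp
  have "(tt ^^ (length L - l)) (bas L) =
      scl ((-1) ^ ((length B + 2) * (l + (length B + 2) - 1))) (bas (u # v # B @ A) :: nat set list \<Rightarrow>\<^sub>0 'k)"
    unfolding 1 unfolding L by (subst tpow_rotate) (simp add: lA)
  then have "(tt ^^ l) (d0 ((tt ^^ (length L - l)) (bas L) :: nat set list \<Rightarrow>\<^sub>0 'k)) =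
    scl ((-1) ^ ((length B + 2) * (l + (length B + 2) - 1)) * cc u v) ((tt ^^ length A) (bas (((u \<union> v) # B) @ A)))"
    by (simp add: lA)
  also have "\<dots> = scl (((-1) ^ ((length B + 2) * (l + (length B + 2) - 1)) * (-1) ^ (l * (length B + l))) * cc u v)
     (bas (A @ (u \<union> v) # B))"
    by (subst tpow_rotate) (simp add: lA mult.commute mult.left_commute)
  \<comment> \<open>With \<open>b = length B\<close> the exponents add up modulo 2 to
    \<open>b (l + b + 1) + l b + l\<close>, which is \<open>l\<close> because
    \<open>b (b + 1)\<close> is even.\<close>
  also have "(-1::'k) ^ ((length B + 2) * (l + (length B + 2) - 1)) * (-1) ^ (l * (length B + l)) = (-1) ^ l"
    unfolding power_add[symmetric] by (rule minus_one_power_iff[THEN trans]) (simp add: minus_one_power_iff)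
  finally show "scl ((-1) ^ l * cc (L ! l) (L ! Suc l)) (bas (take l L @ (L ! l \<union> L ! Suc l) # drop (l + 2) L)) =
     (tt ^^ l) (d0 ((tt ^^ (length L - l)) (bas L)))"
    by (simp add: A_def u_def v_def B_def)
qed

lemma beta_rot: "hom r x \<Longrightarrow> beta x = (\<Sum>l<r - 1. (tt ^^ l) (d0 ((tt ^^ (r - l)) x)))"
  by (rule hom_eq[where f=beta]) (auto simp: beta_rot_bas)

lemma hom_d0: "hom r x \<Longrightarrow> hom (r - 1) (d0 x)"
proof (rule hom_lin[where f=d0])
  fix L :: "nat set list" assume "length L = r"
  then show "hom (r - 1) (d0 (bas L))"
    by (cases L rule: beta_b.cases) (auto intro!: hom_scl)
qed auto

lemma hom_beta: "hom r x \<Longrightarrow> hom (r - 1) (beta x)"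
  by (subst beta_rot, assumption, intro hom_sum hom_tpow hom_d0)

lemma hom_W: "hom r x \<Longrightarrow> hom (r - 1) (W x)"
  unfolding W_d0 by (intro hom_d0 hom_tt)

lemma hom_bb: "hom r x \<Longrightarrow> hom (r - 1) (bb x)"
  by (intro hom_add hom_beta hom_W)

text \<open>Both sides equal \<open>N d_0 N\<close>. On the left the inner rotations are absorbed by
  the norm, and the outer ones, on tensors of length \<open>r - 1\<close>, form a new norm. On the
  right the outer rotations are absorbed; the inner exponents \<open>r - l\<close> run through
  \<open>2..r\<close>, and the cyclic face \<open>W = d_0 t\<close> supplies the exponent 1.\<close>

lemma beta_NN: "beta (NN x) = NN (bb x)"
proof (rule lin_eqI[where x=x])
  fix L :: "nat set list"
  define r where "r = length L"
  define y :: "nat set list \<Rightarrow>\<^sub>0 'k" where "y = bas L"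
  have y: "hom r y" by (simp add: y_def r_def)
  have 1: "beta (NN y) = (\<Sum>l<r - 1. (tt ^^ l) (d0 (NN y)))"
    by (subst beta_rot[OF hom_NN[OF y]]) (simp add: tpow_NN)
  show "beta (NN (bas L)) = NN (bb (bas L))"
  proof (cases "r = 0")
    case True
    then show ?thesis by (simp add: r_def N_b_def)
  next
    case False
    have "(\<Sum>l<r - 1. (tt ^^ (r - l)) y) = (\<Sum>i\<in>{2..r}. (tt ^^ i) y)"
      by (rule sum.reindex_bij_witness[of _ "\<lambda>i. r - i" "\<lambda>l. r - l"]) auto
    then have "(\<Sum>l<r - 1. (tt ^^ (r - l)) y) + tt y = (\<Sum>i\<in>insert 1 {2..r}. (tt ^^ i) y)"
      by simp
    also have "insert 1 {2..r} = {1..<Suc r}" using False by auto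
    also have "(\<Sum>i\<in>{1..<Suc r}. (tt ^^ i) y) = (\<Sum>i<r. (tt ^^ Suc i) y)"
      by (rule sum.reindex_bij_witness[of _ Suc "\<lambda>l. l - 1"]) auto
    also have "\<dots> = tt (NN y)" by (simp add: NN_hom[OF y])
    finally have 2: "(\<Sum>l<r - 1. (tt ^^ (r - l)) y) + tt y = NN y" by (simp add: t_NN)
    have "NN (bb y) = NN (\<Sum>l<r - 1. (tt ^^ l) (d0 ((tt ^^ (r - l)) y))) + NN (d0 (tt y))"
      by (simp add: beta_rot[OF y] W_d0)
    also have "\<dots> = NN (d0 ((\<Sum>l<r - 1. (tt ^^ (r - l)) y) + tt y))"
      by (simp add: NN_tpow)
    also have "\<dots> = NN (d0 (NN y))" by (simp only: 2)
    also have "\<dots> = (\<Sum>l<r - 1. (tt ^^ l) (d0 (NN y)))"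
      by (rule NN_hom) (intro hom_d0 hom_NN y)
    finally show ?thesis using 1 by (simp add: y_def)
  qed
qed auto

section \<open>Normalisation and the matching\<close>

text \<open>A homotopy against unit entries: the first unit is doubled, with the sign of its
  position, and the faces around the two copies recover the original. \<open>H_b\<close> skips the
  head, because normalisation concerns only the other entries.\<close>

fun hl_b :: "nat set list \<Rightarrow> (nat set list \<Rightarrow>\<^sub>0 'k)" where
  "hl_b [] = 0"
| "hl_b (S # L) = (if S = {} then bas ({} # {} # L) else - cons S (hl_b L))"
abbreviation "hl \<equiv> lext hl_b"

fun H_b :: "nat set list \<Rightarrow> (nat set list \<Rightarrow>\<^sub>0 'k)" where
  "H_b [] = 0"
| "H_b (S # L) = - cons S (hl_b L)"
abbreviation "H \<equiv> lext H_b"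

lemma hl_cons: "hl (cons S x) = (if S = {} then cons {} (cons {} x) else - cons S (hl x))"
  by (cases "S = {}"; simp; rule lin_eqI[where x=x]; auto)

lemma H_cons: "H (cons S x) = - cons S (hl x)"
  by (rule lin_eqI[where x=x]) auto

lemma H_lm: "H (lm S x) = lm S (H x)"
proof (rule lin_eqI[where x=x])
  fix L show "H (lm S (bas L)) = lm S (H (bas L))" by (cases L) (auto simp: lm_cons)
qed auto

lemma hl_lm: "S \<noteq> {} \<Longrightarrow> hl (lm S x) = H (lm S x)"
proof (rule lin_eqI[where x=x])
  fix L assume "S \<noteq> {}"
  then show "hl (lm S (bas L)) = H (lm S (bas L))" by (cases L) auto
qed auto

lemma hl_beta_cons: "S \<noteq> {} \<Longrightarrow> hl (beta (cons S x)) = H (beta (cons S x))"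
  by (simp add: beta_cons hl_lm hl_cons H_cons)

text \<open>The two copies of a doubled unit have three adjacent faces, each of which returns the
  list; as the signs alternate, one copy survives. A first unit in the last place lacks an inner
  face on its right. Its third face is the cyclic one, which \<open>W_H\<close> accounts
  for.\<close>

lemma beta_H:
  "beta (H (bas (F # L))) + H (beta (bas (F # L))) = (if {} \<in> set (butlast L) then - bas (F # L) else 0)"
proof (induction L arbitrary: F)
  case (Cons S L)
  show ?case
  proof (cases "S = {}")
    case True
    then show ?thesis
      by (cases L) (simp_all add: beta_cons H_cons hl_cons lm_cons)
  next
    case False
    let ?x = "bas L :: nat set list \<Rightarrow>\<^sub>0 'k"
    let ?y = "cons S ?x"
    have "beta (H (cons F ?y)) + H (beta (cons F ?y)) = cons F (beta (H ?y) + H (beta ?y))"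
      using False by (simp add: beta_cons[of F] beta_cons[of S "hl _"] H_cons hl_cons hl_beta_cons lm_cons H_lm del: lext_bas)
    also have "beta (H ?y) + H (beta ?y) = (if {} \<in> set (butlast L) then - bas (S # L) else 0)"
      using Cons.IH[of S] by simp
    finally show ?thesis using False by (cases "L = []") auto
  qed
qed simp

lemma sg_hl: "sg (hl x) = - hl (sg x)"
proof (rule lin_eqI[where x=x])
  fix L show "sg (hl (bas L)) = - hl (sg (bas L))"
    by (induction L) (auto simp: sg_cons)
qed auto

lemma sg_H: "sg (H x) = - H (sg x)"
proof (rule lin_eqI[where x=x])
  fix L show "sg (H (bas L)) = - H (sg (bas L))"
    using sg_hl[of "bas (tl L)"] by (cases L) (auto simp: sg_cons)
qed auto

lemma hl_snoc:
  "hl_b (M @ [z]) = snoc z (hl_b M) + (if {} \<notin> set M \<and> z = {} then scl ((-1) ^ length M) (bas (M @ [{}, {}])) else 0)"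
  by (induction M) (auto simp: snoc_cons)

lemma W_H:
  "W (H (bas (F # L))) + H (W (bas (F # L))) =
    (if L \<noteq> [] \<and> {} \<notin> set (butlast L) \<and> last L = {} then - bas (F # L) else 0)"
proof (cases L rule: rev_cases)
  case Nil
  then show ?thesis by (simp add: W_b_def)
next
  case (snoc M z)
  let ?e = "if {} \<notin> set M \<and> z = {} then scl ((-1) ^ length M) (bas (F # M @ [{}, {}])) else 0 :: nat set list \<Rightarrow>\<^sub>0 'k"
  have HH: "H (bas (F # L)) = snoc z (H (bas (F # M))) - ?e"
    using snoc by (simp add: hl_snoc snoc_cons)
  have "W (bas ((F # M @ [{}]) @ [{}])) = scl ((-1) ^ length M) (bas (F # M @ [{}]) :: nat set list \<Rightarrow>\<^sub>0 'k)"
    unfolding lext_bas W_b_simps(2) by simp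
  then have We: "W ?e = (if {} \<notin> set M \<and> z = {} then bas (F # L) else 0)"
    using snoc by (auto simp: power_mult_distrib[symmetric])
  have "W (snoc z (H (bas (F # M)))) = lm z (sg (H (bas (F # M))))" by (rule W_snoc)
  moreover have "H (W (bas (F # L))) = H (lm z (sg (bas (F # M))))"
    using snoc W_snoc[of z "bas (F # M)"] by simp
  moreover have "H (lm z (sg (bas (F # M)))) = - lm z (sg (H (bas (F # M))))"
    by (simp add: H_lm sg_H del: lext_bas)
  ultimately show ?thesis unfolding HH using We snoc by simp
qed

text \<open>Consequently, for a Hochschild cycle \<open>f\<close>, the homologous cycle
  \<open>f + bb (H f)\<close> is the part of \<open>f\<close> without units beyond the head.\<close>

lemma bb_H:
  "bb (H x) + H (bb x) = - lext (\<lambda>L. if {} \<in> set (tl L) then bas L else 0) x"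
proof (rule lin_eqI[where x=x])
  fix L show "bb (H (bas L)) + H (bb (bas L)) = - lext (\<lambda>L. if {} \<in> set (tl L) then bas L else 0) (bas L)"
  proof (cases L)
    case (Cons F L')
    have "bb (H (bas L)) + H (bb (bas L)) = (beta (H (bas (F # L'))) + H (beta (bas (F # L')))) +
       (W (H (bas (F # L'))) + H (W (bas (F # L'))))"
      unfolding Cons by (simp only: lext_simps algebra_simps)
    also have "\<dots> = - (if {} \<in> set L' then bas (F # L') else 0)"
      unfolding beta_H W_H by (cases L' rule: rev_cases) auto
    finally show ?thesis using Cons by simp
  qed simp
qed auto

section \<open>The matching of lists by splitting and merging\<close>

definition good :: "nat set \<Rightarrow> bool" where "good S \<longleftrightarrow> S \<noteq> {} \<and> S \<subseteq> {1..n}"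

lemma goodD: assumes "good S" shows "finite S" "Max S \<in> S" "Max S \<le> n" "S \<noteq> {}"
proof -
  show f: "finite S" and ne: "S \<noteq> {}" using assms finite_subset unfolding good_def by auto
  show "Max S \<in> S" using f ne by (rule Max_in)
  then show "Max S \<le> n" using assms unfolding good_def by auto
qed

lemma good_small: "good S \<Longrightarrow> \<not> 2 \<le> card S \<Longrightarrow> S = {Max S}"
proof -
  assume g: "good S" "\<not> 2 \<le> card S"
  have "card S \<noteq> 0" using goodD[OF g(1)] by auto
  then have "card S = 1" using g(2) by simp
  then show ?thesis by (metis Max_singleton card_1_singletonE)
qed

text \<open>The first defect from the left decides. Class 1, the sources: a set that can be split.
  Class 2, their partners: a descent of maxima after a singleton, which can be merged. Class 0, the
  critical lists: weakly increasing singletons.\<close>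

fun cls :: "nat set list \<Rightarrow> nat" where
  "cls [] = 0"
| "cls [S] = (if 2 \<le> card S then 1 else 0)"
| "cls (S # T # L) = (if 2 \<le> card S then 1 else if Max T < Max S then 2 else cls (T # L))"

fun spl :: "nat set list \<Rightarrow> nat set list" where
  "spl [] = []"
| "spl (S # L) = (if 2 \<le> card S then {Max S} # (S - {Max S}) # L else S # spl L)"

fun mrg :: "nat set list \<Rightarrow> nat set list" where
  "mrg (S # T # L) = (if Max T < Max S then (S \<union> T) # L else S # mrg (T # L))"
| "mrg L = L"

lemma Max_diff_less: "finite S \<Longrightarrow> 2 \<le> card S \<Longrightarrow> Max (S - {Max S}) < Max S \<and> S - {Max S} \<noteq> {}"
proof -
  assume S: "finite S" "2 \<le> card S"
  have "S \<noteq> {}" using S by auto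
  then have "card (S - {Max S}) = card S - 1" using S by simp
  then have ne: "S - {Max S} \<noteq> {}" using S by (metis card.empty diff_is_0_eq not_less_eq_eq numeral_2_eq_2 One_nat_def)
  have m: "Max (S - {Max S}) \<in> S - {Max S}" using ne S by (intro Max_in) auto
  then have "Max (S - {Max S}) \<le> Max S" using S by (intro Max_ge) auto
  moreover have "Max (S - {Max S}) \<noteq> Max S" using m by auto
  ultimately show ?thesis using ne by simp
qed

text \<open>Splitting keeps the maximum of the entry at its place, so no descent arises further
  left, while the two parts themselves form a descent. Thus the first defect stays where it was and
  \<open>mrg\<close> undoes the split. The clauses on the head carry the induction.\<close>

lemma spl_props:
  assumes "\<forall>S\<in>set L. good S" "cls L = 1"
  shows "(\<forall>S\<in>set (spl L). good S) \<and> cls (spl L) = 2 \<and> mrg (spl L) = L \<and> length (spl L) = Suc (length L) \<and>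
     spl L \<noteq> [] \<and> Max (hd (spl L)) = Max (hd L) \<and> card (hd (spl L)) = 1 \<and> L \<noteq> []"
  using assms
proof (induction L rule: cls.induct)
  case (2 S)
  have c: "2 \<le> card S" using 2 by (simp split: if_splits)
  have "good S" using 2 by simp
  then show ?case using c Max_diff_less[of S] goodD[of S] by (auto simp: good_def insert_absorb)
next
  case (3 S T L)
  have gS: "good S" using 3 by simp
  show ?case
  proof (cases "2 \<le> card S")
    case True
    then show ?thesis using gS 3 Max_diff_less[of S] goodD[of S] by (auto simp: good_def insert_absorb)
  next
    case False
    then have nm: "\<not> Max T < Max S" and c: "cls (T # L) = 1" using 3 by (auto split: if_splits)
    have IH: "(\<forall>S\<in>set (spl (T # L)). good S) \<and> cls (spl (T # L)) = 2 \<and> mrg (spl (T # L)) = T # L \<and>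
      length (spl (T # L)) = Suc (length (T # L)) \<and> spl (T # L) \<noteq> [] \<and> Max (hd (spl (T # L))) = Max T"
      using 3(1)[OF False nm _ c] 3(2) by simp
    obtain U M where UM: "spl (T # L) = U # M" using IH by (cases "spl (T # L)") auto
    have cS: "card S = 1" using good_small[OF gS False] by (metis card_1_singleton_iff One_nat_def)
    have s: "spl (S # T # L) = S # U # M" using False UM by simp
    have nm': "\<not> Max U < Max S" using IH UM nm by simp
    show ?thesis unfolding s using IH UM gS False nm' cS by simp
  qed
qed auto

text \<open>At the first descent the left entry is a singleton larger than everything in its
  neighbour. It is therefore the maximum of the union and not in the neighbour, so splitting the
  union gives the same two entries.\<close>

lemma mrg_props:
  assumes "\<forall>S\<in>set L. good S" "cls L = 2"
  shows "(\<forall>S\<in>set (mrg L). good S) \<and> cls (mrg L) = 1 \<and> spl (mrg L) = L \<and> mrg L \<noteq> [] \<and> Max (hd (mrg L)) = Max (hd L)"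
  using assms
proof (induction L rule: cls.induct)
  case (2 S)
  then show ?case by (simp split: if_splits)
next
  case (3 S T L)
  have gS: "good S" and gT: "good T" using 3 by auto
  have cS: "\<not> 2 \<le> card S" using 3 by (auto split: if_splits)
  have S: "S = {Max S}" by (rule good_small[OF gS cS])
  show ?case
  proof (cases "Max T < Max S")
    case True
    have fT: "finite T" "T \<noteq> {}" using gT goodD by auto
    have nT: "Max S \<notin> T" using True fT Max_ge[of T "Max S"] by auto
    have m: "Max (S \<union> T) = Max S"
      using True fT gS goodD(1,4)[of S] by (simp add: Max_Un)
    have "{Max S} \<inter> T = {}" using nT by simp
    then have ST0: "S \<inter> T = {}" using S by simp
    then have "card (S \<union> T) = card S + card T"
      using fT goodD(1)[OF gS] by (simp add: card_Un_disjoint)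
    moreover have "card S > 0" "card T > 0" using fT goodD[OF gS] by (simp_all add: card_gt_0_iff)
    ultimately have c: "2 \<le> card (S \<union> T)" by simp
    have d2: "{Max S} = S" by (rule S[symmetric])
    have d: "S \<union> T - S = T" using ST0 by blast
    have "spl ((S \<union> T) # L) = S # T # L"
      using c by (simp only: spl.simps if_True m d d2)
    moreover have "cls ((S \<union> T) # L) = 1" using c by (cases L) simp_all
    moreover have "good (S \<union> T)" using gS gT by (auto simp: good_def)
    ultimately show ?thesis using True 3(2) m by simp
  next
    case False
    have c: "cls (T # L) = 2" using 3 False cS by (auto split: if_splits)
    have IH: "(\<forall>S\<in>set (mrg (T # L)). good S) \<and> cls (mrg (T # L)) = 1 \<and> spl (mrg (T # L)) = T # L \<and>
       mrg (T # L) \<noteq> [] \<and> Max (hd (mrg (T # L))) = Max T"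
      using 3(1)[OF cS False _ c] 3(2) by simp
    obtain U M where UM: "mrg (T # L) = U # M" using IH by (cases "mrg (T # L)") auto
    have s: "mrg (S # T # L) = S # U # M" using False UM by simp
    have nm': "\<not> Max U < Max S" using IH UM False by simp
    show ?thesis unfolding s using IH UM gS cS nm' by simp
  qed
qed simp

text \<open>Larger maxima count as smaller, because absorbing the right neighbour into a singleton
  raises a maximum; \<open>n - Max\<close> makes this well-founded. The cardinality covers the case
  where an entry is replaced by its own maximum.\<close>

definition lexr :: "(nat set list \<times> nat set list) set"
  where "lexr = inv_image (lenlex (less_than <*lex*> less_than)) (map (\<lambda>S. (n - Max S, card S)))"

lemma lexr_Cons: "length K = length L \<Longrightarrow> (S # K, T # L) \<in> lexr \<longleftrightarrow>
   n - Max S < n - Max T \<or> n - Max S = n - Max T \<and> (card S < card T \<or> card S = card T \<and> (K, L) \<in> lexr)"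
  unfolding lexr_def by (auto simp: Cons_lenlex_iff)

text \<open>The face that multiplies the two parts of the split returns \<open>L\<close>. If the
  head was split, all other lists begin with \<open>{Max S}\<close>, of equal maximum and smaller
  cardinality. Otherwise the first face raises the maximum of the head, and the remaining faces are
  covered by induction.\<close>

lemma spl_beta:
  assumes "\<forall>S\<in>set L. good S" "cls L = 1"
  shows "\<exists>u r. u \<noteq> 0 \<and> beta (bas (spl L)) = scl u (bas L) + r \<and> hom (length L) r \<and>
    (\<forall>K\<in>keys r. cls K = 1 \<longrightarrow> (K, L) \<in> lexr)"
  using assms
proof (induction L)
  case (Cons S L)
  have gS: "good S" using Cons by simp
  show ?case
  proof (cases "2 \<le> card S")
    case True
    define T where "T = S - {Max S}"
    have ST: "{Max S} \<union> T = S" "{Max S} \<inter> T = {}" using goodD(2)[OF gS] by (auto simp: T_def)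
    let ?r = "- cons {Max S} (beta (bas (T # L))) :: nat set list \<Rightarrow>\<^sub>0 'k"
    have s: "spl (S # L) = {Max S} # T # L" using True by (simp add: T_def)
    have "beta (bas (spl (S # L))) = scl (cc {Max S} T) (bas (S # L)) + ?r"
      unfolding s using ST by simp
    moreover have "(cc {Max S} T :: 'k) \<noteq> 0" using ST cc_nz by blast
    moreover have hb: "hom (length L) (beta (bas (T # L)))"
      using hom_beta[of "length (T # L)" "bas (T # L)"] by simp
    have "keys ?r \<subseteq> {K. length K = Suc (length L) \<and> (K, S # L) \<in> lexr}"
    proof -
      have "keys (cons {Max S} (beta (bas (T # L))) :: nat set list \<Rightarrow>\<^sub>0 'k) \<subseteq> {K. length K = Suc (length L) \<and> (K, S # L) \<in> lexr}"
        using hb True by (intro keys_lext) (auto simp: hom_def lexr_Cons)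
      then show ?thesis by simp
    qed
    ultimately show ?thesis by (intro exI[of _ "cc {Max S} T"] exI[of _ ?r]) (auto simp: hom_def)
  next
    case False
    obtain T L' where L: "L = T # L'" using Cons(3) False by (cases L) auto
    have nm: "\<not> Max T < Max S" and c: "cls L = 1" using Cons(3) False L by (auto split: if_splits)
    have gL: "\<forall>S\<in>set L. good S" using Cons by simp
    obtain u r where ur: "u \<noteq> 0" "beta (bas (spl L)) = scl u (bas L) + r" "hom (length L) r"
      "\<forall>K\<in>keys r. cls K = 1 \<longrightarrow> (K, L) \<in> lexr" using Cons.IH[OF gL c] by blast
    have sp: "(\<forall>S\<in>set (spl L). good S) \<and> length (spl L) = Suc (length L) \<and>
     spl L \<noteq> [] \<and> Max (hd (spl L)) = Max (hd L)" using spl_props[OF gL c] by blast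
    obtain T' M where TM: "spl L = T' # M" using sp by (cases "spl L") auto
    have T': "Max T' = Max T" "good T'" "length M = length L" using sp TM L by auto
    have Sm: "S = {Max S}" by (rule good_small[OF gS False])
    let ?r = "lm_b S (spl L) - cons S r"
    have "beta (bas (spl (S # L))) = lm S (bas (spl L)) - cons S (beta (bas (spl L)))"
      using False beta_cons[of S "bas (spl L)"] by simp
    then have e: "beta (bas (spl (S # L))) = scl (- u) (bas (S # L)) + ?r"
      unfolding ur(2) by simp
    have k1: "keys (lm_b S (spl L) :: nat set list \<Rightarrow>\<^sub>0 'k) \<subseteq> {K. length K = Suc (length L) \<and> (cls K = 1 \<longrightarrow> (K, S # L) \<in> lexr)}"
    proof (cases "S \<inter> T' = {}")
      case True
      \<comment> \<open>Disjoint sets have different maxima, so the absence of a descent becomes a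
        strict ascent.\<close>
      have "Max S \<noteq> Max T'" using True Sm goodD(2)[OF T'(2)] by (metis disjoint_iff insertI1)
      then have lt: "Max S < Max T" using nm T' by simp
      have "Max (S \<union> T') = max (Max S) (Max T')" using goodD[OF gS] goodD[OF T'(2)] by (simp add: Max_Un)
      then have "Max (S \<union> T') = Max T" using lt T' by simp
      moreover have "Max T \<le> n" using T' goodD(3)[OF T'(2)] by simp
      ultimately have "n - Max (S \<union> T') < n - Max S" using lt by linarith
      then have "((S \<union> T') # M, S # L) \<in> lexr" using T' by (simp add: lexr_Cons)
      then show ?thesis using TM T' by (auto intro!: keysI simp del: keys_single)
    next
      case False
      then show ?thesis using TM by (simp add: cc_z)
    qed
    have k2: "keys (cons S r) \<subseteq> {K. length K = Suc (length L) \<and> (cls K = 1 \<longrightarrow> (K, S # L) \<in> lexr)}"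
    proof (rule keys_lext)
      fix K assume K: "K \<in> keys r"
      have lK: "length K = length L" using K ur(3) by (auto simp: hom_def)
      then obtain U K' where UK: "K = U # K'" using L by (cases K) auto
      have "cls (S # K) = 1 \<Longrightarrow> cls K = 1" using UK False by (auto split: if_splits)
      then show "keys (bas (S # K) :: nat set list \<Rightarrow>\<^sub>0 'k) \<subseteq> {K. length K = Suc (length L) \<and> (cls K = 1 \<longrightarrow> (K, S # L) \<in> lexr)}"
        using ur(4) K lK by (auto simp: lexr_Cons)
    qed
    have k3: "keys ?r \<subseteq> {K. length K = Suc (length L) \<and> (cls K = 1 \<longrightarrow> (K, S # L) \<in> lexr)}"
      using k1 k2 by (rule keys_diffI)
    show ?thesis using e ur(1) k3
      by (intro exI[of _ "- u"] exI[of _ ?r]) (auto simp: hom_def)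
  qed
qed simp

definition SrcH :: "nat set list set"
  where "SrcH = {a # L |a L. a \<subseteq> {1..n} \<and> (\<forall>S\<in>set L. good S) \<and> cls L = 1}"

definition muH :: "nat set list \<Rightarrow> nat set list"
  where "muH xs = hd xs # spl (tl xs)"

text \<open>The first and the cyclic face absorb a nonempty entry into the head, whereupon
  \<open>n - card\<close> drops. The inner faces keep the head and are compared by
  \<open>lexr\<close>.\<close>

definition relH :: "(nat set list \<times> nat set list) set"
  where "relH = inv_image (less_than <*lex*> lexr) (\<lambda>xs. (n - card (hd xs), tl xs))"

lemma trans_relH: "trans relH" and wf_relH: "wf relH"
  unfolding relH_def lexr_def
  by (intro trans_inv_image trans_lex_prod lenlex_transI trans_less_than wf_inv_image wf_lex_prod wf_lenlex wf_less_than)+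

lemma inj_muH: "inj_on muH SrcH"
proof (rule inj_onI)
  fix x y assume "x \<in> SrcH" "y \<in> SrcH" "muH x = muH y"
  then show "x = y" unfolding SrcH_def muH_def
    using spl_props by (auto) (metis spl_props)
qed

lemma card_grow: "a \<subseteq> {1..n} \<Longrightarrow> good S \<Longrightarrow> a \<inter> S = {} \<Longrightarrow> n - card (a \<union> S) < n - card a"
proof -
  assume a: "a \<subseteq> {1..n}" "good S" "a \<inter> S = {}"
  have f: "finite a" "finite S" "S \<noteq> {}" using a goodD[of S] finite_subset[of a "{1..n}"] by auto
  have "card (a \<union> S) = card a + card S" using a f by (simp add: card_Un_disjoint)
  moreover have "card S > 0" using f by (simp add: card_gt_0_iff)
  moreover have "card (a \<union> S) \<le> n"
    using card_mono[of "{1..n}" "a \<union> S"] a by (auto simp: good_def)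
  ultimately show ?thesis by simp
qed

lemma triang_H: "triang relH SrcH muH bb"
  unfolding triang_def
proof (intro conjI ballI)
  show "lin bb" by auto
  show "wf relH" "trans relH" "inj_on muH SrcH" by (rule wf_relH trans_relH inj_muH)+
  fix s assume "s \<in> SrcH"
  then obtain a L where s: "s = a # L" and a: "a \<subseteq> {1..n}" and g: "\<forall>S\<in>set L. good S" and c: "cls L = 1"
    by (auto simp: SrcH_def)
  obtain u r where ur: "u \<noteq> 0" "beta (bas (spl L)) = scl u (bas L) + r" "hom (length L) r"
      "\<forall>K\<in>keys r. cls K = 1 \<longrightarrow> (K, L) \<in> lexr" using spl_beta[OF g c] by blast
  have sp: "(\<forall>S\<in>set (spl L). good S) \<and> spl L \<noteq> []" using spl_props[OF g c] by blast
  let ?r = "lm a (bas (spl L)) - cons a r + W (bas (a # spl L))"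
  let ?B = "{K. K \<in> SrcH \<longrightarrow> (K, s) \<in> relH}"
  have m: "muH s = a # spl L" by (simp add: muH_def s)
  have "beta (cons a (bas (spl L))) = lm a (bas (spl L)) - cons a (scl u (bas L) + r)"
    unfolding beta_cons ur(2) by simp
  then have e: "bb (bas (muH s)) = scl (- u) (bas s) + ?r"
    unfolding m unfolding s by simp
  have k1: "keys (lm a (bas (spl L)) :: nat set list \<Rightarrow>\<^sub>0 'k) \<subseteq> ?B"
  proof -
    obtain T M where TM: "spl L = T # M" using sp by (cases "spl L") auto
    show ?thesis
    proof (cases "a \<inter> T = {}")
      case True
      have "((a \<union> T) # M, s) \<in> relH" unfolding relH_def s using card_grow[OF a _ True] sp TM by auto
      then show ?thesis using TM by (auto intro!: keysI simp del: keys_single)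
    next
      case False
      then show ?thesis using TM by (simp add: cc_z)
    qed
  qed
  have k2: "keys (cons a r) \<subseteq> ?B"
    by (rule keys_lext) (use ur(4) in \<open>auto simp: SrcH_def relH_def s\<close>)
  have k3: "keys (W (bas (a # spl L)) :: nat set list \<Rightarrow>\<^sub>0 'k) \<subseteq> ?B"
  proof -
    obtain M z where Mz: "spl L = M @ [z]" using sp by (metis rev_exhaust)
    have w: "W (bas (a # spl L)) = (scl ((-1) ^ Suc (length M) * cc z a) (bas ((z \<union> a) # M)) :: nat set list \<Rightarrow>\<^sub>0 'k)"
      using W_b_simps(2)[of "a # M" z] Mz by simp
    show ?thesis
    proof (cases "a \<inter> z = {}")
      case True
      have "((z \<union> a) # M, s) \<in> relH" unfolding relH_def s using card_grow[OF a _ True] sp Mz by (auto simp: Un_commute)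
      then show ?thesis unfolding w by (intro keysI) auto
    next
      case False
      then have "z \<inter> a \<noteq> {}" by auto
      then show ?thesis unfolding w by (simp add: cc_z)
    qed
  qed
  have k: "keys ?r \<subseteq> ?B" by (intro keys_addI keys_diffI k1 k2 k3)
  show "\<exists>u r. u \<noteq> 0 \<and> bb (bas (muH s)) = scl u (bas s) + r \<and> (\<forall>K\<in>keys r. K \<in> SrcH \<longrightarrow> (K, s) \<in> relH)"
    using e ur(1) k by (intro exI[of _ "- u"] exI[of _ ?r]) auto
qed

section \<open>The Hochschild homology of \<open>\<Lambda>\<close>\<close>

abbreviation sing :: "nat list \<Rightarrow> nat set list" where "sing w \<equiv> map (\<lambda>i. {i}) w"

text \<open>Taking every distinct word once, rather than symmetrising, realises the divided power
  and gives each word coefficient 1.\<close>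

definition pw :: "nat multiset \<Rightarrow> (nat set list \<Rightarrow>\<^sub>0 'k)"
  where "pw M = (\<Sum>w\<in>permutations_of_multiset M. bas (sing w))"

text \<open>
  \<open>(S, M)\<close> stands for \<open>e\<^sub>S\<close> times the divided power monomial \<open>M\<close>, realised as a sum of shuffles.
  These elements span the critical part of the Hochschild complex, on which \<open>b\<close> is
  \<open>(1 + (-1)\<^sup>w)\<close> times the Koszul differential \<open>de\<close> in weight \<open>w\<close> (lemma \<open>bb_io_b\<close>).
\<close>
definition io_b :: "nat set \<times> nat multiset \<Rightarrow> (nat set list \<Rightarrow>\<^sub>0 'k)"
  where "io_b p = cons (fst p) (pw (snd p))"
abbreviation "io \<equiv> lext io_b"

definition de_b :: "nat set \<times> nat multiset \<Rightarrow> (nat set \<times> nat multiset \<Rightarrow>\<^sub>0 'k)"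
  where "de_b p = (\<Sum>i\<in>set_mset (snd p). scl (cc (fst p) {i}) (bas (insert i (fst p), snd p - {#i#})))"
abbreviation "de \<equiv> lext de_b"

lemma pw_empty [simp]: "pw {#} = bas []" by (simp add: pw_def)

lemma pw_Cons: "M \<noteq> {#} \<Longrightarrow> pw M = (\<Sum>x\<in>set_mset M. cons {x} (pw (M - {#x#})))"
proof -
  assume M: "M \<noteq> {#}"
  have "pw M = (\<Sum>x\<in>set_mset M. \<Sum>w\<in>(#) x ` permutations_of_multiset (M - {#x#}). bas (sing w))"
    unfolding pw_def permutations_of_multiset_nonempty[OF M]
    by (rule sum.UNION_disjoint) auto
  also have "\<dots> = (\<Sum>x\<in>set_mset M. cons {x} (pw (M - {#x#})))"
    by (intro sum.cong refl) (simp add: sum.reindex pw_def)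
  finally show ?thesis .
qed

lemma pw_snoc: "M \<noteq> {#} \<Longrightarrow> pw M = (\<Sum>x\<in>set_mset M. snoc {x} (pw (M - {#x#})))"
proof -
  assume M: "M \<noteq> {#}"
  define rv :: "(nat set list \<Rightarrow>\<^sub>0 'k) \<Rightarrow> (nat set list \<Rightarrow>\<^sub>0 'k)" where "rv = lext (\<lambda>L. bas (rev L))"
  have rp: "rv (pw A) = pw A" for A
  proof -
    have "rv (pw A) = (\<Sum>w\<in>permutations_of_multiset A. bas (sing (rev w)))"
      by (simp add: rv_def pw_def rev_map)
    also have "\<dots> = pw A" unfolding pw_def
      by (rule sum.reindex_bij_witness[of _ rev rev]) (auto simp: permutations_of_multiset_def)
    finally show ?thesis .
  qed
  have rc: "rv (cons S x) = snoc S (rv x)" for S x unfolding rv_def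
    by (rule lin_eqI[where x=x]) auto
  have "pw M = rv (\<Sum>x\<in>set_mset M. cons {x} (pw (M - {#x#})))" using rp[of M] pw_Cons[OF M] by simp
  also have "\<dots> = (\<Sum>x\<in>set_mset M. rv (cons {x} (pw (M - {#x#}))))" unfolding rv_def by simp
  finally show ?thesis unfolding rc rp .
qed

lemma cd_single: "i \<in> {1..n} \<Longrightarrow> cd {i} = 1" by (simp add: cd_def)

text \<open>By \<open>beta_cons\<close> and induction only the product of the first two letters
  remains. It is a sum over ordered pairs, antisymmetric under exchange because generators
  anticommute, so it equals its own negative.\<close>

lemma beta_pw: "set_mset M \<subseteq> {1..n} \<Longrightarrow> beta (pw M) = 0"
proof (induction "size M" arbitrary: M)
  case (Suc m)
  have M: "M \<noteq> {#}" using Suc by auto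
  have z: "beta (pw (M - {#x#})) = 0" if "x \<in># M" for x
    using Suc.hyps(2) Suc.prems that by (intro Suc.hyps(1)) (auto simp: size_Diff_singleton dest: in_diffD)
  have "beta (pw M) = (\<Sum>x\<in>set_mset M. lm {x} (pw (M - {#x#})))"
    by (subst pw_Cons[OF M]) (simp add: beta_cons z)
  also have "\<dots> = (\<Sum>x\<in>set_mset M. \<Sum>y\<in>set_mset (M - {#x#}). scl (cc {x} {y}) (cons {x, y} (pw (M - {#x#} - {#y#}))))"
  proof (rule sum.cong[OF refl])
    fix x assume "x \<in> set_mset M"
    show "lm {x} (pw (M - {#x#})) = (\<Sum>y\<in>set_mset (M - {#x#}). scl (cc {x} {y}) (cons {x, y} (pw (M - {#x#} - {#y#}))))"
    proof (cases "M - {#x#} = {#}")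
      case False
      show ?thesis by (subst pw_Cons[OF False]) (simp add: lm_cons insert_commute)
    qed simp
  qed
  also have "\<dots> = (\<Sum>(x, y)\<in>(SIGMA x:set_mset M. set_mset (M - {#x#})). scl (cc {x} {y}) (cons {x, y} (pw (M - {#x#} - {#y#}))))"
    (is "_ = sum ?f ?Q") by (simp add: sum.Sigma)
  finally have e: "beta (pw M) = sum ?f ?Q" .
  have sw: "prod.swap p \<in> ?Q" if pQ: "p \<in> ?Q" for p
  proof -
    obtain x y where p: "p = (x, y)" "x \<in># M" "y \<in># M - {#x#}" using pQ by auto
    have "y \<in># M" using p in_diffD by metis
    moreover have "x \<in># M - {#y#}" using p
      by (cases "x = y") (auto simp: in_diff_count split: if_splits)
    ultimately show "prod.swap p \<in> ?Q" using p by auto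
  qed
  have "sum ?f ?Q = sum (\<lambda>p. ?f (prod.swap p)) ?Q"
    by (rule sum.reindex_bij_witness[of _ prod.swap prod.swap]) (erule sw | simp)+
  also have "\<dots> = sum (\<lambda>p. - ?f p) ?Q"
  proof (rule sum.cong[OF refl])
    fix p assume "p \<in> ?Q"
    then obtain x y where p: "p = (x, y)" "x \<in># M" "y \<in># M - {#x#}" by auto
    have "y \<in># M" using p in_diffD by metis
    then have xy: "x \<in> {1..n}" "y \<in> {1..n}" using p(2) Suc.prems by blast+
    have "cc {y} {x} = - (cc {x} {y} :: 'k)" using cc_swap[of "{y}" "{x}"] cd_single[OF xy(1)] cd_single[OF xy(2)] by simp
    moreover have "M - {#y#} - {#x#} = M - {#x#} - {#y#}" by (simp add: diff_diff_add add_mset_commute)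
    ultimately show "?f (prod.swap p) = - ?f p" using p by (simp add: insert_commute)
  qed
  finally have "sum ?f ?Q = - sum ?f ?Q" by (simp add: sum_negf)
  then have "scl 2 (sum ?f ?Q) = 0"
    using scl_add_left[of 1 1 "sum ?f ?Q"] by (simp add: eq_neg_iff_add_eq_0 del: scl_sum)
  then have "scl (inverse 2) (scl 2 (sum ?f ?Q)) = 0" by (simp del: scl_sum scl_scl)
  then show ?case unfolding e by (simp del: scl_sum)
qed simp

lemma hom_pw: "hom (size M) (pw M)"
  unfolding pw_def by (intro hom_sum) (auto simp: permutations_of_multiset_def)

lemma sg_hom: "hom r x \<Longrightarrow> sg x = scl ((-1) ^ r) x"
  by (rule hom_eq[where f=sg]) auto

definition KB :: "nat \<Rightarrow> (nat set \<times> nat multiset) set"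
  where "KB p = {(S, M). S \<subseteq> {1..n} \<and> set_mset M \<subseteq> {1..n} \<and> size M = p}"

definition wtK :: "nat set \<times> nat multiset \<Rightarrow> nat"
  where "wtK p = cd (fst p) + size (snd p)"

text \<open>The inner faces among the letters cancel by \<open>beta_pw\<close>, which leaves the
  first face and the cyclic one. The latter is \<open>(-1)^w\<close> times the former: the length
  gives \<open>(-1)^|M|\<close>, and moving the generator past \<open>e_S\<close> gives
  \<open>(-1)^|S|\<close>.\<close>

lemma bb_io_b:
  assumes M: "set_mset M \<subseteq> {1..n}"
  shows "bb (io_b (S, M)) = scl (1 + (-1) ^ wtK (S, M)) (io (de_b (S, M)))"
proof (cases "M = {#}")
  case True
  then show ?thesis by (simp add: io_b_def de_b_def W_b_def)
next
  case False
  have b: "beta (io_b (S, M)) = io (de_b (S, M))"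
    unfolding io_b_def fst_conv snd_conv beta_cons beta_pw[OF M] de_b_def
    by (subst pw_Cons[OF False]) (simp add: lm_cons io_b_def Un_insert_right)
  have "W (io_b (S, M)) = (\<Sum>x\<in>set_mset M. scl ((-1) ^ wtK (S, M)) (scl (cc S {x}) (io_b (insert x S, M - {#x#}))))"
    unfolding io_b_def fst_conv snd_conv
  proof (subst pw_snoc[OF False], unfold lext_simps, rule sum.cong[OF refl])
    fix x assume x: "x \<in> set_mset M"
    have "Suc (size (M - {#x#})) = size M" using x by (metis size_Suc_Diff1)
    then have h: "hom (size M) (cons S (pw (M - {#x#})))"
      by (intro hom_lin[OF lin_lext0 hom_pw]) simp
    have "W (cons S (snoc {x} (pw (M - {#x#})))) = lm {x} (sg (cons S (pw (M - {#x#}))))"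
      by (simp only: snoc_cons[symmetric] W_snoc)
    also have "\<dots> = scl ((-1) ^ size M * cc {x} S) (cons (insert x S) (pw (M - {#x#})))"
      unfolding sg_hom[OF h] by (simp add: lm_cons)
    also have "cc {x} S = ((-1) ^ cd S * cc S {x} :: 'k)"
      using cc_swap[of "{x}" S] cd_single[of x] x M by auto
    finally show "W (cons S (snoc {x} (pw (M - {#x#})))) =
      scl ((-1) ^ wtK (S, M)) (scl (cc S {x}) (cons (insert x S) (pw (M - {#x#}))))"
      by (simp add: wtK_def power_add mult_ac)
  qed
  also have "\<dots> = scl ((-1) ^ wtK (S, M)) (io (de_b (S, M)))"
    by (simp add: de_b_def)
  finally show ?thesis unfolding b by (simp add: scl_add_left)
qed

lemma wt_de: "set_mset (snd p) \<subseteq> {1..n} \<Longrightarrow> keys (de_b p :: _ \<Rightarrow>\<^sub>0 'k) \<subseteq> {q. wtK q = wtK p \<and> Suc (size (snd q)) = size (snd p)}"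
  unfolding de_b_def
proof (rule keys_sumI)
  fix i assume i: "set_mset (snd p) \<subseteq> {1..n}" "i \<in># snd p"
  show "keys (scl (cc (fst p) {i}) (bas (insert i (fst p), snd p - {#i#})) :: _ \<Rightarrow>\<^sub>0 'k) \<subseteq> {q. wtK q = wtK p \<and> Suc (size (snd q)) = size (snd p)}"
  proof (cases "i \<in> fst p")
    case True
    then show ?thesis by (simp add: cc_z)
  next
    case False
    have "cd (insert i (fst p)) = Suc (cd (fst p))"
      using cd_Un[of "fst p" "{i}"] False cd_single[of i] i by auto
    moreover have "Suc (size (snd p - {#i#})) = size (snd p)" using i(2) by (metis size_Suc_Diff1)
    ultimately show ?thesis by (intro keysI) (auto simp: wtK_def)
  qed
qed

lemma KB_de: "p \<in> KB (Suc m) \<Longrightarrow> keys (de_b p :: _ \<Rightarrow>\<^sub>0 'k) \<subseteq> KB m"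
  unfolding de_b_def
proof (intro keysI)
  fix i assume p: "p \<in> KB (Suc m)" "i \<in># snd p"
  have "set_mset (snd p - {#i#}) \<subseteq> set_mset (snd p)" by (rule set_mset_mono[OF diff_subset_eq_self])
  show "(insert i (fst p), snd p - {#i#}) \<in> KB m"
  proof -
    have k: "fst p \<subseteq> {1..n}" "set_mset (snd p) \<subseteq> {1..n}" "size (snd p) = Suc m"
      using p(1) by (auto simp: KB_def)
    have "i \<in> {1..n}" using k(2) p(2) by blast
    moreover have "set_mset (snd p - {#i#}) \<subseteq> {1..n}" using k(2) \<open>set_mset (snd p - {#i#}) \<subseteq> set_mset (snd p)\<close> by blast
    ultimately show ?thesis using k p(2) by (simp add: KB_def size_Diff_singleton)
  qed
qed

definition Bs :: "nat \<Rightarrow> nat set list set"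
  where "Bs r = {L. length L = r \<and> set L \<subseteq> Pow {1..n}}"

lemma io_b_sum: "io_b (S, M) = (\<Sum>w\<in>permutations_of_multiset M. bas (S # sing w))"
  by (simp add: io_b_def pw_def)

lemma io_keys_gen: "keys (io_b (S, M) :: _ \<Rightarrow>\<^sub>0 'k) \<subseteq> {S # sing w |w. mset w = M}"
  unfolding io_b_sum by (intro keysI) (auto simp: permutations_of_multiset_def)

lemma io_keys: "p \<in> KB m \<Longrightarrow> keys (io_b p :: _ \<Rightarrow>\<^sub>0 'k) \<subseteq> Bs (Suc m)"
proof -
  assume p: "p \<in> KB m"
  have "{S # sing w |w S. S = fst p \<and> mset w = snd p} \<subseteq> Bs (Suc m)"
    using p by (auto simp: KB_def Bs_def) (metis set_mset_mset subsetD atLeastAtMost_iff One_nat_def)+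
  then show ?thesis using io_keys_gen[of "fst p" "snd p"] by auto
qed

lemma sing_inj: "sing w = sing w' \<longleftrightarrow> w = w'"
  by (metis (no_types, lifting) inj_map_eq_map inj_def singleton_inject)

lemma lookup_io_b: "lookup (io_b (S, M)) (T # sing w) = (if S = T \<and> mset w = M then 1 else 0)"
proof -
  have "lookup (io_b (S, M)) (T # sing w) = (\<Sum>w'\<in>permutations_of_multiset M. if w' = w \<and> S = T then 1 else 0)"
    unfolding io_b_sum by (simp add: lookup_sum lookup_single when_def sing_inj conj_commute)
  also have "\<dots> = (if S = T \<and> w \<in> permutations_of_multiset M then 1 else 0)"
    by (cases "S = T") simp_all
  finally show ?thesis by (simp add: permutations_of_multiset_def)
qed

lemma lookup_io: "lookup (io x) (T # sing w) = lookup x (T, mset w)"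
proof -
  have "lookup (io x) (T # sing w) = (\<Sum>p\<in>keys x. if p = (T, mset w) then lookup x p else 0)"
    unfolding lookup_lext
  proof (rule sum.cong[OF refl])
    fix p show "lookup x p * lookup (io_b p) (T # sing w) = (if p = (T, mset w) then lookup x p else 0)"
      using lookup_io_b[of "fst p" "snd p" T w] by (cases p) auto
  qed
  also have "\<dots> = lookup x (T, mset w)" by (auto simp: in_keys_iff)
  finally show ?thesis .
qed

text \<open>By \<open>lookup_io\<close> any single ordering of a multiset already reads off the
  coefficient.\<close>

lemma io_inj: "io x = 0 \<Longrightarrow> x = 0"
proof (rule poly_mapping_eqI)
  fix p :: "nat set \<times> nat multiset"
  assume x: "io x = 0"
  obtain w where "mset w = snd p" using ex_mset by blast
  then show "lookup x p = lookup 0 p" using lookup_io[of x "fst p" w] x by simp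
qed

lemma cls_sing: "cls (sing w) \<noteq> 1"
  by (induction w rule: induct_list012) auto

lemma cls_sing_sorted: "cls (sing w) = 0 \<Longrightarrow> sorted w"
  by (induction w rule: induct_list012) (auto split: if_splits)

lemma cls0_sing: "\<forall>S\<in>set L. good S \<Longrightarrow> cls L = 0 \<Longrightarrow> \<exists>w. L = sing w \<and> sorted w"
proof -
  assume a: "\<forall>S\<in>set L. good S" "cls L = 0"
  then have "\<exists>w. L = sing w"
  proof (induction L rule: cls.induct)
    case (2 S)
    then have "S = {Max S}" by (intro good_small) (auto split: if_splits)
    then show ?case by (intro exI[of _ "[Max S]"]) simp
  next
    case (3 S T L)
    then have S: "S = {Max S}" by (intro good_small) (auto split: if_splits)
    have "\<exists>w. T # L = sing w" using 3 by (intro 3(1)) (auto split: if_splits)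
    then obtain w where "T # L = sing w" by (elim exE)
    then show ?case using S by (intro exI[of _ "Max S # w"]) simp
  qed simp
  then show ?thesis using a(2) cls_sing_sorted by blast
qed

lemma keys_bb: "keys x \<subseteq> Bs (Suc r) \<Longrightarrow> keys (bb x) \<subseteq> Bs r"
proof (rule lin_keys[where f=bb])
  fix L assume "keys x \<subseteq> Bs (Suc r)" "L \<in> keys x"
  then have L: "length L = Suc r" "set L \<subseteq> Pow {1..n}" by (auto simp: Bs_def)
  have h: "hom r (bb (bas L))" using hom_bb[of "Suc r" "bas L"] L by simp
  have 1: "keys (beta_b L :: _ \<Rightarrow>\<^sub>0 'k) \<subseteq> {L. set L \<subseteq> Pow {1..n}}"
    using L(2)
  proof (induction L rule: beta_b.induct)
    case (3 S T L)
    have "keys (cons S (beta_b (T # L)) :: _ \<Rightarrow>\<^sub>0 'k) \<subseteq> {L. set L \<subseteq> Pow {1..n}}"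
      by (rule keys_lext) (use 3 in auto)
    then show ?case unfolding beta_b.simps using 3(2) by (intro keysI) auto
  qed auto
  have 2: "keys (W_b L :: _ \<Rightarrow>\<^sub>0 'k) \<subseteq> {L. set L \<subseteq> Pow {1..n}}"
    using L(2)
  proof (cases L rule: rev_cases)
    case (snoc M z)
    then have w: "W_b L = (scl ((-1) ^ length M) (lm_b z M) :: _ \<Rightarrow>\<^sub>0 'k)" by simp
    have "keys (lm_b z M :: _ \<Rightarrow>\<^sub>0 'k) \<subseteq> {L. set L \<subseteq> Pow {1..n}}"
    proof (cases M)
      case (Cons a M')
      then have "set ((z \<union> a) # M') \<subseteq> Pow {1..n}" using L(2) snoc by simp
      then show ?thesis unfolding Cons lm_b.simps by (intro keysI) blast
    qed simp
    then show ?thesis unfolding w by (rule keysI)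
  qed simp
  have "keys (bb (bas L)) \<subseteq> {L. set L \<subseteq> Pow {1..n}}" unfolding lext_bas by (intro keysI 1 2)
  then show "keys (bb (bas L)) \<subseteq> Bs r" using h unfolding hom_def Bs_def by blast
qed auto

lemma keys_H: "keys x \<subseteq> Bs r \<Longrightarrow> keys (H x) \<subseteq> Bs (Suc r)"
proof (rule keys_lext)
  fix L assume "keys x \<subseteq> Bs r" "L \<in> keys x"
  then have L: "length L = r" "set L \<subseteq> Pow {1..n}" by (auto simp: Bs_def)
  have hl: "keys (hl_b L :: _ \<Rightarrow>\<^sub>0 'k) \<subseteq> Bs (Suc (length L))" if "set L \<subseteq> Pow {1..n}" for L
    using that
  proof (induction L)
    case (Cons S L)
    have "keys (cons S (hl_b L) :: _ \<Rightarrow>\<^sub>0 'k) \<subseteq> Bs (Suc (length (S # L)))"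
      by (rule keys_lext) (use Cons in \<open>auto simp: Bs_def\<close>)
    then show ?case using Cons(2) by (auto simp: Bs_def)
  qed simp
  show "keys (H_b L :: _ \<Rightarrow>\<^sub>0 'k) \<subseteq> Bs (Suc r)"
  proof (cases L)
    case (Cons S L')
    have "keys (cons S (hl_b L') :: _ \<Rightarrow>\<^sub>0 'k) \<subseteq> Bs (Suc r)"
      by (rule keys_lext) (use hl[of L'] L Cons in \<open>auto simp: Bs_def\<close>)
    then show ?thesis using Cons by simp
  qed simp
qed

text \<open>The homotopy \<open>H\<close> removes units and \<open>triang_decomp\<close> removes
  sources, both within the homology class. The remaining cycle \<open>g\<close> is determined by its
  critical coefficients: subtracting the combination \<open>io \<kappa>\<close> with the same ones
  leaves \<open>h\<close>, supported on partners and with no source in its boundary, so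
  \<open>triang_unique\<close> gives \<open>h = 0\<close>.\<close>

lemma HH_decomp:
  assumes f: "keys f \<subseteq> Bs (Suc q)" "bb f = 0"
  obtains \<kappa> \<tau> where "f = io \<kappa> + bb \<tau>" "keys \<kappa> \<subseteq> KB q" "keys \<tau> \<subseteq> Bs (Suc (Suc q))" "bb (io \<kappa>) = 0"
proof -
  define NB where "NB = {L\<in>Bs (Suc q). {} \<notin> set (tl L)}"
  define f' where "f' = f + bb (H f)"
  have f': "f' = f - lext (\<lambda>L. if {} \<in> set (tl L) then bas L else 0) f"
    using bb_H[of f] f(2) by (simp add: f'_def)
  have "keys f' \<subseteq> NB"
  proof -
    have "f' = lext (\<lambda>L. if {} \<in> set (tl L) then 0 else bas L) f"
      unfolding f' by (rule lin_eqI[where x=f]) auto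
    moreover have "keys (lext (\<lambda>L. if {} \<in> set (tl L) then 0 else bas L) f) \<subseteq> NB"
      by (rule keys_lext) (use f(1) in \<open>auto simp: NB_def\<close>)
    ultimately show ?thesis by simp
  qed
  define Src where "Src = SrcH \<inter> NB"
  have tri: "triang relH Src muH bb" using triang_subset[OF triang_H] by (simp add: Src_def)
  have muB: "muH s \<in> Bs (Suc (Suc q))" "{} \<notin> set (tl (muH s))" if sS: "s \<in> Src" for s
  proof -
    obtain a L where s: "s = a # L" "a \<subseteq> {1..n}" "\<forall>S\<in>set L. good S" "cls L = 1" "length L = q"
      using sS by (auto simp: Src_def SrcH_def NB_def Bs_def)
    then show "muH s \<in> Bs (Suc (Suc q))" "{} \<notin> set (tl (muH s))"
      using spl_props[OF s(3,4)] by (auto simp: muH_def Bs_def good_def)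
  qed
  have bbN: "keys (bb (bas L)) \<subseteq> NB" if L: "L \<in> Bs (Suc (Suc q))" "{} \<notin> set (tl L)" for L
  proof -
    have 1: "keys (bb (bas L)) \<subseteq> Bs (Suc q)" using L(1) by (intro keys_bb) simp
    have nb: "keys (beta_b M :: _ \<Rightarrow>\<^sub>0 'k) \<subseteq> {K. (({} \<notin> set M) \<longrightarrow> {} \<notin> set K) \<and> ({} \<notin> set (tl M) \<longrightarrow> {} \<notin> set (tl K))}" for M
    proof (induction M rule: beta_b.induct)
      case (3 S T M)
      have "keys (cons S (beta_b (T # M)) :: _ \<Rightarrow>\<^sub>0 'k) \<subseteq> {K. (({} \<notin> set (S # T # M)) \<longrightarrow> {} \<notin> set K) \<and> ({} \<notin> set (tl (S # T # M)) \<longrightarrow> {} \<notin> set (tl K))}"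
        by (rule keys_lext) (use 3 in auto)
      then show ?case unfolding beta_b.simps by (intro keysI) auto
    qed auto
    have w: "keys (W_b L :: _ \<Rightarrow>\<^sub>0 'k) \<subseteq> {K. {} \<notin> set (tl K)}"
    proof (cases L rule: rev_cases)
      case (snoc M z)
      then have w: "W_b L = (scl ((-1) ^ length M) (lm_b z M) :: _ \<Rightarrow>\<^sub>0 'k)" by simp
      have "keys (lm_b z M :: _ \<Rightarrow>\<^sub>0 'k) \<subseteq> {K. {} \<notin> set (tl K)}"
        using L(2) snoc by (cases M) (auto intro!: keysI simp del: keys_single)
      then show ?thesis unfolding w by (rule keysI)
    qed simp
    have "keys (bb (bas L)) \<subseteq> {K. {} \<notin> set (tl K)}"
      unfolding lext_bas using nb[of L] L(2) w by (intro keysI) auto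
    then show ?thesis using 1 by (auto simp: NB_def)
  qed
  obtain \<tau>1 where \<tau>1: "keys \<tau>1 \<subseteq> muH ` Src" "keys (f' - bb \<tau>1) \<subseteq> NB - Src"
    using triang_decomp[OF tri, of NB f'] bbN muB \<open>keys f' \<subseteq> NB\<close> by (auto simp: Src_def)
  define g where "g = f' - bb \<tau>1"
  \<comment> \<open>A critical list is a sorted word behind a head, so every multiset is represented
    by exactly one such list; \<open>\<kappa>\<close> takes over its coefficient.\<close>
  define \<kappa> where "\<kappa> = (\<Sum>L\<in>{L\<in>keys g. cls (tl L) = 0}. scl (lookup g L) (bas (hd L, mset (map the_elem (tl L)))))"
  have gk: "L \<in> keys g \<Longrightarrow> L \<in> NB - Src" for L using \<tau>1(2) g_def by blast
  have gL: "\<exists>a M. L = a # M \<and> a \<subseteq> {1..n} \<and> (\<forall>S\<in>set M. good S) \<and> length M = q" if "L \<in> NB" for L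
    using that unfolding NB_def Bs_def by (cases L) (auto simp: good_def)
  have te: "map the_elem (sing w) = w" for w :: "nat list" by (induction w) auto
  have kk: "keys \<kappa> \<subseteq> KB q" unfolding \<kappa>_def
  proof (intro keysI)
    fix L assume L: "L \<in> {L\<in>keys g. cls (tl L) = 0}"
    obtain a M where aM: "L = a # M" "a \<subseteq> {1..n}" "\<forall>S\<in>set M. good S" "length M = q" using gL gk L by blast
    obtain w where w: "M = sing w" using cls0_sing[OF aM(3)] L aM(1) by auto
    show "(hd L, mset (map the_elem (tl L))) \<in> KB q"
      using aM w by (auto simp: KB_def te good_def)
  qed
  have lk: "lookup \<kappa> (a, mset w) = lookup g (a # sing w)" if w: "sorted w" "cls (sing w) = 0" for a w
  proof -
    have "lookup \<kappa> (a, mset w) = (\<Sum>L\<in>{L\<in>keys g. cls (tl L) = 0}. if L = a # sing w then lookup g L else 0)"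
      unfolding \<kappa>_def lookup_sum
    proof (rule sum.cong[OF refl])
      fix L assume L: "L \<in> {L\<in>keys g. cls (tl L) = 0}"
      obtain a' M where aM: "L = a' # M" "\<forall>S\<in>set M. good S" using gL gk L by blast
      obtain w' where w': "M = sing w'" "sorted w'" using cls0_sing[OF aM(2)] L aM(1) by auto
      have "mset w' = mset w \<longleftrightarrow> w' = w" using w w' properties_for_sort by metis
      then show "lookup (scl (lookup g L) (bas (hd L, mset (map the_elem (tl L))))) (a, mset w) =
         (if L = a # sing w then lookup g L else 0)"
        using aM(1) w' unfolding aM(1) w'(1) list.sel te by (auto simp: lookup_single when_def sing_inj)
    qed
    also have "\<dots> = lookup g (a # sing w)" using w by (auto simp: in_keys_iff)
    finally show ?thesis .
  qed
  define h where "h = g - io \<kappa>"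
  have iok: "keys (io \<kappa>) \<subseteq> {a # sing w |a w. a \<subseteq> {1..n} \<and> set w \<subseteq> {1..n}}"
  proof (rule keys_lext)
    fix p assume "p \<in> keys \<kappa>"
    then have "p \<in> KB q" using kk by blast
    then have p: "fst p \<subseteq> {1..n}" "set_mset (snd p) \<subseteq> {1..n}" by (auto simp: KB_def)
    have "{fst p # sing w |w. mset w = snd p} \<subseteq> {a # sing w |a w. a \<subseteq> {1..n} \<and> set w \<subseteq> {1..n}}"
    proof
      fix L assume "L \<in> {fst p # sing w |w. mset w = snd p}"
      then obtain w where w: "L = fst p # sing w" "mset w = snd p" by blast
      have "set w \<subseteq> {1..n}" using p(2) w(2) by (metis set_mset_mset)
      then show "L \<in> {a # sing w |a w. a \<subseteq> {1..n} \<and> set w \<subseteq> {1..n}}" using w(1) p(1) by blast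
    qed
    then show "keys (io_b p :: _ \<Rightarrow>\<^sub>0 'k) \<subseteq> {a # sing w |a w. a \<subseteq> {1..n} \<and> set w \<subseteq> {1..n}}"
      using io_keys_gen[of "fst p" "snd p"] unfolding prod.collapse by (rule subset_trans[rotated])
  qed
  \<comment> \<open>The critical coefficients of \<open>h\<close> vanish by the choice of
    \<open>\<kappa>\<close>, and sources are absent; a list of class 2 is the partner of its
    merge.\<close>
  have hk: "keys h \<subseteq> muH ` Src'" if "Src' = SrcH" for Src'
  proof
    fix L assume L: "L \<in> keys h"
    have "L \<in> keys g \<union> keys (io \<kappa>)" using L keys_diff_sub[of g "io \<kappa>"] unfolding h_def by blast
    then have "\<exists>a M. L = a # M \<and> a \<subseteq> {1..n} \<and> (\<forall>S\<in>set M. good S) \<and> cls M \<noteq> 1"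
    proof
      assume "L \<in> keys g"
      then have 1: "L \<in> NB" "L \<notin> SrcH" using gk by (auto simp: Src_def)
      obtain a M where "L = a # M" "a \<subseteq> {1..n}" "\<forall>S\<in>set M. good S" using gL[OF 1(1)] by blast
      then show ?thesis using 1(2) by (auto simp: SrcH_def)
    next
      assume "L \<in> keys (io \<kappa>)"
      then obtain a w where "L = a # sing w" "a \<subseteq> {1..n}" "set w \<subseteq> {1..n}" using iok by blast
      then show ?thesis using cls_sing[of w] by (auto simp: good_def)
    qed
    then obtain a M where aM: "L = a # M" "a \<subseteq> {1..n}" "\<forall>S\<in>set M. good S" "cls M \<noteq> 1" by blast
    have cl: "cls M \<in> {0, 1, 2}" by (induction M rule: cls.induct) auto
    have "cls M \<noteq> 0"
    proof
      assume c0: "cls M = 0"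
      then obtain w where w: "M = sing w" "sorted w" using cls0_sing[OF aM(3)] by blast
      then have "lookup h L = 0" using lk[of w a] c0 aM by (simp add: h_def lookup_minus lookup_io)
      then show False using L by (simp add: in_keys_iff)
    qed
    then have c2: "cls M = 2" using cl aM(4) by auto
    note m = mrg_props[OF aM(3) c2]
    have "a # mrg M \<in> SrcH" using m aM by (auto simp: SrcH_def)
    moreover have "muH (a # mrg M) = L" using m aM by (simp add: muH_def)
    ultimately show "L \<in> muH ` Src'" using that by force
  qed
  have bg: "bb g = 0"
  proof -
    have "bb g = bb f + bb (bb (H f)) - bb (bb \<tau>1)"
      by (simp add: g_def f'_def)
    then show ?thesis by (simp only: bb_bb f(2)) simp
  qed
  \<comment> \<open>As \<open>bb g = 0\<close>, the boundary of \<open>h\<close> is that of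
    \<open>- io \<kappa>\<close>, whose lists have only singletons beyond the head and hence nothing
    to split.\<close>
  have nosrc: "keys (bb h) \<inter> SrcH = {}"
  proof -
    have "bb h = - bb (io \<kappa>)" using bg by (simp add: h_def)
    moreover have "keys (bb (io \<kappa>)) \<subseteq> {a # sing w |a w. True}"
    proof (rule lin_keys[where f="\<lambda>x. bb (io x)"])
      fix p assume p: "p \<in> keys \<kappa>"
      have e: "bb (io (bas p)) = scl (1 + (-1) ^ wtK p) (io (de_b p))"
        using bb_io_b[of "snd p" "fst p"] p kk by (auto simp: KB_def)
      have "keys (io (de_b p)) \<subseteq> {a # sing w |a w. True}"
      proof (rule keys_lext)
        fix q show "keys (io_b q :: _ \<Rightarrow>\<^sub>0 'k) \<subseteq> {a # sing w |a w. True}"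
          using io_keys_gen[of "fst q" "snd q"] by auto
      qed
      then show "keys (bb (io (bas p))) \<subseteq> {a # sing w |a w. True}" unfolding e by (rule keys_sclI)
    qed auto
    ultimately have 1: "keys (bb h) \<subseteq> {a # sing w |a w. True}" by (simp only: keys_uminus')
    have "a # sing w \<notin> SrcH" for a w using cls_sing[of w] by (auto simp: SrcH_def)
    then have "{a # sing w |a w. True} \<inter> SrcH = {}" by blast
    then show ?thesis using 1 by blast
  qed
  have "h = 0" using triang_unique[OF triang_H hk[OF refl] nosrc] .
  then have e: "f = io \<kappa> + bb (\<tau>1 - H f)"
    by (simp add: h_def g_def f'_def algebra_simps)
  moreover have "keys (\<tau>1 - H f) \<subseteq> Bs (Suc (Suc q))"
    using \<tau>1(1) muB keys_H[OF f(1)] by (intro keysI) auto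
  moreover have "bb (io \<kappa>) = 0"
  proof -
    have "g = io \<kappa>" using \<open>h = 0\<close> h_def by simp
    then show ?thesis using bg by simp
  qed
  ultimately show thesis using kk that by blast
qed

end

text \<open>When \<open>B\<close> has no critical elements, removing the sources from a cycle leaves
  a cycle supported on partners, which vanishes by \<open>triang_unique\<close>.\<close>

lemma triang_exact:
  fixes \<delta> :: "('s \<Rightarrow>\<^sub>0 'k::field) \<Rightarrow> ('s \<Rightarrow>\<^sub>0 'k)"
  assumes tri: "triang R Src \<mu> \<delta>" and dd: "\<And>x. keys x \<subseteq> \<mu> ` (Src \<inter> B) \<Longrightarrow> \<delta> (\<delta> x) = 0"
    and f: "keys f \<subseteq> B" "\<delta> f = 0" and B: "B \<subseteq> Src \<union> \<mu> ` Src"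
    and cl: "\<And>s. s \<in> Src \<inter> B \<Longrightarrow> keys (\<delta> (bas (\<mu> s))) \<subseteq> B"
  shows "\<exists>\<tau>. keys \<tau> \<subseteq> \<mu> ` (Src \<inter> B) \<and> f = \<delta> \<tau>"
proof -
  have lin: "lin \<delta>" using tri by (auto simp: triang_def)
  obtain \<tau> where \<tau>: "keys \<tau> \<subseteq> \<mu> ` (Src \<inter> B)" "keys (f - \<delta> \<tau>) \<subseteq> B - (Src \<inter> B)"
    using triang_decomp[OF triang_subset[OF tri, of "Src \<inter> B"], of B f] cl f by auto
  have "\<delta> (f - \<delta> \<tau>) = 0" using dd[OF \<tau>(1)] by (simp add: lin_diff[OF lin] f)
  moreover have "keys (f - \<delta> \<tau>) \<subseteq> \<mu> ` Src" using \<tau>(2) B by auto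
  ultimately have "f - \<delta> \<tau> = 0" by (intro triang_unique[OF tri]) simp_all
  then show ?thesis using \<tau>(1) by (intro exI[of _ \<tau>] conjI) (simp_all only: right_minus_eq)
qed

lemma sum_antisym:
  fixes f :: "'a \<times> 'a \<Rightarrow> ('s \<Rightarrow>\<^sub>0 'k::field_char_0)"
  assumes sw: "\<And>x y. (x, y) \<in> Q \<Longrightarrow> (y, x) \<in> Q" and f: "\<And>x y. (x, y) \<in> Q \<Longrightarrow> f (y, x) = - f (x, y)"
  shows "sum f Q = 0"
proof -
  have "sum f Q = sum (\<lambda>p. f (prod.swap p)) Q"
  proof (rule sum.reindex_bij_witness[of _ prod.swap prod.swap])
    fix a assume "a \<in> Q" then show "prod.swap a \<in> Q" using sw[of "fst a" "snd a"] by (cases a) auto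
  next
    fix a assume "a \<in> Q" then show "prod.swap a \<in> Q" using sw[of "fst a" "snd a"] by (cases a) auto
  qed auto
  also have "\<dots> = sum (\<lambda>p. - f p) Q"
  proof (rule sum.cong[OF refl])
    fix p assume "p \<in> Q" then show "f (prod.swap p) = - f p" using f[of "fst p" "snd p"] by (cases p) auto
  qed
  finally have "sum f Q = - sum f Q" by (simp add: sum_negf)
  then have "scl 2 (sum f Q) = 0"
    using scl_add_left[of 1 1 "sum f Q"] by (simp add: eq_neg_iff_add_eq_0 del: scl_sum)
  then have "scl (inverse 2) (scl 2 (sum f Q)) = 0" by (simp del: scl_sum scl_scl)
  then show ?thesis by (simp del: scl_sum)
qed

section \<open>The Koszul and de Rham differentials and their exactness\<close>

context grass
begin

type_synonym idx = "nat set \<times> nat multiset"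

lemma cc_Un_left: "S \<inter> S' = {} \<Longrightarrow> cc (S \<union> S') T = cc S T * cc S' T"
  by (auto simp: cc_def invs_Un_left power_add)
lemma cc_Un_right: "T \<inter> T' = {} \<Longrightarrow> cc S (T \<union> T') = cc S T * cc S T'"
  by (auto simp: cc_def invs_Un_right power_add)

definition dd_b :: "idx \<Rightarrow> (idx \<Rightarrow>\<^sub>0 'k)"
  where "dd_b p = (\<Sum>s\<in>fst p \<inter> {1..n}. scl (cc (fst p - {s}) {s}) (bas (fst p - {s}, add_mset s (snd p))))"
abbreviation "dd \<equiv> lext dd_b"

text \<open>Removing \<open>s\<close> and \<open>t\<close> in either order leads to the same
  monomial with opposite signs, because \<open>e_s\<close> and \<open>e_t\<close> anticommute while
  the differentials commute.\<close>

lemma dd_dd [simp]: "dd (dd x) = 0"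
proof (rule lin_eqI[where x=x])
  fix p :: idx
  obtain S M where p: "p = (S, M)" by (cases p)
  let ?Q = "SIGMA s:S \<inter> {1..n}. (S - {s}) \<inter> {1..n}"
  let ?f = "\<lambda>(s, t). scl (cc (S - {s}) {s}) (scl (cc (S - {s} - {t}) {t}) (bas (S - {s} - {t}, add_mset t (add_mset s M)))) :: idx \<Rightarrow>\<^sub>0 'k"
  have "dd (dd (bas p)) = sum ?f ?Q"
    unfolding p by (simp add: dd_b_def sum.Sigma)
  also have "\<dots> = 0"
  proof (rule sum_antisym)
    fix s t assume q: "(s, t) \<in> ?Q"
    then show "(t, s) \<in> ?Q" by auto
    have st: "s \<in> {1..n}" "t \<in> {1..n}" "s \<noteq> t" using q by auto
    obtain R where R: "S - {s} = R \<union> {t}" "S - {t} = R \<union> {s}" "R \<union> {s} - {s} = R" "R \<union> {t} - {t} = R"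
        "R \<inter> {s} = {}" "R \<inter> {t} = {}"
    proof
      show "S - {s} = (S - {s, t}) \<union> {t}" "S - {t} = (S - {s, t}) \<union> {s}" using q by auto
    qed auto
    have c: "cc (R \<union> {t}) {s} = (cc R {s} * cc {t} {s} :: 'k)" "cc (R \<union> {s}) {t} = (cc R {t} * cc {s} {t} :: 'k)"
      by (rule cc_Un_left[OF R(6)], rule cc_Un_left[OF R(5)])
    have "cc {s} {t} = - (cc {t} {s} :: 'k)" using cc_swap[of "{s}" "{t}"] cd_single[OF st(1)] cd_single[OF st(2)] by simp
    then show "?f (t, s) = - ?f (s, t)"
      unfolding prod.case R(1,2) c R(3,4) by (simp add: add_mset_commute mult_ac)
  qed
  finally show "dd (dd (bas p)) = 0" .
qed auto

definition mn :: "idx \<Rightarrow> nat" where "mn p = Min (fst p \<union> set_mset (snd p))"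

definition KK :: "idx set" where
  "KK = {p. fst p \<subseteq> {1..n} \<and> set_mset (snd p) \<subseteq> {1..n} \<and> fst p \<union> set_mset (snd p) \<noteq> {}}"

lemma mn_in: "p \<in> KK \<Longrightarrow> mn p \<in> fst p \<union> set_mset (snd p)" "p \<in> KK \<Longrightarrow> mn p \<in> {1..n}"
proof -
  assume p: "p \<in> KK"
  have "finite (fst p)" using p finite_subset unfolding KK_def by blast
  then show "mn p \<in> fst p \<union> set_mset (snd p)" unfolding mn_def using p by (intro Min_in) (auto simp: KK_def)
  then show "mn p \<in> {1..n}" using p unfolding KK_def by blast
qed

lemma mn_eqI: "p \<in> KK \<Longrightarrow> fst q \<union> set_mset (snd q) \<subseteq> fst p \<union> set_mset (snd p) \<Longrightarrow> mn p \<in> fst q \<union> set_mset (snd q) \<Longrightarrow> mn q = mn p"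
proof -
  assume a: "p \<in> KK" "fst q \<union> set_mset (snd q) \<subseteq> fst p \<union> set_mset (snd p)" "mn p \<in> fst q \<union> set_mset (snd q)"
  have f: "finite (fst p \<union> set_mset (snd p))" using a finite_subset unfolding KK_def by blast
  have f2: "finite (fst q \<union> set_mset (snd q))" using f a(2) finite_subset by blast
  show ?thesis unfolding mn_def[of q]
  proof (rule Min_eqI[OF f2 _ a(3)])
    fix y assume "y \<in> fst q \<union> set_mset (snd q)"
    then show "mn p \<le> y" unfolding mn_def using f a(2) by (intro Min_le) auto
  qed
qed

text \<open>
  Moving the least index \<open>mn p\<close> between the two parts of \<open>p\<close> matches \<open>Hi\<close> with \<open>Lo\<close>; both \<open>de\<close>
  and \<open>dd\<close> are exact away from \<open>({}, {#})\<close> because they are unitriangular along this matching.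
\<close>
definition Hi :: "idx set" where "Hi = {p\<in>KK. mn p \<in> fst p}"
definition Lo :: "idx set" where "Lo = {p\<in>KK. mn p \<notin> fst p}"
definition dn :: "idx \<Rightarrow> idx" where "dn p = (fst p - {mn p}, add_mset (mn p) (snd p))"
definition up :: "idx \<Rightarrow> idx" where "up p = (insert (mn p) (fst p), snd p - {#mn p#})"

lemma dn_props: "p \<in> Hi \<Longrightarrow> dn p \<in> Lo \<and> mn (dn p) = mn p \<and> up (dn p) = p \<and> wtK (dn p) = wtK p \<and> size (snd (dn p)) = Suc (size (snd p))"
proof -
  assume p: "p \<in> Hi"
  then have k: "p \<in> KK" "mn p \<in> fst p" by (auto simp: Hi_def)
  have m: "mn (dn p) = mn p" by (rule mn_eqI[OF k(1)]) (use k in \<open>auto simp: dn_def\<close>)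
  have "dn p \<in> KK" using k mn_in(2)[OF k(1)] unfolding KK_def dn_def by auto
  moreover have "cd (fst p) = Suc (cd (fst p - {mn p}))"
    using cd_Un[of "fst p - {mn p}" "{mn p}"] k(2) cd_single[OF mn_in(2)[OF k(1)]] by (simp add: insert_absorb)
  ultimately show ?thesis using m k by (auto simp: Lo_def up_def dn_def wtK_def prod_eq_iff insert_absorb)
qed

lemma up_props: "p \<in> Lo \<Longrightarrow> up p \<in> Hi \<and> mn (up p) = mn p \<and> dn (up p) = p \<and> wtK (up p) = wtK p \<and> Suc (size (snd (up p))) = size (snd p)"
proof -
  assume p: "p \<in> Lo"
  then have k: "p \<in> KK" "mn p \<notin> fst p" by (auto simp: Lo_def)
  have i: "mn p \<in># snd p" using mn_in(1)[OF k(1)] k(2) by blast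
  have "set_mset (snd p - {#mn p#}) \<subseteq> set_mset (snd p)" by (rule set_mset_mono[OF diff_subset_eq_self])
  then have sub: "fst (up p) \<union> set_mset (snd (up p)) \<subseteq> fst p \<union> set_mset (snd p)"
    using i unfolding up_def by auto
  have m: "mn (up p) = mn p" by (rule mn_eqI[OF k(1) sub]) (simp add: up_def)
  have "fst (up p) \<subseteq> {1..n}" "set_mset (snd (up p)) \<subseteq> {1..n}"
    using sub k(1) unfolding KK_def by auto
  then have "up p \<in> KK" by (simp add: KK_def up_def)
  moreover have "cd (insert (mn p) (fst p)) = Suc (cd (fst p))"
    using cd_Un[of "fst p" "{mn p}"] k(2) cd_single[OF mn_in(2)[OF k(1)]] by simp
  moreover have "Suc (size (snd p - {#mn p#})) = size (snd p)" using i by (metis size_Suc_Diff1)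
  ultimately show ?thesis using m k i by (auto simp: Hi_def up_def dn_def wtK_def prod_eq_iff)
qed

lemma Hi_Lo: "KK = Hi \<union> Lo" "Hi \<inter> Lo = {}" by (auto simp: Hi_def Lo_def)

lemma KK_dn: "KK \<subseteq> Hi \<union> dn ` Hi"
proof
  fix p assume "p \<in> KK"
  then consider "p \<in> Hi" | "p \<in> Lo" using Hi_Lo(1) by blast
  then show "p \<in> Hi \<union> dn ` Hi"
  proof cases
    case 2
    then have "p = dn (up p)" "up p \<in> Hi" using up_props by simp_all
    then show ?thesis by (intro UnI2) (rule image_eqI)
  qed simp
qed

lemma KK_up: "KK \<subseteq> Lo \<union> up ` Lo"
proof
  fix p assume "p \<in> KK"
  then consider "p \<in> Lo" | "p \<in> Hi" using Hi_Lo(1) by blast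
  then show "p \<in> Lo \<union> up ` Lo"
  proof cases
    case 2
    then have "p = up (dn p)" "dn p \<in> Lo" using dn_props by simp_all
    then show ?thesis by (intro UnI2) (rule image_eqI)
  qed simp
qed

text \<open>Only the term that takes the least index back into the set lies in \<open>Hi\<close>; in
  all others that index stays in the multiset alone. So there are no lower sources, and the empty
  relation serves as order.\<close>

lemma triang_de: "triang {} Hi dn de"
  unfolding triang_def
proof (intro conjI ballI)
  show "inj_on dn Hi" using dn_props by (metis inj_onI)
  fix p assume p: "p \<in> Hi"
  then have k: "p \<in> KK" "mn p \<in> fst p" by (auto simp: Hi_def)
  let ?j = "mn p" let ?S = "fst p - {?j}" let ?M = "snd p"
  let ?t = "\<lambda>i. scl (cc ?S {i}) (bas (insert i ?S, add_mset ?j ?M - {#i#})) :: idx \<Rightarrow>\<^sub>0 'k"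
  have e: "de (bas (dn p)) = ?t ?j + (\<Sum>i\<in>set_mset ?M - {?j}. ?t i)"
    by (simp add: de_b_def dn_def sum.insert_remove)
  have tj: "?t ?j = scl (cc ?S {?j}) (bas p)" using k(2) by (simp add: insert_absorb)
  have "keys (\<Sum>i\<in>set_mset ?M - {?j}. ?t i) \<inter> Hi = {}"
  proof -
    have "keys (\<Sum>i\<in>set_mset ?M - {?j}. ?t i) \<subseteq> - Hi"
    proof (rule keys_sumI, rule keys_sclI, rule keys_basI)
      fix i assume i: "i \<in> set_mset ?M - {?j}"
      let ?q = "(insert i ?S, add_mset ?j ?M - {#i#})"
      have "set_mset (add_mset ?j ?M - {#i#}) \<subseteq> set_mset (add_mset ?j ?M)" by (rule set_mset_mono[OF diff_subset_eq_self])
      moreover have "?j \<in># add_mset ?j ?M - {#i#}" using i by (simp add: in_diff_count)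
      ultimately have "mn ?q = ?j" using i k(2) by (intro mn_eqI[OF k(1)]) auto
      then show "?q \<in> - Hi" using i by (auto simp: Hi_def)
    qed
    then show ?thesis by blast
  qed
  then show "\<exists>u r. u \<noteq> 0 \<and> de (bas (dn p)) = scl u (bas p) + r \<and> (\<forall>K\<in>keys r. K \<in> Hi \<longrightarrow> (K, p) \<in> {})"
    unfolding e tj using cc_nz[of ?S "{?j}"]
    by (intro exI[of _ "cc ?S {?j}"] exI[of _ "\<Sum>i\<in>set_mset ?M - {?j}. ?t i"]) auto
qed auto

text \<open>Dual to \<open>triang_de\<close>: only the term that removes the least index from the
  set lies in \<open>Lo\<close>.\<close>

lemma triang_dd: "triang {} Lo up dd"
  unfolding triang_def
proof (intro conjI ballI)
  show "inj_on up Lo" using up_props by (metis inj_onI)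
  fix p assume p: "p \<in> Lo"
  then have k: "p \<in> KK" "mn p \<notin> fst p" by (auto simp: Lo_def)
  have jM: "mn p \<in># snd p" using mn_in(1)[OF k(1)] k(2) by blast
  let ?j = "mn p" let ?S = "insert ?j (fst p)" let ?M = "snd p - {#?j#}"
  let ?t = "\<lambda>s. scl (cc (?S - {s}) {s}) (bas (?S - {s}, add_mset s ?M)) :: idx \<Rightarrow>\<^sub>0 'k"
  have "?S \<inter> {1..n} = insert ?j (fst p \<inter> {1..n})" using mn_in(2)[OF k(1)] by auto
  then have e: "dd (bas (up p)) = ?t ?j + (\<Sum>s\<in>fst p \<inter> {1..n}. ?t s)"
    using k(2) by (simp add: dd_b_def up_def)
  have tj: "?t ?j = scl (cc (fst p) {?j}) (bas p)" using k(2) jM by simp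
  have "keys (\<Sum>s\<in>fst p \<inter> {1..n}. ?t s) \<inter> Lo = {}"
  proof -
    have "keys (\<Sum>s\<in>fst p \<inter> {1..n}. ?t s) \<subseteq> - Lo"
    proof (rule keys_sumI, rule keys_sclI, rule keys_basI)
      fix s assume s: "s \<in> fst p \<inter> {1..n}"
      let ?q = "(?S - {s}, add_mset s ?M)"
      have "set_mset ?M \<subseteq> set_mset (snd p)" by (rule set_mset_mono[OF diff_subset_eq_self])
      then have "mn ?q = ?j" using s k(2) jM by (intro mn_eqI[OF k(1)]) auto
      then show "?q \<in> - Lo" using s k(2) by (auto simp: Lo_def)
    qed
    then show ?thesis by blast
  qed
  moreover have "cc (fst p) {?j} \<noteq> (0::'k)" using k(2) by (intro cc_nz) auto
  ultimately show "\<exists>u r. u \<noteq> 0 \<and> dd (bas (up p)) = scl u (bas p) + r \<and> (\<forall>K\<in>keys r. K \<in> Lo \<longrightarrow> (K, p) \<in> {})"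
    unfolding e tj by (intro exI[of _ "cc (fst p) {?j}"] exI[of _ "\<Sum>s\<in>fst p \<inter> {1..n}. ?t s"]) auto
qed auto

definition KBP :: "(nat \<Rightarrow> bool) \<Rightarrow> nat \<Rightarrow> idx set"
  where "KBP P p = {q\<in>KB p. P (wtK q)}"

lemma KBP_KK: "\<not> P 0 \<Longrightarrow> KBP P m \<subseteq> KK"
  by (auto simp: KBP_def KB_def KK_def wtK_def)

lemma KK_KBP: "q \<in> KK \<Longrightarrow> P (wtK q) \<Longrightarrow> size (snd q) = m \<Longrightarrow> q \<in> KBP P m"
  unfolding KBP_def KB_def KK_def by (cases q) simp

text \<open>Inherited from \<open>bb_bb\<close>: in even weight \<open>bb\<close> is twice
  \<open>de\<close> along the injective map \<open>io\<close>.\<close>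

lemma de_de_even: "keys x \<subseteq> {p. set_mset (snd p) \<subseteq> {1..n} \<and> even (wtK p)} \<Longrightarrow> de (de x) = 0"
proof (rule lin_eq_on[of "\<lambda>x. de (de x)" "\<lambda>x. 0"])
  fix p assume "keys x \<subseteq> {p. set_mset (snd p) \<subseteq> {1..n} \<and> even (wtK p)}" "p \<in> keys x"
  then have p: "set_mset (snd p) \<subseteq> {1..n}" "even (wtK p)" by auto
  have b: "bb (io (bas q)) = scl 2 (io (de (bas q)))" if "set_mset (snd q) \<subseteq> {1..n}" "even (wtK q)" for q
    using bb_io_b[of "snd q" "fst q"] that by simp
  have b2: "bb (io y) = scl 2 (io (de y))" if "keys y \<subseteq> {q. set_mset (snd q) \<subseteq> {1..n} \<and> even (wtK q)}" for y
    by (rule lin_eq_on[of "\<lambda>y. bb (io y)" "\<lambda>y. scl 2 (io (de y))"]) (use that b in auto)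
  have kd: "keys (de (bas p)) \<subseteq> {q. set_mset (snd q) \<subseteq> {1..n} \<and> even (wtK q)}"
  proof
    fix q assume q: "q \<in> keys (de (bas p))"
    have "even (wtK q)" using wt_de[OF p(1)] q p(2) by auto
    moreover have "keys (de_b p :: _ \<Rightarrow>\<^sub>0 'k) \<subseteq> {q. set_mset (snd q) \<subseteq> set_mset (snd p)}"
      unfolding de_b_def by (intro keysI) (auto dest: in_diffD)
    then have "set_mset (snd q) \<subseteq> {1..n}" using q p(1) by auto
    ultimately show "q \<in> {q. set_mset (snd q) \<subseteq> {1..n} \<and> even (wtK q)}" by blast
  qed
  have "bb (bb (io (bas p))) = scl 2 (scl 2 (io (de (de (bas p)))))"
    unfolding b[OF p] by (simp only: lext_simps scl_add[symmetric] b2[OF kd])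
  then have "scl 4 (io (de (de (bas p)))) = 0" unfolding bb_bb by simp
  then have "scl (inverse 4) (scl 4 (io (de (de (bas p))))) = 0" by (simp del: scl_scl)
  then have "io (de (de (bas p))) = 0" by simp
  then show "de (de (bas p)) = 0" by (rule io_inj)
qed auto

text \<open>Weight 0 has to be excluded because \<open>({}, {#})\<close> has no index to move and is
  left unmatched.\<close>

lemma de_exact:
  assumes f: "keys f \<subseteq> KBP (\<lambda>w. even w \<and> w \<noteq> 0) m" "de f = 0"
  shows "\<exists>\<tau>. keys \<tau> \<subseteq> KBP (\<lambda>w. even w \<and> w \<noteq> 0) (Suc m) \<and> f = de \<tau>"
proof -
  let ?P = "\<lambda>w. even w \<and> w \<noteq> 0"
  have sub: "KBP ?P m \<subseteq> KK" by (rule KBP_KK) simp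
  have dnB: "dn p \<in> KBP ?P (Suc m)" if "p \<in> Hi \<inter> KBP ?P m" for p
    using dn_props[of p] that by (intro KK_KBP) (auto simp: Lo_def KBP_def KB_def)
  have "\<exists>\<tau>. keys \<tau> \<subseteq> dn ` (Hi \<inter> KBP ?P m) \<and> f = de \<tau>"
  proof (rule triang_exact[OF triang_de _ f])
    fix x :: "idx \<Rightarrow>\<^sub>0 'k" assume "keys x \<subseteq> dn ` (Hi \<inter> KBP ?P m)"
    then have "keys x \<subseteq> KBP ?P (Suc m)" using dnB by blast
    moreover have "KBP ?P (Suc m) \<subseteq> {p. set_mset (snd p) \<subseteq> {1..n} \<and> even (wtK p)}" by (auto simp: KBP_def KB_def)
    ultimately show "de (de x) = 0" by (intro de_de_even) (rule subset_trans)
  next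
    show "KBP ?P m \<subseteq> Hi \<union> dn ` Hi" using sub KK_dn by (rule subset_trans)
  next
    fix s assume s: "s \<in> Hi \<inter> KBP ?P m"
    have d: "dn s \<in> KBP ?P (Suc m)" by (rule dnB[OF s])
    then have 1: "keys (de_b (dn s) :: _ \<Rightarrow>\<^sub>0 'k) \<subseteq> KB m" by (intro KB_de) (simp add: KBP_def)
    have 2: "keys (de_b (dn s) :: _ \<Rightarrow>\<^sub>0 'k) \<subseteq> {q. wtK q = wtK (dn s)}"
      using wt_de[of "dn s"] d by (auto simp: KBP_def KB_def)
    show "keys (de (bas (dn s))) \<subseteq> KBP ?P m" using 1 2 d by (auto simp: KBP_def)
  qed
  then show ?thesis using dnB by blast
qed

lemma dd_keys: "p \<in> KB m \<Longrightarrow> keys (dd_b p :: _ \<Rightarrow>\<^sub>0 'k) \<subseteq> {q\<in>KB (Suc m). wtK q = wtK p}"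
  unfolding dd_b_def
proof (intro keysI)
  fix s assume p: "p \<in> KB m" and s: "s \<in> fst p \<inter> {1..n}"
  have "cd (fst p) = Suc (cd (fst p - {s}))"
    using cd_Un[of "fst p - {s}" "{s}"] s cd_single[of s] by (simp add: insert_absorb)
  then show "(fst p - {s}, add_mset s (snd p)) \<in> {q\<in>KB (Suc m). wtK q = wtK p}"
    using p s by (auto simp: KB_def wtK_def)
qed

lemma dd_exact:
  assumes f: "keys f \<subseteq> KBP odd m" "dd f = 0"
  shows "\<exists>\<tau>. keys \<tau> \<subseteq> up ` (Lo \<inter> KBP odd m) \<and> f = dd \<tau>"
proof (rule triang_exact[OF triang_dd _ f])
  show "KBP odd m \<subseteq> Lo \<union> up ` Lo" using KBP_KK[of odd m] KK_up by (meson even_zero subset_trans)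
next
  fix s assume s: "s \<in> Lo \<inter> KBP odd m"
  then have sz: "size (snd s) = m" and od: "odd (wtK s)" and sL: "s \<in> Lo" by (auto simp: KBP_def KB_def)
  note u = up_props[OF sL]
  obtain m' where m: "m = Suc m'" using u sz by metis
  have "up s \<in> KBP odd m'"
    by (rule KK_KBP) (use u sz od m in \<open>simp_all add: Hi_def\<close>)
  then show "keys (dd (bas (up s))) \<subseteq> KBP odd m" using dd_keys[of "up s" m'] m by (auto simp: KBP_def)
qed simp

end

lemma sum_const_scl: "(\<Sum>i\<in>A. y) = scl (of_nat (card A)) (y :: 's \<Rightarrow>\<^sub>0 'k::field)"
  by (induction A rule: infinite_finite_induct) (auto simp: scl_add_left)

lemma lext_bas_id [simp]: "lext bas x = x"
  by (rule lin_eqI[where x=x]) auto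

context grass
begin

section \<open>The map to differential forms\<close>

abbreviation X :: "nat set \<Rightarrow> (idx \<Rightarrow>\<^sub>0 'k) \<Rightarrow> (idx \<Rightarrow>\<^sub>0 'k)"
  where "X S \<equiv> lext (\<lambda>p. scl (cc S (fst p)) (bas (S \<union> fst p, snd p)))"

text \<open>The commutator of the differential with multiplication by \<open>e_S\<close> is, up to
  sign conventions, multiplication by the differential of \<open>e_S\<close>. In this form the
  derivation rules follow formally.\<close>

definition DD :: "nat set \<Rightarrow> (idx \<Rightarrow>\<^sub>0 'k) \<Rightarrow> (idx \<Rightarrow>\<^sub>0 'k)"
  where "DD S x = dd (X S x) - X S (dd x)"

lemma lin_DD: "lin (DD S)" unfolding DD_def by auto
lemmas DD_simps [simp] = lin_rules[OF lin_DD]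
lemma lin_DD_comp [intro!]: "lin g \<Longrightarrow> lin (\<lambda>x. DD S (g x))"
  by (rule lin_comp[OF lin_DD])

lemma X_X: "X S (X T x) = scl (cc S T) (X (S \<union> T) x)"
  by (rule lin_eqI[where x=x]) (auto simp: cc_assoc mult.commute Un_assoc)

lemma X_empty [simp]: "X {} x = x"
  by (rule lin_eqI[where x=x]) auto

lemma DD_empty [simp]: "DD {} x = 0"
  by (simp add: DD_def)

lemma X_swap: "X S (X T x) = scl ((-1) ^ (cd S * cd T)) (X T (X S x))"
proof -
  have "cc S T = ((-1) ^ (cd S * cd T) * cc T S :: 'k)" by (rule cc_swap)
  then show ?thesis unfolding X_X by (simp add: Un_commute)
qed

text \<open>The Leibniz rule, which every commutator satisfies.\<close>

lemma DD_X: "scl (cc S T) (DD (S \<union> T) x) = DD S (X T x) + X S (DD T x)"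
  unfolding DD_def by (simp add: X_X)

abbreviation Y :: "nat \<Rightarrow> (idx \<Rightarrow>\<^sub>0 'k) \<Rightarrow> (idx \<Rightarrow>\<^sub>0 'k)"
  where "Y i \<equiv> lext (\<lambda>p. scl ((-1) ^ cd (fst p)) (bas (fst p, add_mset i (snd p))))"

text \<open>Only the term that differentiates the new generator survives, and passing
  \<open>e_U\<close> produces its sign. If \<open>i\<close> lies in \<open>U\<close> the product
  with \<open>e_i\<close> vanishes, and the same term arises from the other half of the
  commutator.\<close>

lemma DD_single: "i \<in> {1..n} \<Longrightarrow> DD {i} x = Y i x"
proof (rule lin_eqI[where x=x])
  fix p :: idx assume i: "i \<in> {1..n}"
  obtain U M where p: "p = (U, M)" by (cases p)
  let ?t = "\<lambda>s. scl (cc (U - {s}) {s}) (bas (U - {s}, add_mset s M)) :: idx \<Rightarrow>\<^sub>0 'k"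
  have d: "dd (bas p) = (\<Sum>s\<in>U \<inter> {1..n}. ?t s)" by (simp add: p dd_b_def)
  show "DD {i} (bas p) = Y i (bas p)"
  proof (cases "i \<in> U")
    case False
    have U1: "insert i U \<inter> {1..n} = insert i (U \<inter> {1..n})" using i by auto
    have c1: "cc {i} U * cc U {i} = ((-1) ^ cd U :: 'k)"
      using cc_swap[of "{i}" U] cd_single[OF i] cc_sq[of U "{i}"] False by simp
    have "dd (X {i} (bas p)) = scl (cc {i} U) (\<Sum>s\<in>insert i (U \<inter> {1..n}).
        scl (cc (insert i U - {s}) {s}) (bas (insert i U - {s}, add_mset s M)))"
      by (simp add: p dd_b_def U1 del: One_nat_def)
    also have "\<dots> = scl ((-1) ^ cd U) (bas (U, add_mset i M)) + (\<Sum>s\<in>U \<inter> {1..n}.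
        scl (cc {i} U * cc (insert i U - {s}) {s}) (bas (insert i U - {s}, add_mset s M)))"
      using False by (simp add: c1)
    also have "(\<Sum>s\<in>U \<inter> {1..n}. scl (cc {i} U * cc (insert i U - {s}) {s}) (bas (insert i U - {s}, add_mset s M)))
       = (\<Sum>s\<in>U \<inter> {1..n}. X {i} (?t s))"
    proof (rule sum.cong[OF refl])
      fix s assume s: "s \<in> U \<inter> {1..n}"
      have e: "insert i U - {s} = {i} \<union> (U - {s})" using s False by auto
      have U: "U = (U - {s}) \<union> {s}" using s by auto
      have c2: "cc {i} U = (cc {i} (U - {s}) * cc {i} {s} :: 'k)"
        by (subst U, rule cc_Un_right) auto
      have c3: "cc ({i} \<union> (U - {s})) {s} = (cc {i} {s} * cc (U - {s}) {s} :: 'k)"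
        by (rule cc_Un_left) (use False in auto)
      have c4: "cc {i} {s} * cc {i} {s} = (1 :: 'k)" by (rule cc_sq) (use False s in auto)
      have "cc {i} U * cc ({i} \<union> (U - {s})) {s} = (cc {i} (U - {s}) * cc (U - {s}) {s} * (cc {i} {s} * cc {i} {s}) :: 'k)"
        unfolding c2 c3 by (simp only: mult_ac)
      then have "cc {i} U * cc ({i} \<union> (U - {s})) {s} = (cc (U - {s}) {s} * cc {i} (U - {s}) :: 'k)"
        unfolding c4 by (simp add: mult.commute)
      then show "scl (cc {i} U * cc (insert i U - {s}) {s}) (bas (insert i U - {s}, add_mset s M)) = X {i} (?t s)"
        unfolding e by simp
    qed
    finally show ?thesis unfolding DD_def d by (simp add: p)
  next
    case True
    have "X {i} (dd (bas p)) = (\<Sum>s\<in>U \<inter> {1..n}. X {i} (?t s))" unfolding d by simp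
    also have "\<dots> = (\<Sum>s\<in>U \<inter> {1..n}. if s = i then X {i} (?t i) else 0)"
    proof (rule sum.cong[OF refl])
      fix s show "X {i} (?t s) = (if s = i then X {i} (?t i) else 0)"
        using True by (cases "s = i") (simp_all add: cc_z)
    qed
    also have "\<dots> = X {i} (?t i)" using True i by simp
    also have "\<dots> = scl (cc (U - {i}) {i} * cc {i} (U - {i})) (bas (U, add_mset i M))"
      using True by (simp add: insert_absorb)
    also have "cc (U - {i}) {i} * cc {i} (U - {i}) = ((-1) ^ cd (U - {i}) :: 'k)"
      using cc_swap[of "{i}" "U - {i}"] cd_single[OF i] cc_sq[of "U - {i}" "{i}"] by simp
    finally have "X {i} (dd (bas p)) = scl ((-1) ^ cd (U - {i})) (bas (U, add_mset i M))" .
    moreover have "cd U = Suc (cd (U - {i}))"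
      using cd_Un[of "U - {i}" "{i}"] True cd_single[OF i] by (simp add: insert_absorb)
    moreover have "X {i} (bas p) = 0" using True by (simp add: p cc_z)
    ultimately show ?thesis unfolding DD_def by (simp add: p)
  qed
qed (auto intro: lin_DD)

lemma Y_X: "Y i (X S x) = scl ((-1) ^ cd S) (X S (Y i x))"
proof (rule lin_eqI[where x=x])
  fix p :: idx
  show "Y i (X S (bas p)) = scl ((-1) ^ cd S) (X S (Y i (bas p)))"
  proof (cases "S \<inter> fst p = {}")
    case True
    then show ?thesis by (simp add: cd_Un power_add mult_ac)
  next
    case False
    then show ?thesis by (simp add: cc_z)
  qed
qed auto

text \<open>Peel one generator off \<open>T\<close> by the Leibniz rule and use \<open>Y_X\<close>
  for it; the nonzero factor \<open>cc {i} T\<close> is cancelled at the end.\<close>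

lemma DD_X_swap:
  assumes "T \<subseteq> {1..n}"
  shows "DD T (X S x) = scl ((-1) ^ (cd S * cd T)) (X S (DD T x))"
proof -
  have "finite T" using assms finite_subset by blast
  then show ?thesis using assms
  proof (induction T arbitrary: x)
    case (insert i T)
    have i: "i \<in> {1..n}" and T: "T \<subseteq> {1..n}" using insert by auto
    have c: "cc {i} T \<noteq> (0 :: 'k)" using insert(2) by (intro cc_nz) auto
    have cdT: "cd (insert i T) = Suc (cd T)"
      using cd_Un[of "{i}" T] insert(2) cd_single[OF i] by simp
    have D: "scl (cc {i} T) (DD (insert i T) x) = Y i (X T x) + X {i} (DD T x)" for x
      using DD_X[of "{i}" T x] DD_single[OF i] by simp
    have "scl (cc {i} T) (DD (insert i T) (X S x)) = Y i (X T (X S x)) + X {i} (DD T (X S x))" by (rule D)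
    also have "Y i (X T (X S x)) = scl ((-1) ^ (cd S * cd (insert i T))) (X S (Y i (X T x)))"
      unfolding X_swap[of T S] using Y_X[of i S "X T x"] by (simp add: cdT power_add mult_ac)
    also have "X {i} (DD T (X S x)) = scl ((-1) ^ (cd S * cd (insert i T))) (X S (X {i} (DD T x)))"
      unfolding insert.IH[OF T] using X_swap[of "{i}" S "DD T x"] cd_single[OF i]
      by (simp add: cdT power_add mult_ac)
    also have "scl ((-1) ^ (cd S * cd (insert i T))) (X S (Y i (X T x))) + scl ((-1) ^ (cd S * cd (insert i T))) (X S (X {i} (DD T x)))
       = scl (cc {i} T) (scl ((-1) ^ (cd S * cd (insert i T))) (X S (DD (insert i T) x)))"
      using arg_cong[OF D[of x], of "\<lambda>y. scl ((-1) ^ (cd S * cd (insert i T))) (X S y)"]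
      by (simp add: mult.commute)
    finally show ?case by (simp only: scl_cancel[OF c])
  qed simp
qed

lemma dd_DD: "dd (DD S x) = - DD S (dd x)"
  by (simp add: DD_def)

text \<open>Apply \<open>dd\<close> to \<open>DD_X_swap\<close> at \<open>x\<close> and add the same
  identity at \<open>dd x\<close>. Since \<open>dd\<close> anticommutes with \<open>DD\<close>, the
  sums collapse to the two products.\<close>

lemma DD_DD:
  assumes "T \<subseteq> {1..n}"
  shows "DD T (DD S x) = - scl ((-1) ^ (cd S * cd T)) (DD S (DD T x))"
proof -
  have "dd (DD T (X S x)) + DD T (X S (dd x)) = scl ((-1) ^ (cd S * cd T)) (dd (X S (DD T x)) + X S (DD T (dd x)))"
    by (simp add: DD_X_swap[OF assms])
  moreover have "dd (DD T (X S x)) + DD T (X S (dd x)) = - DD T (DD S x)"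
    unfolding dd_DD by (simp add: DD_def[of S])
  moreover have "dd (X S (DD T x)) + X S (DD T (dd x)) = DD S (DD T x)"
    by (simp add: DD_def[of S] dd_DD)
  ultimately show ?thesis by (metis minus_minus)
qed

text \<open>On a tensor \<open>a_0, ..., a_q\<close>, \<open>F\<close> is
  \<open>da_0 ... da_q\<close>, \<open>G\<close> is the Hochschild-Kostant-Rosenberg form
  \<open>a_0 da_1 ... da_q\<close>, and \<open>E\<close> is \<open>da_0 ... da_(q-1) a_q\<close>,
  the form that arises at the far end when the product rule telescopes.\<close>

fun F_b :: "nat set list \<Rightarrow> (idx \<Rightarrow>\<^sub>0 'k)" where
  "F_b [] = bas ({}, {#})"
| "F_b (S # L) = DD S (F_b L)"
abbreviation "F \<equiv> lext F_b"

fun G_b :: "nat set list \<Rightarrow> (idx \<Rightarrow>\<^sub>0 'k)" where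
  "G_b [] = 0"
| "G_b (S # L) = X S (F_b L)"
abbreviation "G \<equiv> lext G_b"

fun E_b :: "nat set list \<Rightarrow> (idx \<Rightarrow>\<^sub>0 'k)" where
  "E_b [] = 0"
| "E_b [S] = bas (S, {#})"
| "E_b (S # T # L) = DD S (E_b (T # L))"
abbreviation "E \<equiv> lext E_b"

lemma F_cons: "F (cons S x) = DD S (F x)"
  by (rule lin_eqI[where x=x]) auto
lemma G_cons: "G (cons S x) = X S (F x)"
  by (rule lin_eqI[where x=x]) auto

lemma dd_one [simp]: "dd_b ({}, M) = 0" by (simp add: dd_b_def)

lemma dd_F [simp]: "dd (F x) = 0"
proof (rule lin_eqI[where x=x])
  fix L show "dd (F (bas L)) = 0"
  proof (induction L)
    case (Cons S L)
    have "dd (DD S (F_b L)) = - DD S (dd (F (bas L)))" by (simp add: dd_DD)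
    then show ?case unfolding Cons by simp
  qed simp
qed auto

lemma dd_G: "[] \<notin> keys x \<Longrightarrow> dd (G x) = F x"
proof (rule lin_eq_on[of "\<lambda>x. dd (G x)" F])
  fix L assume "[] \<notin> keys x" "L \<in> keys x"
  then obtain S M where L: "L = S # M" by (cases L) auto
  have "dd (F (bas M)) = 0" by (rule dd_F)
  then show "dd (G (bas L)) = F (bas L)" by (simp add: L DD_def)
qed auto

lemma F_lm: "F (lm S (bas (T # L))) = DD S (G (bas (T # L))) + X S (F (bas (T # L)))"
  using DD_X[of S T "F_b L"] by simp

lemma G_lm: "G (lm S x) = X S (G x)"
proof (rule lin_eqI[where x=x])
  fix L show "G (lm S (bas L)) = X S (G (bas L))" by (cases L) (auto simp: X_X)
qed auto

text \<open>The product rule splits each merged entry in two, and neighbouring contributions cancel.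
  What remains are the ends, where the first or the last entry is left undifferentiated.\<close>

lemma F_beta: "F (beta (bas L)) = G (bas L) + E (sg (bas L))"
proof (induction L rule: beta_b.induct)
  case (3 S T L)
  have "F (beta (cons S (bas (T # L)))) = DD S (G (bas (T # L))) + X S (F (bas (T # L))) - DD S (F (beta (bas (T # L))))"
    unfolding beta_cons lext_simps F_lm F_cons by simp
  also have "\<dots> = X S (F (bas (T # L))) - DD S (E (sg (bas (T # L))))" unfolding 3 by simp
  finally show ?case by simp
qed (auto simp: X_X)

lemma G_beta: "G (beta (bas (S # L))) = - X S (E (sg (bas L)))"
proof -
  have "G (beta (cons S (bas L))) = X S (G (bas L)) - X S (F (beta (bas L)))"
    unfolding beta_cons lext_simps G_lm G_cons by simp
  also have "\<dots> = - X S (E (sg (bas L)))" unfolding F_beta by simp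
  finally show ?thesis by simp
qed

section \<open>Weights, and the behaviour of the forms under \<open>b\<close> and
  \<open>t\<close>\<close>

definition wt :: "nat set list \<Rightarrow> nat" where "wt L = sum_list (map cd L)"

definition Lst :: "nat set list set" where "Lst = {L. set L \<subseteq> Pow {1..n}}"

text \<open>The undifferentiated last entry moves to the front past differentials of total weight
  \<open>wt M\<close>.\<close>

lemma E_snoc: "M @ [z] \<in> Lst \<Longrightarrow> E_b (M @ [z]) = scl ((-1) ^ (cd z * wt M)) (X z (F_b M))"
proof (induction M)
  case (Cons S M)
  have "E_b ((S # M) @ [z]) = DD S (E_b (M @ [z]))" by (cases M) auto
  also have "\<dots> = scl ((-1) ^ (cd z * wt M)) (DD S (X z (F_b M)))"
    using Cons by (simp add: Lst_def)
  also have "DD S (X z (F_b M)) = scl ((-1) ^ (cd z * cd S)) (X z (DD S (F_b M)))"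
    by (rule DD_X_swap) (use Cons in \<open>simp add: Lst_def\<close>)
  finally show ?case by (simp add: wt_def power_add algebra_simps)
qed (simp add: wt_def)

lemma F_snoc: "M @ [z] \<in> Lst \<Longrightarrow> F_b (M @ [z]) = scl ((-1) ^ (cd z * wt M + length M)) (DD z (F_b M))"
proof (induction M)
  case (Cons S M)
  have "F_b ((S # M) @ [z]) = DD S (scl ((-1) ^ (cd z * wt M + length M)) (DD z (F_b M)))"
    using Cons by (simp add: Lst_def)
  also have "\<dots> = scl ((-1) ^ (cd z * wt M + length M)) (DD S (DD z (F_b M)))" by simp
  also have "DD S (DD z (F_b M)) = - scl ((-1) ^ (cd z * cd S)) (DD z (DD S (F_b M)))"
    by (rule DD_DD) (use Cons in \<open>simp add: Lst_def\<close>)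
  finally show ?case by (simp add: wt_def power_add algebra_simps)
qed (simp add: wt_def)

text \<open>The inner faces telescope to one term with \<open>a_q\<close> undifferentiated at the
  end, and the cyclic face has \<open>a_q\<close> at the front. Moving it costs
  \<open>(-1)^(a (w - a))\<close>, where \<open>a\<close> is its weight; for odd \<open>w\<close>
  one of the two factors in the exponent is even, so the terms cancel.\<close>

lemma G_bb: "L \<in> Lst \<Longrightarrow> odd (wt L) \<Longrightarrow> G (bb (bas L)) = 0"
proof -
  assume L: "L \<in> Lst" "odd (wt L)"
  show ?thesis
  proof (cases L)
    case Nil then show ?thesis by simp
  next
    case (Cons a L')
    show ?thesis
    proof (cases L' rule: rev_cases)
      case Nil
      then show ?thesis using Cons by (simp add: W_b_def)
    next
      case (snoc M z)
      have LL: "M @ [z] \<in> Lst" using L Cons snoc by (simp add: Lst_def)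
      have "G (beta (bas L)) = - scl ((-1) ^ Suc (length M)) (X a (E (bas (M @ [z]))))"
        using G_beta[of a L'] Cons snoc by simp
      also have "X a (E (bas (M @ [z]))) = scl ((-1) ^ (cd z * wt M)) (X a (X z (F_b M)))"
        using E_snoc[OF LL] by simp
      also have "X a (X z (F_b M)) = scl ((-1) ^ (cd a * cd z)) (X z (X a (F_b M)))" by (rule X_swap)
      finally have 1: "G (beta (bas L)) = scl ((-1) ^ length M * (-1) ^ (cd z * (wt M + cd a))) (X z (X a (F_b M)))"
        by (simp add: power_add algebra_simps)
      have "even (cd z * (wt M + cd a))"
        using L(2) Cons snoc by (auto simp: wt_def)
      then have 2: "G (beta (bas L)) = scl ((-1) ^ length M) (X z (X a (F_b M)))" using 1 by simp
      have "W (bas L) = (scl ((-1) ^ Suc (length M)) (lm z (bas (a # M))) :: _ \<Rightarrow>\<^sub>0 'k)"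
        using W_b_simps(2)[of "a # M" z] Cons snoc by simp
      then have "G (W (bas L)) = scl ((-1) ^ Suc (length M)) (X z (G (bas (a # M))))"
        by (simp only: lext_simps G_lm)
      then show ?thesis using 2 by simp
    qed
  qed
qed

text \<open>Moving \<open>da_q\<close> to the front costs the sign of \<open>tt\<close>, from
  anticommuting one-forms, times a sign that depends on weights and is 1 in odd weight.\<close>

lemma F_t: "L \<in> Lst \<Longrightarrow> odd (wt L) \<Longrightarrow> F (tt (bas L)) = F (bas L)"
proof (cases L rule: rev_cases)
  case (snoc M z)
  assume L: "L \<in> Lst" "odd (wt L)"
  have "even (cd z * wt M)" using L(2) snoc by (auto simp: wt_def)
  then show ?thesis using F_snoc[of M z] L snoc by (simp add: power_add)
qed simp

lemma wt_Cons [simp]: "wt (S # L) = cd S + wt L" by (simp add: wt_def)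
lemma wt_append [simp]: "wt (L @ M) = wt L + wt M" by (simp add: wt_def)
lemma wt_Nil [simp]: "wt [] = 0" by (simp add: wt_def)

lemma wt_lm: "keys (lm_b S L :: _ \<Rightarrow>\<^sub>0 'k) \<subseteq> {K. wt K = cd S + wt L}"
proof (cases L)
  case (Cons T M)
  then show ?thesis
    by (cases "S \<inter> T = {}") (auto simp: cc_z cd_Un intro!: keysI simp del: keys_single)
qed simp

lemma wt_beta: "keys (beta_b L :: _ \<Rightarrow>\<^sub>0 'k) \<subseteq> {K. wt K = wt L}"
proof (induction L rule: beta_b.induct)
  case (3 S T L)
  have "keys (cons S (beta_b (T # L)) :: _ \<Rightarrow>\<^sub>0 'k) \<subseteq> {K. wt K = wt (S # T # L)}"
    by (rule keys_lext) (use 3 in auto)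
  moreover have "keys (scl (cc S T) (bas ((S \<union> T) # L)) :: _ \<Rightarrow>\<^sub>0 'k) \<subseteq> {K. wt K = wt (S # T # L)}"
    using wt_lm[of S "T # L"] by simp
  ultimately show ?case unfolding beta_b.simps by (intro keys_diffI)
qed auto

lemma wt_W: "keys (W_b L :: _ \<Rightarrow>\<^sub>0 'k) \<subseteq> {K. wt K = wt L}"
proof (cases L rule: rev_cases)
  case (snoc M z)
  have "keys (scl ((-1) ^ length M) (lm_b z M) :: _ \<Rightarrow>\<^sub>0 'k) \<subseteq> {K. wt K = cd z + wt M}"
    using wt_lm by (rule keys_sclI)
  then show ?thesis using snoc by (simp add: add.commute)
qed simp

lemma wt_t: "keys (t_b L :: _ \<Rightarrow>\<^sub>0 'k) \<subseteq> {K. wt K = wt L}"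
  by (cases L rule: rev_cases) (auto intro!: keysI simp del: keys_single)

text \<open>Restricted to odd weight, since only there \<open>G\<close> vanishes on Hochschild boundaries.\<close>
definition phi_b :: "nat set list \<Rightarrow> (idx \<Rightarrow>\<^sub>0 'k)" where
  "phi_b L = (if odd (wt L) then G_b L else 0)"
abbreviation "phi \<equiv> lext phi_b"

lemma phi_wt: "keys x \<subseteq> {K. wt K = w} \<Longrightarrow> phi x = (if odd w then G x else 0)"
  by (cases "odd w"; rule lin_eq_on[where f=phi]) (auto simp: phi_b_def)

lemma phi_bb: "keys x \<subseteq> Lst \<Longrightarrow> phi (bb x) = 0"
proof (rule lin_eq_on[of "\<lambda>x. phi (bb x)" "\<lambda>x. 0"])
  fix L assume "keys x \<subseteq> Lst" "L \<in> keys x"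
  then have L: "L \<in> Lst" by blast
  have k: "keys (bb (bas L)) \<subseteq> {K. wt K = wt L}" unfolding lext_bas by (intro keys_addI wt_beta wt_W)
  show "phi (bb (bas L)) = 0" unfolding phi_wt[OF k] using G_bb[OF L] by simp
qed auto

lemma phi_cons_empty: "phi (cons {} x) = lext (\<lambda>L. if odd (wt L) then F_b L else 0) x"
  by (rule lin_eqI[where x=x]) (auto simp: phi_b_def)

text \<open>With the unit in front every entry is differentiated, so \<open>F_t\<close>
  applies.\<close>

lemma phi_s_t: "keys x \<subseteq> Lst \<Longrightarrow> phi (cons {} (tt x)) = phi (cons {} x)"
proof (rule lin_eq_on[of "\<lambda>x. phi (cons {} (tt x))" "\<lambda>x. phi (cons {} x)"])
  fix L assume "keys x \<subseteq> Lst" "L \<in> keys x"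
  then have L: "L \<in> Lst" by blast
  have k: "keys (cons {} (tt (bas L)) :: _ \<Rightarrow>\<^sub>0 'k) \<subseteq> {K. wt K = wt L}"
    by (rule keys_lext) (use wt_t[of L] in auto)
  have "G (cons {} (tt (bas L))) = F (tt (bas L))" "G (cons {} (bas L)) = F (bas L)"
    by (simp_all only: G_cons X_empty)
  then show "phi (cons {} (tt (bas L))) = phi (cons {} (bas L))"
    using phi_wt[OF k] F_t[OF L] by (auto simp: phi_b_def)
qed auto

text \<open>Rotation moves the unit into a differentiated place, and the differential of 1 is
  0.\<close>

lemma phi_t_s: "[] \<notin> keys x \<Longrightarrow> phi (tt (cons {} x)) = 0"
proof (rule lin_eq_on[of "\<lambda>x. phi (tt (cons {} x))" "\<lambda>x. 0"])
  fix L assume "[] \<notin> keys x" "L \<in> keys x"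
  then have "L \<noteq> []" by auto
  then obtain M z where L: "L = M @ [z]" by (cases L rule: rev_cases) auto
  have "tt (bas (({} # M) @ [z])) = (scl ((-1) ^ Suc (length M)) (bas (z # {} # M)) :: _ \<Rightarrow>\<^sub>0 'k)"
    unfolding lext_bas t_b_simps by simp
  then show "phi (tt (cons {} (bas L))) = 0" unfolding L by (simp add: phi_b_def)
qed auto

lemma dd_phi: "[] \<notin> keys x \<Longrightarrow> dd (phi x) = phi (cons {} x)"
proof (rule lin_eq_on[of "\<lambda>x. dd (phi x)" "\<lambda>x. phi (cons {} x)"])
  fix L assume "[] \<notin> keys x" "L \<in> keys x"
  then have "[] \<notin> keys (bas L :: _ \<Rightarrow>\<^sub>0 'k)" by auto
  then have "dd (G (bas L)) = F (bas L)" by (rule dd_G)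
  then show "dd (phi (bas L)) = phi (cons {} (bas L))" by (simp add: phi_b_def)
qed auto

lemma F_sing: "set w \<subseteq> {1..n} \<Longrightarrow> F_b (sing w) = bas ({}, mset w)"
  by (induction w) (auto simp: DD_single)

lemma wt_sing: "set w \<subseteq> {1..n} \<Longrightarrow> wt (sing w) = length w"
  by (induction w) (auto simp: cd_single)

text \<open>Every word of content \<open>M\<close> yields the same ordinary monomial.
  \<open>io\<close> uses divided powers and \<open>phi\<close> ordinary powers, which explains the
  number of words as a factor.\<close>

lemma phi_io:
  assumes "p \<in> KB m"
  shows "phi (io_b p) = (if odd (wtK p) then scl (of_nat (card (permutations_of_multiset (snd p)))) (bas p) else 0)"
proof -
  obtain S M where p: "p = (S, M)" by (cases p)
  have M: "set_mset M \<subseteq> {1..n}" using assms p by (simp add: KB_def)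
  have "phi (io_b p) = (\<Sum>w\<in>permutations_of_multiset M. phi_b (S # sing w))"
    unfolding p io_b_sum by simp
  also have "\<dots> = (\<Sum>w\<in>permutations_of_multiset M. if odd (wtK p) then bas p else 0)"
  proof (rule sum.cong[OF refl])
    fix w assume "w \<in> permutations_of_multiset M"
    then have w: "mset w = M" by (simp add: permutations_of_multiset_def)
    then have "set w \<subseteq> {1..n}" "length w = size M" using M by auto
    then show "phi_b (S # sing w) = (if odd (wtK p) then bas p else 0)"
      using F_sing[of w] wt_sing[of w] w by (simp add: phi_b_def p wtK_def)
  qed
  also have "\<dots> = (if odd (wtK p) then scl (of_nat (card (permutations_of_multiset M))) (bas p) else 0)"
    by (simp add: sum_const_scl)
  finally show ?thesis by (simp add: p)
qed

definition KBw :: "nat \<Rightarrow> nat \<Rightarrow> idx set" where "KBw m w = {q\<in>KB m. wtK q = w}"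

lemma keys_dd: "keys x \<subseteq> KBw m w \<Longrightarrow> keys (dd x) \<subseteq> KBw (Suc m) w"
proof (rule keys_lext)
  fix p assume "keys x \<subseteq> KBw m w" "p \<in> keys x"
  then have "p \<in> KB m" "wtK p = w" by (auto simp: KBw_def)
  then show "keys (dd_b p :: _ \<Rightarrow>\<^sub>0 'k) \<subseteq> KBw (Suc m) w" using dd_keys[of p m] by (auto simp: KBw_def)
qed

lemma keys_X: "S \<subseteq> {1..n} \<Longrightarrow> keys x \<subseteq> KBw m w \<Longrightarrow> keys (X S x) \<subseteq> KBw m (cd S + w)"
proof (rule keys_lext)
  fix p assume a: "S \<subseteq> {1..n}" "keys x \<subseteq> KBw m w" "p \<in> keys x"
  then have p: "p \<in> KB m" "wtK p = w" by (auto simp: KBw_def)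
  show "keys (scl (cc S (fst p)) (bas (S \<union> fst p, snd p)) :: _ \<Rightarrow>\<^sub>0 'k) \<subseteq> KBw m (cd S + w)"
  proof (cases "S \<inter> fst p = {}")
    case True
    then show ?thesis using p a(1) by (intro keysI) (auto simp: KBw_def KB_def wtK_def cd_Un)
  qed (simp add: cc_z)
qed

lemma keys_F: "L \<in> Lst \<Longrightarrow> keys (F_b L :: _ \<Rightarrow>\<^sub>0 'k) \<subseteq> KBw (length L) (wt L)"
proof (induction L)
  case (Cons S L)
  have IH: "keys (F_b L :: _ \<Rightarrow>\<^sub>0 'k) \<subseteq> KBw (length L) (wt L)" and S: "S \<subseteq> {1..n}"
    using Cons by (auto simp: Lst_def)
  show ?case unfolding F_b.simps DD_def length_Cons wt_Cons
    by (intro keys_diffI keys_dd keys_X S IH)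
qed (auto simp: KBw_def KB_def wtK_def)

lemma keys_phi_s: "keys x \<subseteq> Bs m \<Longrightarrow> keys (phi (cons {} x)) \<subseteq> KBP odd m"
  unfolding phi_cons_empty
proof (rule keys_lext)
  fix L assume "keys x \<subseteq> Bs m" "L \<in> keys x"
  then have "L \<in> Lst" "length L = m" by (auto simp: Bs_def Lst_def)
  then show "keys (if odd (wt L) then F_b L else 0 :: _ \<Rightarrow>\<^sub>0 'k) \<subseteq> KBP odd m"
    using keys_F[of L] by (auto simp: KBw_def KBP_def)
qed

section \<open>The total complex\<close>

text \<open>The operators act on lists of every length, so one formula serves all degrees; the
  degree enters only through the supports prescribed by \<open>TC\<close>.\<close>

definition CD :: "(nat \<Rightarrow> (nat set list \<Rightarrow>\<^sub>0 'k)) \<Rightarrow> nat \<Rightarrow> (nat set list \<Rightarrow>\<^sub>0 'k)"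
  where "CD z p = (if even p then bb (z p) + (z (Suc p) - tt (z (Suc p))) else NN (z (Suc p)) - beta (z p))"

definition TC :: "nat \<Rightarrow> (nat \<Rightarrow> (nat set list \<Rightarrow>\<^sub>0 'k)) set"
  where "TC m = {z. (\<forall>p\<le>m. keys (z p) \<subseteq> Bs (Suc (m - p))) \<and> (\<forall>p>m. z p = 0)}"

lemma TC_D: "z \<in> TC m \<Longrightarrow> p \<le> m \<Longrightarrow> keys (z p) \<subseteq> Bs (Suc (m - p))"
  by (simp add: TC_def)

lemma TC_0: "z \<in> TC m \<Longrightarrow> m < p \<Longrightarrow> z p = 0"
  by (simp add: TC_def)

lemma TC_I: "(\<And>p. p \<le> m \<Longrightarrow> keys (z p) \<subseteq> Bs (Suc (m - p))) \<Longrightarrow> (\<And>p. m < p \<Longrightarrow> z p = 0) \<Longrightarrow> z \<in> TC m"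
  by (simp add: TC_def)

lemma Bs_Lst: "Bs r \<subseteq> Lst" by (auto simp: Bs_def Lst_def)
lemma Bs_nil: "keys x \<subseteq> Bs (Suc r) \<Longrightarrow> [] \<notin> keys x" by (auto simp: Bs_def)
lemma Bs_hom: "keys x \<subseteq> Bs r \<Longrightarrow> hom r x" by (auto simp: Bs_def hom_def)

lemma keys_tt: "keys x \<subseteq> Bs r \<Longrightarrow> keys (tt x) \<subseteq> Bs r"
proof (rule keys_lext)
  fix L assume "keys x \<subseteq> Bs r" "L \<in> keys x"
  then have "L \<in> Bs r" by blast
  then show "keys (t_b L :: _ \<Rightarrow>\<^sub>0 'k) \<subseteq> Bs r"
    by (cases L rule: rev_cases; simp only: t_b_simps; intro keysI; simp add: Bs_def)
qed

lemma keys_tpow: "keys x \<subseteq> Bs r \<Longrightarrow> keys ((tt ^^ i) x) \<subseteq> Bs r"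
  by (induction i) (auto simp: keys_tt intro!: keys_tt)

lemma keys_NN: "keys x \<subseteq> Bs r \<Longrightarrow> keys (NN x) \<subseteq> Bs r"
  unfolding NN_hom[OF Bs_hom] by (intro keysI keys_tpow)

lemma keys_s: "keys x \<subseteq> Bs r \<Longrightarrow> keys (cons {} x) \<subseteq> Bs (Suc r)"
  by (rule keys_lext) (auto simp: Bs_def)

lemma keys_beta: "keys x \<subseteq> Bs (Suc r) \<Longrightarrow> keys (beta x) \<subseteq> Bs r"
proof -
  assume x: "keys x \<subseteq> Bs (Suc r)"
  have w: "W x = d0 (tt x)" by (rule W_d0)
  have k: "keys (d0 (tt x)) \<subseteq> Bs r"
  proof (rule keys_lext)
    fix L assume "L \<in> keys (tt x)"
    then have L: "L \<in> Bs (Suc r)" using keys_tt[OF x] by blast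
    show "keys (d0_b L :: _ \<Rightarrow>\<^sub>0 'k) \<subseteq> Bs r"
      using L by (cases L rule: beta_b.cases; simp only: d0_b.simps lm_b.simps; intro keysI; simp add: Bs_def)
  qed
  have "keys (bb x - W x) \<subseteq> Bs r" by (rule keys_diffI[OF keys_bb[OF x] k[folded w]])
  then show ?thesis by simp
qed

lemma CD_add: "CD (\<lambda>p. y p + z p) p = CD y p + CD z p" by (simp add: CD_def)
lemma CD_diff: "CD (\<lambda>p. y p - z p) p = CD y p - CD z p" by (simp add: CD_def)
lemma CD_scl: "CD (\<lambda>p. scl c (z p)) p = scl c (CD z p)" by (simp add: CD_def)

lemma TC_add: "y \<in> TC m \<Longrightarrow> z \<in> TC m \<Longrightarrow> (\<lambda>p. y p + z p) \<in> TC m"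
  unfolding TC_def by (simp add: keys_addI)
lemma TC_diff: "y \<in> TC m \<Longrightarrow> z \<in> TC m \<Longrightarrow> (\<lambda>p. y p - z p) \<in> TC m"
  unfolding TC_def by (simp add: keys_diffI)
lemma TC_scl: "z \<in> TC m \<Longrightarrow> (\<lambda>p. scl c (z p)) \<in> TC m"
  unfolding TC_def by (simp add: keys_sclI)

lemma CD_CD [simp]: "CD (CD z) p = 0"
proof (cases "even p")
  case True
  have "bb (z (Suc p) - tt (z (Suc p))) = beta (z (Suc p)) - tt (beta (z (Suc p)))" by (rule bb_one_minus_t)
  moreover have "CD (CD z) p = bb (bb (z p)) + bb (z (Suc p) - tt (z (Suc p))) +
     (NN (z (Suc (Suc p))) - tt (NN (z (Suc (Suc p)))) - (beta (z (Suc p)) - tt (beta (z (Suc p)))))"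
    using True by (simp add: CD_def)
  ultimately show ?thesis by (simp only: bb_bb t_NN) simp
next
  case False
  have "CD (CD z) p = NN (bb (z (Suc p))) - beta (NN (z (Suc p))) + (NN (z (Suc (Suc p))) - NN (tt (z (Suc (Suc p)))))"
    using False by (simp add: CD_def)
  then show ?thesis by (simp only: beta_NN NN_t) simp
qed

text \<open>Ensures that nothing leaves the bottom row: on a single entry the cyclic face has no
  entry left to multiply into and is 0 by convention.\<close>

lemma bb_Bs1: "keys x \<subseteq> Bs (Suc 0) \<Longrightarrow> bb x = 0"
proof (rule lin_eq_on[of bb "\<lambda>x. 0"])
  fix L assume "keys x \<subseteq> Bs (Suc 0)" "L \<in> keys x"
  then have "length L = Suc 0" by (auto simp: Bs_def)
  then show "bb (bas L) = 0" by (cases L) (auto simp: W_b_def)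
qed auto

lemma beta_Bs1: "keys x \<subseteq> Bs (Suc 0) \<Longrightarrow> beta x = 0"
proof (rule lin_eq_on[of beta "\<lambda>x. 0"])
  fix L assume "keys x \<subseteq> Bs (Suc 0)" "L \<in> keys x"
  then have "length L = Suc 0" by (auto simp: Bs_def)
  then show "beta (bas L) = 0" by (cases L) auto
qed auto

lemma CD_TC:
  assumes y: "y \<in> TC (Suc m)" shows "CD y \<in> TC m"
proof (rule TC_I)
  fix p assume p: "p \<le> m"
  have 1: "keys (y p) \<subseteq> Bs (Suc (Suc (m - p)))" using TC_D[OF y, of p] p by (simp add: Suc_diff_le)
  have 2: "keys (y (Suc p)) \<subseteq> Bs (Suc (m - p))" using TC_D[OF y, of "Suc p"] p by simp
  show "keys (CD y p) \<subseteq> Bs (Suc (m - p))"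
    unfolding CD_def by (cases "even p"; simp only: if_True if_False)
      (intro keys_addI keys_diffI keys_bb[OF 1] keys_beta[OF 1] keys_tt[OF 2] keys_NN[OF 2] 2 | simp)+
next
  fix p assume p: "m < p"
  have 2: "y (Suc p) = 0" using TC_0[OF y] p by simp
  show "CD y p = 0"
  proof (cases "p = Suc m")
    case True
    then have "keys (y p) \<subseteq> Bs (Suc 0)" using TC_D[OF y, of p] by simp
    then show ?thesis using 2 bb_Bs1 beta_Bs1 by (simp add: CD_def)
  next
    case False
    then have "y p = 0" using TC_0[OF y] p by simp
    then show ?thesis using 2 by (simp add: CD_def)
  qed
qed

text \<open>
  Prefixing the unit turns \<open>phi\<close> into \<open>dd \<circ> phi\<close>, so \<open>Th\<close> is Connes' operator \<open>B\<close> on the first column,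
  and it does not see the other columns.
\<close>
definition Th :: "(nat \<Rightarrow> (nat set list \<Rightarrow>\<^sub>0 'k)) \<Rightarrow> (idx \<Rightarrow>\<^sub>0 'k)"
  where "Th z = phi (cons {} (z 0))"

lemma phi_s_bb:
  assumes "keys x \<subseteq> Bs (Suc (Suc r))" shows "phi (cons {} (bb x)) = 0"
proof -
  have 1: "phi (cons {} (bb x)) = dd (phi (bb x))"
    by (rule dd_phi[symmetric]) (rule Bs_nil[OF keys_bb[OF assms]])
  have 2: "phi (bb x) = 0" by (rule phi_bb[OF subset_trans[OF assms Bs_Lst]])
  show ?thesis unfolding 1 2 by simp
qed

lemma Th_CD:
  assumes y: "y \<in> TC (Suc m)" shows "Th (CD y) = 0"
proof -
  have 1: "keys (y 0) \<subseteq> Bs (Suc (Suc m))" using TC_D[OF y, of 0] by simp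
  have 2: "keys (y 1) \<subseteq> Lst" using TC_D[OF y, of 1] Bs_Lst by auto
  have "Th (CD y) = phi (cons {} (bb (y 0))) + (phi (cons {} (y 1)) - phi (cons {} (tt (y 1))))"
    by (simp add: Th_def CD_def)
  then show ?thesis using phi_s_bb[OF 1] phi_s_t[OF 2] by simp
qed

text \<open>In length 1 the rotation is the identity, so only \<open>b\<close> contributes, and
  \<open>b\<close> is a commutator. It never contains the unit: if both factors are the unit the two
  terms cancel, and otherwise the product is a nonempty set or 0.\<close>

lemma pt_CD:
  assumes y: "y \<in> TC (Suc m)" and m: "even m" shows "lookup (CD y m) [{}] = 0"
proof -
  have 1: "keys (y m) \<subseteq> Bs (Suc (Suc 0))" using TC_D[OF y, of m] by (simp add: Suc_diff_le)
  have 2: "keys (y (Suc m)) \<subseteq> Bs (Suc 0)" using TC_D[OF y, of "Suc m"] by simp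
  have "tt (y (Suc m)) = y (Suc m)"
  proof (rule lin_eq_on[of tt "\<lambda>x. x"])
    fix L assume "L \<in> keys (y (Suc m))"
    then have "length L = Suc 0" using 2 by (auto simp: Bs_def)
    then show "tt (bas L) = bas L" by (cases L) (auto simp: t_b_def)
  qed auto
  then have e: "CD y m = bb (y m)" using m by (simp add: CD_def)
  have "keys (bb (y m)) \<subseteq> - {[{}]}"
  proof (rule lin_keys[where f=bb])
    fix L assume "L \<in> keys (y m)"
    then have "length L = Suc (Suc 0)" using 1 by (auto simp: Bs_def)
    then obtain a b where L: "L = [a, b]" by (auto simp: length_Suc_conv)
    show "keys (bb (bas L)) \<subseteq> - {[{}]}"
    proof (cases "a \<union> b = {}")
      case True
      then show ?thesis unfolding L by (simp add: W_b_def)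
    next
      case False
      have "bb (bas [a, b]) = scl (cc a b) (bas [a \<union> b]) - scl (cc b a) (bas [b \<union> a])"
        by (simp add: W_b_def)
      then show ?thesis unfolding L using False by (simp only:) (intro keysI; auto)
    qed
  qed auto
  then show ?thesis unfolding e by (auto simp: in_keys_iff)
qed

lemma lookup_res: "lookup (lext (\<lambda>p. if P p then bas p else 0) x) p = (if P p then lookup x p else 0)"
proof -
  have "lookup (lext (\<lambda>p. if P p then bas p else 0) x) p = (\<Sum>s\<in>keys x. if s = p then (if P p then lookup x p else 0) else 0)"
    unfolding lookup_lext by (intro sum.cong refl) (auto simp: lookup_single when_def)
  also have "\<dots> = (if P p then lookup x p else 0)" by (auto simp: in_keys_iff)
  finally show ?thesis .
qed

definition res :: "(nat \<Rightarrow> bool) \<Rightarrow> (idx \<Rightarrow>\<^sub>0 'k) \<Rightarrow> (idx \<Rightarrow>\<^sub>0 'k)"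
  where "res P x = lext (\<lambda>p. if P (wtK p) then bas p else 0) x"

lemma keys_res: "keys x \<subseteq> KB m \<Longrightarrow> keys (res P x) \<subseteq> KBP P m"
  unfolding res_def by (rule keys_lext) (auto simp: KBP_def)

lemma lookup_phi_io:
  assumes "keys x \<subseteq> KB m"
  shows "lookup (phi (io x)) p = (if odd (wtK p) then of_nat (card (permutations_of_multiset (snd p))) * lookup x p else 0)"
proof -
  have "phi (io x) = lext (\<lambda>p. if odd (wtK p) then scl (of_nat (card (permutations_of_multiset (snd p)))) (bas p) else 0) x"
    by (rule lin_eq_on[of "\<lambda>x. phi (io x)"]) (use assms phi_io in auto)
  also have "lookup \<dots> p = (\<Sum>s\<in>keys x. if s = p then (if odd (wtK p) then of_nat (card (permutations_of_multiset (snd p))) * lookup x p else 0) else 0)"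
    unfolding lookup_lext by (intro sum.cong refl) (auto simp: lookup_single when_def)
  also have "\<dots> = (if odd (wtK p) then of_nat (card (permutations_of_multiset (snd p))) * lookup x p else 0)"
    by (auto simp: in_keys_iff)
  finally show ?thesis .
qed

lemma perm_nz: "(of_nat (card (permutations_of_multiset M)) :: 'k) \<noteq> 0"
  by (simp add: card_eq_0_iff)

section \<open>Hochschild cycles that bound in the total complex\<close>

definition bd :: "nat \<Rightarrow> (nat set list \<Rightarrow>\<^sub>0 'k) \<Rightarrow> bool"
  where "bd m f \<longleftrightarrow> (\<exists>y\<in>TC (Suc m). CD y 0 = f \<and> (\<forall>p>0. CD y p = 0))"

lemma bd_add: "bd m f \<Longrightarrow> bd m g \<Longrightarrow> bd m (f + g)"
  unfolding bd_def by (metis (no_types, lifting) CD_add TC_add add_0)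
lemma bd_scl: "bd m f \<Longrightarrow> bd m (scl c f)"
  unfolding bd_def by (metis (no_types, lifting) CD_scl TC_scl scl_zero)
lemma bd_diff: "bd m f \<Longrightarrow> bd m g \<Longrightarrow> bd m (f - g)"
  using bd_add[of m f "scl (-1) g"] bd_scl[of m g "-1"] by simp
lemma bd_0: "bd m 0"
  unfolding bd_def by (rule bexI[of _ "\<lambda>_. 0"]) (auto simp: CD_def TC_def)

lemma bd_bb: "keys x \<subseteq> Bs (Suc (Suc m)) \<Longrightarrow> bd m (bb x)"
  unfolding bd_def by (rule bexI[of _ "\<lambda>p. if p = 0 then x else 0"]) (auto simp: CD_def TC_def)

lemma keys_io: "keys x \<subseteq> KB m \<Longrightarrow> keys (io x) \<subseteq> Bs (Suc m)"
  by (rule keys_lext) (use io_keys in blast)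

lemma bb_io_even:
  assumes "keys \<kappa> \<subseteq> KB m"
  shows "bb (io \<kappa>) = scl 2 (io (de (res (\<lambda>w. even w \<and> w \<noteq> 0) \<kappa>)))"
proof (rule lin_eq_on[of "\<lambda>\<kappa>. bb (io \<kappa>)" "\<lambda>\<kappa>. scl 2 (io (de (res (\<lambda>w. even w \<and> w \<noteq> 0) \<kappa>)))"])
  show "lin (\<lambda>\<kappa>. scl 2 (io (de (res (\<lambda>w. even w \<and> w \<noteq> 0) \<kappa>))))" unfolding res_def by auto
  fix p assume "p \<in> keys \<kappa>"
  then have p: "p \<in> KB m" using assms by blast
  have b: "bb (io (bas p)) = scl (1 + (-1) ^ wtK p) (io (de_b p))"
    using bb_io_b[of "snd p" "fst p"] p by (auto simp: KB_def)
  have z: "wtK p = 0 \<Longrightarrow> de_b p = 0"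
    by (simp add: wtK_def de_b_def)
  show "bb (io (bas p)) = scl 2 (io (de (res (\<lambda>w. even w \<and> w \<noteq> 0) (bas p))))"
    unfolding b res_def using z by (cases "even (wtK p)") auto
qed auto

text \<open>Already a Hochschild boundary: injectivity of \<open>io\<close> makes the even part a
  Koszul cycle, \<open>de_exact\<close> provides \<open>\<eta>\<close>, and half of
  \<open>io \<eta>\<close> is the bounding chain.\<close>

lemma bd_even:
  assumes k: "keys \<kappa> \<subseteq> KB m" and b: "bb (io \<kappa>) = 0"
  shows "bd m (io (res (\<lambda>w. even w \<and> w \<noteq> 0) \<kappa>))"
proof -
  let ?P = "\<lambda>w. even w \<and> w \<noteq> 0"
  let ?e = "res ?P \<kappa>"
  have "scl (inverse 2) (scl 2 (io (de ?e))) = 0" using b bb_io_even[OF k] by (simp only: scl_zero)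
  then have "io (de ?e) = 0" by simp
  then have "de ?e = 0" by (rule io_inj)
  then obtain \<eta> where \<eta>: "keys \<eta> \<subseteq> KBP ?P (Suc m)" "?e = de \<eta>"
    using de_exact[OF keys_res[OF k]] by blast
  have kB: "keys \<eta> \<subseteq> KB (Suc m)" using \<eta>(1) by (auto simp: KBP_def)
  have "res ?P \<eta> = \<eta>"
    unfolding res_def by (rule lin_eq_on[of _ "\<lambda>x. x"]) (use \<eta>(1) in \<open>auto simp: KBP_def\<close>)
  then have "bb (io \<eta>) = scl 2 (io ?e)" using bb_io_even[OF kB] \<eta>(2) by simp
  then have "io ?e = bb (scl (inverse 2) (io \<eta>))" by (simp add: scl_add[symmetric] del: scl_add)
  moreover have "bd m (bb (scl (inverse 2) (io \<eta>)))"
    by (intro bd_bb keys_sclI keys_io kB)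
  ultimately show ?thesis by simp
qed

lemma res_split: "res odd x + res (\<lambda>w. even w \<and> w \<noteq> 0) x + res (\<lambda>w. w = 0) x = x"
  unfolding res_def by (rule lin_eqI[where x=x]) auto

lemma res_0: "keys x \<subseteq> KB (Suc m) \<Longrightarrow> res (\<lambda>w. w = 0) x = 0"
proof -
  assume "keys x \<subseteq> KB (Suc m)"
  then have "keys (res (\<lambda>w. w = 0) x) \<subseteq> {}"
    unfolding res_def by (intro keys_lext) (auto simp: KB_def wtK_def)
  then show ?thesis by (metis keys_eq_empty subset_empty)
qed

text \<open>By \<open>phi_s_t\<close> all \<open>r\<close> rotations have the same form.\<close>

lemma phi_s_NN:
  assumes "keys x \<subseteq> Bs r" shows "phi (cons {} (NN x)) = scl (of_nat r) (phi (cons {} x))"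
proof -
  have t: "phi (cons {} ((tt ^^ i) x)) = phi (cons {} x)" for i
  proof (induction i)
    case (Suc i)
    have "keys ((tt ^^ i) x) \<subseteq> Lst" using keys_tpow[OF assms] Bs_Lst by blast
    then show ?case using Suc phi_s_t[of "(tt ^^ i) x"] by simp
  qed simp
  show ?thesis unfolding NN_hom[OF Bs_hom[OF assms]] by (simp add: t sum_const_scl)
qed

text \<open>Connes' operator \<open>B = (1 - t) s N\<close> bounds. Choose a primitive
  \<open>\<omega>\<close> of the closed form \<open>phi (io \<kappa>)\<close> and a Hochschild cycle
  \<open>x\<close> with \<open>phi x = \<omega>\<close>. Then \<open>g = B x\<close> is a total
  boundary with form \<open>m\<close> times that of \<open>io \<kappa>\<close>, and by
  \<open>HH_decomp\<close> a Hochschild cycle is determined, up to what already bounds, by its form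
  and its weight-zero part.\<close>

lemma bd_odd:
  assumes k: "keys \<kappa> \<subseteq> KB m" and d: "dd (phi (io \<kappa>)) = 0"
  shows "bd m (io (res odd \<kappa>))"
proof -
  have kp: "keys (phi (io \<kappa>)) \<subseteq> KBP odd m"
  proof
    fix p assume "p \<in> keys (phi (io \<kappa>))"
    then have "lookup (phi (io \<kappa>)) p \<noteq> 0" by (simp add: in_keys_iff)
    then have "odd (wtK p)" "lookup \<kappa> p \<noteq> 0" by (auto simp: lookup_phi_io[OF k] split: if_splits)
    then show "p \<in> KBP odd m" using k by (auto simp: KBP_def in_keys_iff)
  qed
  obtain \<omega> where \<omega>: "keys \<omega> \<subseteq> up ` (Lo \<inter> KBP odd m)" "phi (io \<kappa>) = dd \<omega>"
    using dd_exact[OF kp d] by blast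
  show ?thesis
  proof (cases m)
    case 0
    \<comment> \<open>In degree 0 a primitive would have degree -1, so the closed form itself is
      0.\<close>
    have "Lo \<inter> KBP odd m = {}" using up_props unfolding KBP_def KB_def 0 by fastforce
    then have "keys \<omega> = {}" using \<omega>(1) by blast
    then have "phi (io \<kappa>) = 0" using \<omega>(2) by (metis keys_eq_empty lext_simps(3))
    then have l0: "lookup (phi (io \<kappa>)) p = 0" for p by simp
    have "res odd \<kappa> = 0"
    proof (rule poly_mapping_eqI)
      fix p show "lookup (res odd \<kappa>) p = lookup 0 p"
        using l0[of p] lookup_phi_io[OF k, of p] perm_nz[of "snd p"] by (auto simp: res_def lookup_res)
    qed
    then show ?thesis using bd_0 by simp
  next
    case (Suc m1)
    have upk: "up s \<in> KBP odd m1" if s: "s \<in> Lo \<inter> KBP odd m" for s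
    proof -
      have sL: "s \<in> Lo" and sz: "size (snd s) = m" "odd (wtK s)" using s by (auto simp: KBP_def KB_def)
      show ?thesis by (rule KK_KBP) (use up_props[OF sL] sz Suc in \<open>simp_all add: Hi_def\<close>)
    qed
    have ko: "keys \<omega> \<subseteq> KBP odd m1" using \<omega>(1) upk by blast
    \<comment> \<open>Dividing by the number of words cancels the factor of
      \<open>phi_io\<close>.\<close>
    define \<omega>' where "\<omega>' = lext (\<lambda>p. scl (inverse (of_nat (card (permutations_of_multiset (snd p))))) (bas p)) \<omega>"
    have ko': "keys \<omega>' \<subseteq> KBP odd m1" unfolding \<omega>'_def
      by (rule keys_lext) (use ko in \<open>auto intro!: keysI simp del: keys_single\<close>)
    then have kb': "keys \<omega>' \<subseteq> KB m1" by (auto simp: KBP_def)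
    define x where "x = io \<omega>'"
    have px: "phi x = \<omega>"
    proof -
      have "phi x = lext (\<lambda>p. scl (inverse (of_nat (card (permutations_of_multiset (snd p))))) (phi (io_b p))) \<omega>"
        unfolding x_def \<omega>'_def by (rule lin_eqI[where x=\<omega>]) auto
      also have "\<dots> = \<omega>"
      proof (rule lin_eq_on[of _ "\<lambda>x. x"])
        fix p assume "p \<in> keys \<omega>"
        then have "p \<in> KB m1" "odd (wtK p)" using ko by (auto simp: KBP_def)
        then show "lext (\<lambda>p. scl (inverse (of_nat (card (permutations_of_multiset (snd p))))) (phi (io_b p))) (bas p) = bas p"
          using phi_io[of p m1] perm_nz[of "snd p"] by simp
      qed auto
      finally show ?thesis .
    qed
    have kx: "keys x \<subseteq> Bs (Suc m1)" unfolding x_def by (rule keys_io[OF kb'])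
    have "res (\<lambda>w. even w \<and> w \<noteq> 0) \<omega>' = 0"
      unfolding res_def by (rule lin_eq_on[of _ "\<lambda>x. 0"]) (use ko' in \<open>auto simp: KBP_def\<close>)
    then have bx: "bb x = 0" unfolding x_def using bb_io_even[OF kb'] by simp
    define u where "u = cons {} (NN x)"
    have ku: "keys u \<subseteq> Bs (Suc (Suc m1))" unfolding u_def by (intro keys_s keys_NN kx)
    have bu: "beta u = NN x"
    proof -
      have "beta (NN x) = 0" unfolding beta_NN bx by simp
      then show ?thesis using beta_contract[OF Bs_nil[OF keys_NN[OF kx]]] unfolding u_def by simp
    qed
    define g where "g = u - tt u"
    \<comment> \<open>In column 2 the vertical differential of \<open>x\<close> vanishes; in column
      1 \<open>- beta u\<close> cancels \<open>NN x\<close>, because \<open>s\<close> contracts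
      \<open>b'\<close>; so only \<open>(1 - t) u = g\<close> in column 0 remains.\<close>
    define y where "y = (\<lambda>p::nat. if p = 1 then u else if p = 2 then x else 0)"
    have yT: "y \<in> TC (Suc m)"
      by (rule TC_I) (use ku kx Suc in \<open>auto simp: y_def\<close>)
    have "CD y p = (if p = 0 then g else 0)" for p
      using bx bu by (auto simp: CD_def y_def g_def)
    then have bg: "bd m g" unfolding bd_def using yT by (intro bexI[of _ y]) auto
    have bbg: "bb g = 0" unfolding g_def bb_one_minus_t bu t_NN by simp
    have kg: "keys g \<subseteq> Bs (Suc m)" unfolding g_def Suc by (intro keys_diffI keys_tt ku)
    obtain \<kappa>' \<tau>' where gd: "g = io \<kappa>' + bb \<tau>'" "keys \<kappa>' \<subseteq> KB m" "keys \<tau>' \<subseteq> Bs (Suc (Suc m))" "bb (io \<kappa>') = 0"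
      by (rule HH_decomp[OF kg bbg])
    have "phi (tt u) = 0" unfolding u_def by (rule phi_t_s[OF Bs_nil[OF keys_NN[OF kx]]])
    then have "phi g = phi (cons {} (NN x))" unfolding g_def u_def by simp
    also have "\<dots> = scl (of_nat m) (phi (cons {} x))" using phi_s_NN[OF kx] Suc by simp
    also have "phi (cons {} x) = dd (phi x)" by (rule dd_phi[symmetric, OF Bs_nil[OF kx]])
    also have "\<dots> = phi (io \<kappa>)" using px \<omega>(2) by simp
    finally have "phi g = scl (of_nat m) (phi (io \<kappa>))" .
    moreover have "phi (bb \<tau>') = 0" using gd(3) Bs_Lst by (intro phi_bb) blast
    ultimately have pk: "phi (io \<kappa>') = scl (of_nat m) (phi (io \<kappa>))" using gd(1) by simp
    have "res odd \<kappa>' = scl (of_nat m) (res odd \<kappa>)"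
    proof (rule poly_mapping_eqI)
      fix p
      show "lookup (res odd \<kappa>') p = lookup (scl (of_nat m) (res odd \<kappa>)) p"
      proof (cases "odd (wtK p)")
        case True
        have "lookup (phi (io \<kappa>')) p = of_nat m * lookup (phi (io \<kappa>)) p" using pk by simp
        then have "lookup \<kappa>' p = of_nat m * lookup \<kappa> p"
          using lookup_phi_io[OF k, of p] lookup_phi_io[OF gd(2), of p] perm_nz[of "snd p"] True by simp
        then show ?thesis using True by (simp add: res_def lookup_res)
      next
        case False
        then show ?thesis by (simp add: res_def lookup_res)
      qed
    qed
    then have e: "io (res odd \<kappa>) = scl (inverse (of_nat m)) (io (res odd \<kappa>'))"
      using Suc by (simp del: of_nat_Suc)
    \<comment> \<open>All other parts of \<open>g\<close> are already known to bound, and there is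
      no weight-zero part in positive degree.\<close>
    have "io (res odd \<kappa>') = io \<kappa>' - io (res (\<lambda>w. even w \<and> w \<noteq> 0) \<kappa>')"
      using arg_cong[OF res_split[of \<kappa>'], of io] res_0[of \<kappa>' m1] gd(2) Suc by (simp add: algebra_simps)
    also have "io \<kappa>' = g - bb \<tau>'" using gd(1) by (simp add: algebra_simps)
    finally have "bd m (io (res odd \<kappa>'))"
      using bd_diff[OF bd_diff[OF bg bd_bb[OF gd(3)]] bd_even[OF gd(2,4)]] by simp
    then show ?thesis unfolding e by (rule bd_scl)
  qed
qed

lemma Th_diff: "Th (\<lambda>p. y p - z p) = Th y - Th z" by (simp add: Th_def)
lemma Th_add: "Th (\<lambda>p. y p + z p) = Th y + Th z" by (simp add: Th_def)
lemma Th_scl: "Th (\<lambda>p. scl c (z p)) = scl c (Th z)" by (simp add: Th_def)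

text \<open>For \<open>u = s b' z_1 = z_1 - b' s z_1\<close>, the cycle equation in column 0 makes
  \<open>u - t u\<close> a sum of Hochschild boundaries, whence \<open>phi u = 0\<close>, since
  \<open>phi (t u) = 0\<close>. By the equation in column 1, \<open>u = s N z_2\<close>, whose form
  is \<open>m + 1\<close> times that of \<open>s z_2\<close>; here the tensors in column 2 have
  length \<open>m + 1\<close>.\<close>

lemma Th_shift:
  assumes z: "z \<in> TC (Suc (Suc m))" and c: "\<And>p. CD z p = 0"
  shows "phi (cons {} (z 2)) = 0"
proof -
  have k0: "keys (z 0) \<subseteq> Bs (Suc (Suc (Suc m)))" using TC_D[OF z, of 0] by simp
  have k1: "keys (z 1) \<subseteq> Bs (Suc (Suc m))" using TC_D[OF z, of 1] by simp
  have k2: "keys (z 2) \<subseteq> Bs (Suc m)" using TC_D[OF z, of 2] by simp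
  have e1: "NN (z 2) = beta (z 1)" using c[of 1] by (simp add: CD_def numeral_2_eq_2)
  have e0: "z 1 - tt (z 1) = - bb (z 0)" using c[of 0] by (simp add: CD_def eq_neg_iff_add_eq_0 algebra_simps)
  define x where "x = cons {} (z 1)"
  have kx: "keys x \<subseteq> Bs (Suc (Suc (Suc m)))" unfolding x_def by (rule keys_s[OF k1])
  define u where "u = cons {} (beta (z 1))"
  have u: "u = z 1 - beta x" unfolding u_def x_def using beta_contract[OF Bs_nil[OF k1]] by (simp add: algebra_simps)
  have "phi (tt u) = 0" unfolding u_def by (rule phi_t_s[OF Bs_nil[OF keys_beta[OF k1]]])
  then have "phi u = phi (u - tt u)" by simp
  also have "u - tt u = (z 1 - tt (z 1)) - (beta x - tt (beta x))" unfolding u by simp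
  also have "\<dots> = - bb (z 0) - bb (x - tt x)" unfolding e0 bb_one_minus_t ..
  also have "phi \<dots> = - phi (bb (z 0)) - phi (bb (x - tt x))" by simp
  also have "phi (bb (z 0)) = 0" by (rule phi_bb[OF subset_trans[OF k0 Bs_Lst]])
  also have "phi (bb (x - tt x)) = 0"
    by (rule phi_bb[OF subset_trans[OF keys_diffI[OF kx keys_tt[OF kx]] Bs_Lst]])
  finally have "phi (cons {} (NN (z 2))) = 0" unfolding e1 u_def by simp
  then have "scl (of_nat (Suc m)) (phi (cons {} (z 2))) = 0" using phi_s_NN[OF k2] by simp
  then have "scl (inverse (of_nat (Suc m))) (scl (of_nat (Suc m)) (phi (cons {} (z 2)))) = 0" by (simp only: scl_zero)
  then show ?thesis by (simp del: of_nat_Suc)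
qed

text \<open>Periodicity of the bicomplex drives the induction. Dropping the first two columns gives
  a cycle of degree \<open>m - 2\<close> that satisfies the hypotheses by \<open>Th_shift\<close>,
  and a chain bounding it clears all columns from 2 on. The contraction \<open>s\<close> of
  \<open>b'\<close> clears column 1. What is left is a Hochschild cycle in column 0, handled by
  parity of the weight.\<close>

lemma tot_kernel:
  assumes "z \<in> TC m" "\<And>p. CD z p = 0" "Th z = 0" "even m \<Longrightarrow> lookup (z m) [{}] = 0"
  shows "\<exists>y\<in>TC (Suc m). \<forall>p. CD y p = z p"
  using assms
proof (induction m arbitrary: z rule: less_induct)
  case (less m)
  have z: "z \<in> TC m" and c: "\<And>p. CD z p = 0" and th: "Th z = 0" and pt: "even m \<Longrightarrow> lookup (z m) [{}] = 0"
    using less.prems by auto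
  obtain y1 where y1: "y1 \<in> TC (Suc m)" "\<And>p. 2 \<le> p \<Longrightarrow> CD y1 p = z p"
  proof (cases "2 \<le> m")
    case True
    then obtain m' where m: "m = Suc (Suc m')" using add_2_eq_Suc le_Suc_ex by blast
    define z' where "z' = (\<lambda>p. z (Suc (Suc p)))"
    have z'T: "z' \<in> TC m'"
    proof (rule TC_I)
      fix p show "p \<le> m' \<Longrightarrow> keys (z' p) \<subseteq> Bs (Suc (m' - p))"
        using TC_D[OF z, of "Suc (Suc p)"] m by (simp add: z'_def)
      show "m' < p \<Longrightarrow> z' p = 0" using TC_0[OF z, of "Suc (Suc p)"] m by (simp add: z'_def)
    qed
    have cz': "CD z' p = 0" for p using c[of "Suc (Suc p)"] by (simp add: CD_def z'_def)
    have "Th z' = 0" unfolding Th_def z'_def using Th_shift[of z m'] z m c by (simp add: numeral_2_eq_2)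
    moreover have "even m' \<Longrightarrow> lookup (z' m') [{}] = 0" using pt m by (simp add: z'_def)
    ultimately obtain y' where y': "y' \<in> TC (Suc m')" "\<And>p. CD y' p = z' p"
      using less.IH[of m' z'] z'T cz' m by auto
    define y where "y = (\<lambda>p. if p < 2 then 0 else y' (p - 2))"
    have "y \<in> TC (Suc m)"
    proof (rule TC_I)
      fix p show "p \<le> Suc m \<Longrightarrow> keys (y p) \<subseteq> Bs (Suc (Suc m - p))"
        using TC_D[OF y'(1), of "p - 2"] m by (cases "p < 2") (auto simp: y_def Suc_diff_le not_less le_diff_conv numeral_2_eq_2)
      show "Suc m < p \<Longrightarrow> y p = 0" using TC_0[OF y'(1), of "p - 2"] m by (auto simp: y_def)
    qed
    moreover have "CD y p = z p" if "2 \<le> p" for p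
    proof -
      obtain q where q: "p = Suc (Suc q)" using \<open>2 \<le> p\<close> add_2_eq_Suc le_Suc_ex by blast
      have "CD y p = CD y' q" by (simp add: CD_def y_def q)
      then show ?thesis using y'(2) q by (simp add: z'_def)
    qed
    ultimately show thesis using that by blast
  next
    case False
    have "CD (\<lambda>_. 0) p = z p" if "2 \<le> p" for p
      using TC_0[OF z, of p] that False by (simp add: CD_def)
    then show thesis using that[of "\<lambda>_. 0"] by (simp add: TC_def)
  qed
  define z1 where "z1 = (\<lambda>p. z p - CD y1 p)"
  have z1T: "z1 \<in> TC m" unfolding z1_def using TC_diff[OF z CD_TC[OF y1(1)]] .
  have c1: "CD z1 p = 0" for p unfolding z1_def CD_diff c by simp
  have z10: "2 \<le> p \<Longrightarrow> z1 p = 0" for p using y1(2) by (simp add: z1_def)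
  have k11: "1 \<le> m \<Longrightarrow> keys (z1 1) \<subseteq> Bs (Suc (m - 1))" using TC_D[OF z1T, of 1] by simp
  have k11': "keys (z1 1) \<subseteq> Bs m" using k11 TC_0[OF z1T, of 1] by (cases m) auto
  have nil: "[] \<notin> keys (z1 1)" using k11 TC_0[OF z1T, of 1] by (cases m) (auto simp: Bs_def)
  have b1: "beta (z1 1) = 0" using c1[of 1] z10[of 2] by (simp add: CD_def numeral_2_eq_2)
  \<comment> \<open>The minus sign compensates for the vertical differential \<open>-b'\<close> of
    odd columns.\<close>
  define y2 where "y2 = (\<lambda>p::nat. if p = 1 then - cons {} (z1 1) else 0)"
  have y2T: "y2 \<in> TC (Suc m)"
    by (rule TC_I) (use keys_s[OF k11'] in \<open>auto simp: y2_def\<close>)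
  have cy2: "CD y2 p = z1 p" if "1 \<le> p" for p
  proof (cases "p = 1")
    case True
    have "beta (cons {} (z1 1)) = z1 1" using beta_contract[OF nil] b1 by simp
    then show ?thesis using True by (simp add: CD_def y2_def)
  next
    case False
    then show ?thesis using that z10[of p] by (simp add: CD_def y2_def)
  qed
  define f where "f = z1 0 - CD y2 0"
  define z2 where "z2 = (\<lambda>p. z1 p - CD y2 p)"
  have z2T: "z2 \<in> TC m" unfolding z2_def using TC_diff[OF z1T CD_TC[OF y2T]] .
  have z2p: "z2 p = (if p = 0 then f else 0)" for p using cy2 by (simp add: z2_def f_def)
  have "CD z2 0 = 0" unfolding z2_def CD_diff c1 by simp
  then have bf: "bb f = 0" by (simp add: CD_def z2p)
  have kf: "keys f \<subseteq> Bs (Suc m)" using TC_D[OF z2T, of 0] z2p by simp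
  obtain \<kappa> \<tau> where d: "f = io \<kappa> + bb \<tau>" "keys \<kappa> \<subseteq> KB m" "keys \<tau> \<subseteq> Bs (Suc (Suc m))" "bb (io \<kappa>) = 0"
    by (rule HH_decomp[OF kf bf])
  have thz2: "Th z2 = 0"
    unfolding z2_def z1_def Th_diff using th Th_CD[OF y1(1)] Th_CD[OF y2T] by simp
  have "phi (cons {} f) = 0" using thz2 by (simp add: Th_def z2p)
  then have "phi (cons {} (io \<kappa>)) = 0" using d(1) phi_s_bb[OF d(3)] by simp
  then have dk: "dd (phi (io \<kappa>)) = 0" using dd_phi[OF Bs_nil[OF keys_io[OF d(2)]]] by simp
  \<comment> \<open>Weight 0 forces an empty multiset, hence \<open>m = 0\<close>, where the
    hypothesis on the coefficient of the unit applies; it survives all corrections by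
    \<open>pt_CD\<close>.\<close>
  have k0: "res (\<lambda>w. w = 0) \<kappa> = 0"
  proof (cases m)
    case (Suc m')
    then show ?thesis using res_0[of \<kappa> m'] d(2) by simp
  next
    case 0
    have "lookup f [{}] = lookup (z2 0) [{}]" by (simp add: z2p)
    also have "\<dots> = 0" unfolding z2_def z1_def
      using pt pt_CD[OF y1(1)] pt_CD[OF y2T] 0 by (simp add: lookup_minus)
    finally have "lookup f [{}] = 0" .
    moreover have "bd 0 (bb \<tau>)" using bd_bb[of \<tau> 0] d(3) 0 by simp
    then obtain yy where "yy \<in> TC (Suc 0)" "CD yy 0 = bb \<tau>" unfolding bd_def by blast
    then have "lookup (bb \<tau>) [{}] = 0" using pt_CD[of yy 0] by simp
    ultimately have "lookup (io \<kappa>) [{}] = 0" using d(1) by (simp add: lookup_add)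
    then have l: "lookup \<kappa> ({}, {#}) = 0" using lookup_io[of \<kappa> "{}" "[]"] by simp
    show ?thesis
    proof (rule poly_mapping_eqI)
      fix p show "lookup (res (\<lambda>w. w = 0) \<kappa>) p = lookup 0 p"
      proof (cases "wtK p = 0 \<and> p \<in> keys \<kappa>")
        case True
        then have pk: "p \<in> KB m" "wtK p = 0" using d(2) by auto
        have "fst p \<inter> {1..n} = {}" "snd p = {#}" using pk(2) by (auto simp: wtK_def cd_def)
        moreover have "fst p \<subseteq> {1..n}" using pk(1) by (auto simp: KB_def)
        ultimately have "p = ({}, {#})" by (simp add: prod_eq_iff Int_absorb2)
        then show ?thesis using l True by (simp add: in_keys_iff)
      next
        case False
        then show ?thesis by (auto simp: res_def lookup_res in_keys_iff)
      qed
    qed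
  qed
  have "io \<kappa> = io (res odd \<kappa>) + io (res (\<lambda>w. even w \<and> w \<noteq> 0) \<kappa>)"
    using arg_cong[OF res_split[of \<kappa>], of io] k0 by simp
  then have "bd m f"
    unfolding d(1) using bd_add[OF bd_add[OF bd_odd[OF d(2) dk] bd_even[OF d(2,4)]] bd_bb[OF d(3)]] by simp
  then obtain y3 where y3: "y3 \<in> TC (Suc m)" "CD y3 0 = f" "\<And>p. 0 < p \<Longrightarrow> CD y3 p = 0"
    unfolding bd_def by blast
  have "CD y3 p = z2 p" for p using y3(2,3) z2p[of p] by (cases "p = 0") auto
  then have "CD (\<lambda>p. y1 p + y2 p + y3 p) p = z p" for p
    by (simp add: CD_add z2_def z1_def)
  then show ?case using TC_add[OF TC_add[OF y1(1) y2T] y3(1)] by (intro bexI) auto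
qed

text \<open>By the matching a closed form of odd weight is determined by its coefficients on
  \<open>Lo\<close>, so these indices serve as coordinates for the values of \<open>Th\<close> in
  degree \<open>m\<close>.\<close>

definition IX :: "nat \<Rightarrow> idx set" where "IX m = Lo \<inter> KBP odd (Suc m)"

text \<open>\<open>Th z\<close> is closed, and without coefficients on \<open>Lo\<close> it is
  supported on partners, so \<open>triang_unique\<close> applies.\<close>

lemma Th_zero_iff:
  assumes z: "z \<in> TC m" and l: "\<And>s. s \<in> IX m \<Longrightarrow> lookup (Th z) s = 0"
  shows "Th z = 0"
proof -
  have k0: "keys (z 0) \<subseteq> Bs (Suc m)" using TC_D[OF z, of 0] by simp
  have kT: "keys (Th z) \<subseteq> KBP odd (Suc m)" unfolding Th_def by (rule keys_phi_s[OF k0])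
  have "Th z = dd (phi (z 0))" unfolding Th_def by (rule dd_phi[symmetric, OF Bs_nil[OF k0]])
  then have dT: "dd (Th z) = 0" by simp
  have kl: "keys (Th z) \<inter> Lo = {}" using l kT by (auto simp: IX_def in_keys_iff)
  have "KBP odd (Suc m) \<subseteq> Lo \<union> up ` Lo" using KBP_KK[of odd] KK_up by (meson even_zero subset_trans)
  then have "keys (Th z) \<subseteq> up ` Lo" using kT kl by blast
  then show ?thesis using triang_unique[OF triang_dd] dT by simp
qed

text \<open>In odd weight \<open>io (bas (up s))\<close> is a Hochschild cycle, so it is a total
  cycle when placed in column 0, and its de Rham differential has \<open>s\<close> as its only term
  in \<open>Lo\<close>.\<close>

lemma tot_surj:
  assumes s: "s \<in> IX m"
  shows "\<exists>z\<in>TC m. (\<forall>p. CD z p = 0) \<and> (\<forall>t\<in>IX m. lookup (Th z) t = (if t = s then 1 else 0)) \<and> lookup (z m) [{}] = 0"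
proof -
  have sL: "s \<in> Lo" and sz: "size (snd s) = Suc m" "odd (wtK s)" using s by (auto simp: IX_def KBP_def KB_def)
  note u = up_props[OF sL]
  have uk: "up s \<in> KB m" using KK_KBP[of "up s" odd m] u sz by (auto simp: KBP_def Hi_def)
  obtain v r where vr: "v \<noteq> 0" "dd (bas (up s)) = scl v (bas s) + r" "\<forall>K\<in>keys r. K \<notin> Lo"
    using triang_dd sL unfolding triang_def by (metis empty_iff)
  \<comment> \<open>The leading coefficient of \<open>dd\<close> times the number of words from
    \<open>phi_io\<close>.\<close>
  define w where "w = v * of_nat (card (permutations_of_multiset (snd (up s))))"
  have w0: "w \<noteq> 0" using vr(1) perm_nz by (simp add: w_def)
  define x where "x = scl (inverse w) (io (bas (up s)))"
  define z where "z = (\<lambda>p::nat. if p = 0 then x else 0)"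
  have ki: "keys (io (bas (up s))) \<subseteq> Bs (Suc m)" by (rule keys_io) (use uk in simp)
  have kx: "keys x \<subseteq> Bs (Suc m)" unfolding x_def by (rule keys_sclI[OF ki])
  have zT: "z \<in> TC m" by (rule TC_I) (use kx in \<open>auto simp: z_def\<close>)
  have "bb (io (bas (up s))) = 0"
  proof -
    have "set_mset (snd (up s)) \<subseteq> {1..n}" using uk by (auto simp: KB_def)
    then show ?thesis using bb_io_b[of "snd (up s)" "fst (up s)"] u sz by simp
  qed
  then have "bb x = 0" unfolding x_def by (simp add: scl_add[symmetric] del: scl_add)
  then have c: "CD z p = 0" for p by (simp add: CD_def z_def)
  have "phi (cons {} (io (bas (up s)))) = dd (phi (io (bas (up s))))"
    by (rule dd_phi[symmetric, OF Bs_nil[OF ki]])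
  also have "phi (io (bas (up s))) = scl (of_nat (card (permutations_of_multiset (snd (up s))))) (bas (up s))"
    using phi_io[OF uk] u sz by simp
  also have "dd \<dots> = scl (of_nat (card (permutations_of_multiset (snd (up s))))) (scl v (bas s) + r)"
    unfolding lext_simps vr(2) ..
  finally have T: "Th z = scl (inverse w) (scl (of_nat (card (permutations_of_multiset (snd (up s))))) (scl v (bas s) + r))"
    by (simp add: Th_def z_def x_def)
  have "lookup (Th z) t = (if t = s then 1 else 0)" if "t \<in> IX m" for t
  proof -
    have "lookup r t = 0" using vr(3) that by (auto simp: IX_def in_keys_iff)
    then show ?thesis unfolding T using w0 by (auto simp: lookup_add lookup_single when_def w_def field_simps)
  qed
  moreover have "lookup (z m) [{}] = 0"
  proof (cases "m = 0")
    case True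
    have "fst (up s) \<noteq> {}" using u by (auto simp: Hi_def)
    then show ?thesis using True lookup_io[of "bas (up s)" "{}" "[]"]
      by (auto simp: z_def x_def lookup_single when_def)
  qed (simp add: z_def)
  ultimately show ?thesis using zT c by blast
qed

text \<open>
  Coefficients of a cycle supported on the tensor powers of the unit; it is the class
  that \<open>\<Lambda>\<close> shares with the ground field.
\<close>
fun al :: "nat \<Rightarrow> 'k" where
  "al 0 = 1"
| "al (Suc q) = (if even q then of_nat (Suc q) * al q else - 2 * al q)"

text \<open>On tensors of units all operators are scalars. For even \<open>q\<close>,
  \<open>b'\<close> is 1 on \<open>e (Suc q)\<close> and \<open>N\<close> is \<open>q + 1\<close> on
  \<open>e q\<close>; for odd \<open>q\<close>, \<open>b\<close> is 1 and \<open>1 - t\<close> is 2.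
  The recursion for \<open>al\<close> says that the two contributions cancel in every
  column.\<close>

lemma tot_point:
  assumes m: "even m"
  shows "\<exists>z\<in>TC m. (\<forall>p. CD z p = 0) \<and> Th z = 0 \<and> lookup (z m) [{}] = 1"
proof -
  define e where "e q = (bas (replicate (Suc q) {}) :: nat set list \<Rightarrow>\<^sub>0 'k)" for q
  have be: "beta (e (Suc q)) = (if even q then e q else 0)" for q
    by (induction q) (auto simp: e_def)
  have We: "W (e (Suc q)) = scl ((-1) ^ Suc q) (e q)" for q
  proof -
    have r: "replicate (Suc (Suc q)) {} = replicate (Suc q) {} @ [{}]" by (simp add: replicate_append_same)
    have "W (e (Suc q)) = scl ((-1) ^ Suc q) (lm_b {} (replicate (Suc q) {}))"
      unfolding e_def lext_bas r W_b_simps(2) by (simp only: length_replicate)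
    then show ?thesis by (simp add: e_def)
  qed
  have te: "tt (e q) = scl ((-1) ^ q) (e q)" for q
  proof -
    have r: "replicate (Suc q) {} = replicate q {} @ [{}]" by (simp add: replicate_append_same)
    have "tt (e q) = scl ((-1) ^ q) (bas ({} # replicate q {}))"
      unfolding e_def lext_bas r t_b_simps(2) by (simp only: length_replicate)
    then show ?thesis by (simp add: e_def)
  qed
  have tie: "even q \<Longrightarrow> (tt ^^ i) (e q) = e q" for q i by (induction i) (auto simp: te)
  have Ne: "even q \<Longrightarrow> NN (e q) = scl (of_nat (Suc q)) (e q)" for q
    by (subst NN_hom[of "Suc q"]) (auto simp: e_def[symmetric] tie sum_const_scl simp del: of_nat_Suc sum.lessThan_Suc, simp add: e_def)
  define z where "z = (\<lambda>p. if p \<le> m then scl (al (m - p)) (e (m - p)) else 0)"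
  have zT: "z \<in> TC m"
    by (rule TC_I) (auto simp: z_def e_def Bs_def intro!: keysI simp del: keys_single replicate_Suc)
  have "CD z p = 0" for p
  proof (cases "p < m")
    case True
    then obtain q where q: "m - p = Suc q" "m - Suc p = q" by (metis Suc_diff_Suc)
    have zp: "z p = scl (al (Suc q)) (e (Suc q))" "z (Suc p) = scl (al q) (e q)" using True q by (simp_all add: z_def)
    have par: "even p \<longleftrightarrow> odd q" using q(1) m True by presburger
    show ?thesis
    proof (cases "even p")
      case False
      then show ?thesis using par unfolding CD_def zp by (simp add: be Ne mult.commute del: of_nat_Suc)
    next
      case True
      then have "odd q" using par by simp
      then show ?thesis unfolding CD_def zp using True
        by (intro poly_mapping_eqI) (simp add: be We te lookup_add lookup_minus del: of_nat_Suc)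
    qed
  next
    case False
    then have z0: "z (Suc p) = 0" by (simp add: z_def)
    have "keys (z p) \<subseteq> Bs (Suc 0)" using False by (auto simp: z_def e_def Bs_def intro!: keysI simp del: keys_single)
    then show ?thesis using bb_Bs1 beta_Bs1 z0 by (simp add: CD_def)
  qed
  moreover have "Th z = 0"
  proof -
    have "wt (replicate q {}) = 0" for q by (induction q) auto
    then show ?thesis by (simp add: Th_def z_def e_def phi_b_def)
  qed
  moreover have "lookup (z m) [{}] = 1" by (simp add: z_def e_def)
  ultimately show ?thesis using zT by blast
qed

section \<open>Counting\<close>

lemma finite_KBP: "finite (KBP P m)"
proof (rule finite_subset)
  show "KBP P m \<subseteq> Pow {1..n} \<times> multisets_of_size {1..n} m"
    by (auto simp: KBP_def KB_def multisets_of_size_def)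
qed (auto intro!: finite_multisets_of_size)

lemma card_parity: "1 \<le> n \<Longrightarrow> card {S. S \<subseteq> {1..n} \<and> (even (card S) \<longleftrightarrow> b)} = 2 ^ (n - 1)"
proof -
  assume n: "1 \<le> n"
  let ?E = "{S. S \<subseteq> {1..n} \<and> even (card S)}" let ?O = "{S. S \<subseteq> {1..n} \<and> odd (card S)}"
  have "card {T. T \<subseteq> {1..n} \<and> {} \<subseteq> T \<and> even (card T)} = card {T. T \<subseteq> {1..n} \<and> {} \<subseteq> T \<and> odd (card T)}"
    by (rule card_subsupersets_even_odd) (use n in auto)
  then have eq: "card ?E = card ?O" by simp
  have "card ?E + card ?O = card (?E \<union> ?O)"
    by (rule card_Un_disjoint[symmetric]) auto
  also have "?E \<union> ?O = Pow {1..n}" by auto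
  finally have "2 * card ?E = 2 ^ n" using eq by (simp add: card_Pow)
  moreover have "(2::nat) ^ n = 2 * 2 ^ (n - 1)" using n by (metis Suc_diff_1 not_one_le_zero not_gr_zero power_Suc)
  ultimately have "card ?E = 2 ^ (n - 1)" by simp
  then show ?thesis using eq by (cases b) auto
qed

lemma card_KBP: "1 \<le> n \<Longrightarrow> card (KBP odd m) = 2 ^ (n - 1) * ((n + m - 1) choose (n - 1))"
proof -
  assume n: "1 \<le> n"
  have cd: "S \<subseteq> {1..n} \<Longrightarrow> cd S = card S" for S by (simp add: cd_def Int_absorb2)
  have "KBP odd m = {S. S \<subseteq> {1..n} \<and> (even (card S) \<longleftrightarrow> odd m)} \<times> multisets_of_size {1..n} m"
    by (auto simp: KBP_def KB_def multisets_of_size_def wtK_def cd)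
  then have "card (KBP odd m) = 2 ^ (n - 1) * ((n + m - 1) choose m)"
    using card_parity[OF n] by (simp add: card_cartesian_product card_multisets_of_size)
  also have "(n + m - 1) choose m = (n + m - 1) choose (n - 1)"
    using n binomial_symmetric[of m "n + m - 1"] by simp
  finally show ?thesis .
qed

text \<open>Exactness in terms of the matching: the \<open>Lo\<close> half is \<open>IX m\<close>,
  and \<open>dn\<close> carries the \<open>Hi\<close> half, with degree raised by one, onto
  \<open>IX (Suc m)\<close>.\<close>

lemma card_IX_step: "card (KBP odd (Suc m)) = card (IX (Suc m)) + card (IX m)"
proof -
  have "KBP odd (Suc m) \<subseteq> KK" by (rule KBP_KK) simp
  then have e: "KBP odd (Suc m) = (Hi \<inter> KBP odd (Suc m)) \<union> IX m"
    using Hi_Lo(1) by (auto simp: IX_def)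
  have "card (KBP odd (Suc m)) = card (Hi \<inter> KBP odd (Suc m)) + card (IX m)"
    by (subst e, rule card_Un_disjoint) (use Hi_Lo(2) finite_KBP in \<open>auto simp: IX_def\<close>)
  also have "card (Hi \<inter> KBP odd (Suc m)) = card (IX (Suc m))"
  proof (rule bij_betw_same_card[of dn], rule bij_betw_byWitness[where f'=up])
    show "\<forall>a\<in>Hi \<inter> KBP odd (Suc m). up (dn a) = a" using dn_props by simp
    show "\<forall>a\<in>IX (Suc m). dn (up a) = a" using up_props by (simp add: IX_def)
    show "dn ` (Hi \<inter> KBP odd (Suc m)) \<subseteq> IX (Suc m)"
    proof
      fix q assume "q \<in> dn ` (Hi \<inter> KBP odd (Suc m))"
      then obtain p where p: "p \<in> Hi" "odd (wtK p)" "size (snd p) = Suc m" "q = dn p" by (auto simp: KBP_def KB_def)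
      note d = dn_props[OF p(1)]
      have "q \<in> KBP odd (Suc (Suc m))" by (rule KK_KBP) (use d p in \<open>simp_all add: Lo_def\<close>)
      then show "q \<in> IX (Suc m)" using d p by (simp add: IX_def)
    qed
    show "up ` IX (Suc m) \<subseteq> Hi \<inter> KBP odd (Suc m)"
    proof
      fix q assume "q \<in> up ` IX (Suc m)"
      then obtain p where p: "p \<in> Lo" "odd (wtK p)" "size (snd p) = Suc (Suc m)" "q = up p" by (auto simp: KBP_def KB_def IX_def)
      note d = up_props[OF p(1)]
      have "q \<in> KBP odd (Suc m)" by (rule KK_KBP) (use d p in \<open>simp_all add: Hi_def\<close>)
      then show "q \<in> Hi \<inter> KBP odd (Suc m)" using d p by simp
    qed
  qed
  finally show ?thesis .
qed

text \<open>With an empty multiset the least index must lie in the set, so there is only a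
  \<open>Hi\<close> half.\<close>

lemma card_IX_0: "card (KBP odd 0) = card (IX 0)"
proof (rule bij_betw_same_card[of dn], rule bij_betw_byWitness[where f'=up])
  have sub: "KBP odd 0 \<subseteq> Hi"
  proof
    fix p assume p: "p \<in> KBP odd 0"
    then have k: "p \<in> KK" using KBP_KK[of odd 0] by auto
    have "snd p = {#}" using p by (auto simp: KBP_def KB_def)
    then show "p \<in> Hi" using mn_in(1)[OF k] k by (simp add: Hi_def)
  qed
  show "\<forall>a\<in>KBP odd 0. up (dn a) = a" using dn_props sub by blast
  show "\<forall>a\<in>IX 0. dn (up a) = a" using up_props by (simp add: IX_def)
  show "dn ` KBP odd 0 \<subseteq> IX 0"
  proof
    fix q assume "q \<in> dn ` KBP odd 0"
    then obtain p where p0: "p \<in> KBP odd 0" "q = dn p" by blast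
    then have p: "p \<in> Hi" "odd (wtK p)" "size (snd p) = 0" "q = dn p"
      using subsetD[OF sub p0(1)] by (auto simp: KBP_def KB_def)
    note d = dn_props[OF p(1)]
    have "q \<in> KBP odd (Suc 0)" by (rule KK_KBP) (use d p in \<open>simp_all add: Lo_def\<close>)
    then show "q \<in> IX 0" using d p by (simp add: IX_def)
  qed
  show "up ` IX 0 \<subseteq> KBP odd 0"
  proof
    fix q assume "q \<in> up ` IX 0"
    then obtain p where p: "p \<in> Lo" "odd (wtK p)" "size (snd p) = Suc 0" "q = up p" by (auto simp: KBP_def KB_def IX_def)
    note d = up_props[OF p(1)]
    show "q \<in> KBP odd 0" by (rule KK_KBP) (use d p in \<open>simp_all add: Hi_def\<close>)
  qed
qed

lemma card_IX: "1 \<le> n \<Longrightarrow> int (card (IX m)) = (\<Sum>i=0..m. (-1) ^ (m - i) * 2 ^ (n - 1) * int ((n + i - 1) choose (n - 1)))"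
proof (induction m)
  case 0
  then show ?case using card_IX_0 card_KBP[of 0] by simp
next
  case (Suc m)
  have "int (card (IX (Suc m))) = int (card (KBP odd (Suc m))) - int (card (IX m))"
    using card_IX_step[of m] by simp
  also have "\<dots> = 2 ^ (n - 1) * int ((n + Suc m - 1) choose (n - 1)) - (\<Sum>i=0..m. (-1) ^ (m - i) * 2 ^ (n - 1) * int ((n + i - 1) choose (n - 1)))"
    using Suc card_KBP[OF Suc.prems, of "Suc m"] by simp
  also have "\<dots> = (\<Sum>i=0..Suc m. (-1) ^ (Suc m - i) * 2 ^ (n - 1) * int ((n + i - 1) choose (n - 1)))"
  proof -
    have "- (\<Sum>i=0..m. (-1) ^ (m - i) * 2 ^ (n - 1) * int ((n + i - 1) choose (n - 1)))
      = (\<Sum>i=0..m. (-1) ^ (Suc m - i) * 2 ^ (n - 1) * int ((n + i - 1) choose (n - 1)))"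
      unfolding sum_negf[symmetric] by (rule sum.cong) (auto simp: Suc_diff_le)
    then show ?thesis by simp
  qed
  finally show ?case .
qed

end

section \<open>Quotients by kernels\<close>

text \<open>The axioms are reflected by a jointly injective family of maps compatible with the
  operations. A family is allowed because a total chain is separated only by all its columns
  together. Negatives come from the scalar -1.\<close>

lemma pull_vs:
  fixes V :: "('k::field, 'a, 'm) module_scheme" and H :: "'i \<Rightarrow> 'a \<Rightarrow> ('s \<Rightarrow>\<^sub>0 'k)"
  assumes add: "\<And>x y. x \<in> carrier V \<Longrightarrow> y \<in> carrier V \<Longrightarrow> x \<oplus>\<^bsub>V\<^esub> y \<in> carrier V"
    and zero: "\<zero>\<^bsub>V\<^esub> \<in> carrier V"
    and sm: "\<And>c x. x \<in> carrier V \<Longrightarrow> c \<odot>\<^bsub>V\<^esub> x \<in> carrier V"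
    and H_add: "\<And>i x y. x \<in> carrier V \<Longrightarrow> y \<in> carrier V \<Longrightarrow> H i (x \<oplus>\<^bsub>V\<^esub> y) = H i x + H i y"
    and H_zero: "\<And>i. H i (\<zero>\<^bsub>V\<^esub>) = 0"
    and H_sm: "\<And>i c x. x \<in> carrier V \<Longrightarrow> H i (c \<odot>\<^bsub>V\<^esub> x) = scl c (H i x)"
    and inj: "\<And>x y. x \<in> carrier V \<Longrightarrow> y \<in> carrier V \<Longrightarrow> (\<And>i. H i x = H i y) \<Longrightarrow> x = y"
  shows "vectorspace class_ring V"
proof -
  have neg: "\<exists>w\<in>carrier V. v \<oplus>\<^bsub>V\<^esub> w = \<zero>\<^bsub>V\<^esub>" if v: "v \<in> carrier V" for v
    by (rule bexI[OF _ sm[OF v, of "-1"]], rule inj) (simp_all add: v add sm zero H_add H_zero H_sm)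
  show ?thesis
    by (rule vs_criteria[OF class_field]; (intro allI ballI impI)?; (rule inj)?)
      (auto simp: add zero sm neg H_add H_zero H_sm algebra_simps scl_add_left)
qed

text \<open>Meaningless unless \<open>f\<close> has finite support.\<close>
definition pm :: "('s \<Rightarrow> 'k::field) \<Rightarrow> ('s \<Rightarrow>\<^sub>0 'k)" where "pm f = Abs_poly_mapping f"

lemma lookup_pm: "finite {s. f s \<noteq> 0} \<Longrightarrow> lookup (pm f) = f"
  by (simp add: pm_def)

lemma free_module_simps [simp]:
  "carrier (free_module S) = {f. finite {s. f s \<noteq> 0} \<and> {s. f s \<noteq> 0} \<subseteq> S}"
  "zero (free_module S) = (\<lambda>s. 0)" "add (free_module S) = (\<lambda>f g s. f s + g s)"
  "smult (free_module S) = (\<lambda>c f s. c * f s)"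
  by (simp_all add: free_module_def)

lemma fsupp_add: "finite {s. f s \<noteq> 0} \<Longrightarrow> finite {s. g s \<noteq> 0} \<Longrightarrow> finite {s. f s + g s \<noteq> (0::'k::field)}"
  by (rule finite_subset[of _ "{s. f s \<noteq> 0} \<union> {s. g s \<noteq> 0}"]) auto

lemma fsupp_smult: "finite {s. f s \<noteq> 0} \<Longrightarrow> finite {s. c * f s \<noteq> (0::'k::field)}"
  by (rule finite_subset[of _ "{s. f s \<noteq> 0}"]) auto

lemma pm_add: "finite {s. f s \<noteq> 0} \<Longrightarrow> finite {s. g s \<noteq> 0} \<Longrightarrow> pm (\<lambda>s. f s + g s) = pm f + pm g"
  by (rule poly_mapping_eqI) (simp add: lookup_pm fsupp_add lookup_add)

lemma pm_smult: "finite {s. f s \<noteq> 0} \<Longrightarrow> pm (\<lambda>s. c * f s) = scl c (pm f)"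
  by (rule poly_mapping_eqI) (simp only: lookup_pm fsupp_smult lookup_scl)

lemma pm_zero [simp]: "pm (\<lambda>s. 0) = 0"
  by (rule poly_mapping_eqI) (simp add: lookup_pm)

lemma keys_pm: "finite {s. f s \<noteq> 0} \<Longrightarrow> keys (pm f) = {s. f s \<noteq> 0}"
  by (auto simp: in_keys_iff lookup_pm)

lemma free_module_vs: "vectorspace class_ring (free_module S :: ('k::field, 's \<Rightarrow> 'k) module)"
proof (rule pull_vs[where H="\<lambda>_::unit. pm"])
  fix f g :: "'s \<Rightarrow> 'k" assume f: "f \<in> carrier (free_module S)" and g: "g \<in> carrier (free_module S)"
  have "s \<in> S" if "f s + g s \<noteq> 0" for s
  proof -
    have "f s \<noteq> 0 \<or> g s \<noteq> 0" using that by auto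
    then show ?thesis using f g by auto
  qed
  then show "f \<oplus>\<^bsub>free_module S\<^esub> g \<in> carrier (free_module S)" using f g by (auto simp: fsupp_add)
  show "pm (f \<oplus>\<^bsub>free_module S\<^esub> g) = pm f + pm g" using f g by (simp add: pm_add)
  have l: "lookup (pm f) = f" "lookup (pm g) = g" using f g by (simp_all add: lookup_pm)
  show "f = g" if e: "\<And>i::unit. pm f = pm g"
    by (rule trans[OF l(1)[symmetric]], subst e, rule l(2))
next
  fix c and f :: "'s \<Rightarrow> 'k" assume f: "f \<in> carrier (free_module S)"
  show "c \<odot>\<^bsub>free_module S\<^esub> f \<in> carrier (free_module S)" using f fsupp_smult[of f c] by auto
  show "pm (c \<odot>\<^bsub>free_module S\<^esub> f) = scl c (pm f)" using f by (simp only: free_module_simps mem_Collect_eq pm_smult)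
qed auto

lemma basis_vec_carrier: "s \<in> S \<Longrightarrow> (basis_vec s :: 's \<Rightarrow> 'k::field) \<in> carrier (free_module S)"
  by (auto simp: basis_vec_def)

lemma fsupp_basis_vec: "finite {t. (basis_vec s t :: 'k::field) \<noteq> 0}"
  by (simp add: basis_vec_def)

lemma pm_basis_vec [simp]: "pm (basis_vec s) = bas s"
  by (rule poly_mapping_eqI) (simp only: lookup_pm[OF fsupp_basis_vec], simp add: basis_vec_def lookup_single when_def)

text \<open>Every quotient considered here is by the kernel of an explicit map \<open>h\<close> into
  finitely supported functions: the exterior algebra, the tensor powers and the homology. A coset is
  then known by its value under \<open>h\<close>.\<close>

locale linq =
  fixes M :: "('k::field, 'a, 'm) module_scheme" and h :: "'a \<Rightarrow> ('s \<Rightarrow>\<^sub>0 'k)"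
  assumes ab: "abelian_group M"
    and h_add: "x \<in> carrier M \<Longrightarrow> y \<in> carrier M \<Longrightarrow> h (x \<oplus>\<^bsub>M\<^esub> y) = h x + h y"
    and sm: "x \<in> carrier M \<Longrightarrow> c \<odot>\<^bsub>M\<^esub> x \<in> carrier M"
    and h_sm: "x \<in> carrier M \<Longrightarrow> h (c \<odot>\<^bsub>M\<^esub> x) = scl c (h x)"
begin

interpretation ab: abelian_group M by (rule ab)

definition ker :: "'a set" where "ker = {x \<in> carrier M. h x = 0}"

lemma h_zero: "h (\<zero>\<^bsub>M\<^esub>) = 0"
  using h_add[of "\<zero>\<^bsub>M\<^esub>" "\<zero>\<^bsub>M\<^esub>"] by simp

lemma h_inv: "x \<in> carrier M \<Longrightarrow> h (\<ominus>\<^bsub>M\<^esub> x) = - h x"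
  using h_add[of "\<ominus>\<^bsub>M\<^esub> x" x] ab.l_neg h_zero by (simp add: eq_neg_iff_add_eq_0)

lemma coset: "x \<in> carrier M \<Longrightarrow> ker +>\<^bsub>M\<^esub> x = {y \<in> carrier M. h y = h x}"
proof (intro equalityI subsetI)
  fix y assume x: "x \<in> carrier M" and "y \<in> ker +>\<^bsub>M\<^esub> x"
  then obtain k where "k \<in> ker" "y = k \<oplus>\<^bsub>M\<^esub> x" by (auto simp: a_r_coset_def')
  then show "y \<in> {y \<in> carrier M. h y = h x}" using x by (auto simp: ker_def h_add)
next
  fix y assume x: "x \<in> carrier M" and y: "y \<in> {y \<in> carrier M. h y = h x}"
  then have "y \<oplus>\<^bsub>M\<^esub> \<ominus>\<^bsub>M\<^esub> x \<in> ker" by (auto simp: ker_def h_add h_inv)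
  moreover have "y = (y \<oplus>\<^bsub>M\<^esub> \<ominus>\<^bsub>M\<^esub> x) \<oplus>\<^bsub>M\<^esub> x" using x y by (auto simp: ab.a_assoc ab.l_neg)
  ultimately show "y \<in> ker +>\<^bsub>M\<^esub> x" unfolding a_r_coset_def' by blast
qed

abbreviation Q :: "('k, 'a set) module" where "Q \<equiv> quotient_module M ker"

lemma Q_simps:
  "carrier Q = a_rcosets\<^bsub>M\<^esub> ker" "zero Q = ker" "add Q = set_add M"
  "monoid.mult Q = rcoset_mult M ker" "one Q = ker +>\<^bsub>M\<^esub> \<one>\<^bsub>M\<^esub>"
  "smult Q = (\<lambda>c X. \<Union>x\<in>X. ker +>\<^bsub>M\<^esub> (c \<odot>\<^bsub>M\<^esub> x))"
  by (simp_all add: quotient_module_def ring.extend_def module.fields_def FactRing_def)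

lemma Q_carrier: "carrier Q = (\<lambda>x. ker +>\<^bsub>M\<^esub> x) ` carrier M"
  unfolding Q_simps A_RCOSETS_def RCOSETS_def a_r_coset_def by auto

definition QH :: "'a set \<Rightarrow> ('s \<Rightarrow>\<^sub>0 'k)" where "QH X = h (SOME x. x \<in> X)"

lemma QH_coset [simp]: "x \<in> carrier M \<Longrightarrow> QH (ker +>\<^bsub>M\<^esub> x) = h x"
proof -
  assume x: "x \<in> carrier M"
  have "(SOME y. y \<in> ker +>\<^bsub>M\<^esub> x) \<in> ker +>\<^bsub>M\<^esub> x"
    by (rule someI[of _ x]) (simp add: coset x)
  then show ?thesis unfolding QH_def using coset[OF x] by blast
qed

lemma Q_add: "x \<in> carrier M \<Longrightarrow> y \<in> carrier M \<Longrightarrow> (ker +>\<^bsub>M\<^esub> x) \<oplus>\<^bsub>Q\<^esub> (ker +>\<^bsub>M\<^esub> y) = ker +>\<^bsub>M\<^esub> (x \<oplus>\<^bsub>M\<^esub> y)"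
proof -
  assume x: "x \<in> carrier M" and y: "y \<in> carrier M"
  have "{y \<in> carrier M. h y = h x} <+>\<^bsub>M\<^esub> {z \<in> carrier M. h z = h y} = {z \<in> carrier M. h z = h x + h y}"
  proof (intro equalityI subsetI)
    fix z assume z: "z \<in> {z \<in> carrier M. h z = h x + h y}"
    then have "z = (z \<oplus>\<^bsub>M\<^esub> \<ominus>\<^bsub>M\<^esub> y) \<oplus>\<^bsub>M\<^esub> y" using y by (auto simp: ab.a_assoc ab.l_neg)
    moreover have "z \<oplus>\<^bsub>M\<^esub> \<ominus>\<^bsub>M\<^esub> y \<in> {y \<in> carrier M. h y = h x}" using z y by (auto simp: h_add h_inv)
    ultimately show "z \<in> {y \<in> carrier M. h y = h x} <+>\<^bsub>M\<^esub> {z \<in> carrier M. h z = h y}"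
      unfolding set_add_def' using y by blast
  qed (auto simp: set_add_def' h_add)
  then show ?thesis using x y by (simp add: Q_simps coset h_add)
qed

lemma Q_smult: "x \<in> carrier M \<Longrightarrow> c \<odot>\<^bsub>Q\<^esub> (ker +>\<^bsub>M\<^esub> x) = ker +>\<^bsub>M\<^esub> (c \<odot>\<^bsub>M\<^esub> x)"
proof -
  assume x: "x \<in> carrier M"
  have "(\<Union>y\<in>{y \<in> carrier M. h y = h x}. ker +>\<^bsub>M\<^esub> (c \<odot>\<^bsub>M\<^esub> y)) = (\<Union>y\<in>{y \<in> carrier M. h y = h x}. ker +>\<^bsub>M\<^esub> (c \<odot>\<^bsub>M\<^esub> x))"
    by (intro SUP_cong refl) (auto simp: coset sm h_sm x)
  also have "\<dots> = ker +>\<^bsub>M\<^esub> (c \<odot>\<^bsub>M\<^esub> x)" using x by auto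
  finally show ?thesis using x by (simp add: Q_simps coset)
qed

lemma Q_zero: "\<zero>\<^bsub>Q\<^esub> = ker +>\<^bsub>M\<^esub> \<zero>\<^bsub>M\<^esub>"
  by (subst Q_simps(2)) (simp add: coset h_zero ker_def)

lemma coset_in_Q: "x \<in> carrier M \<Longrightarrow> ker +>\<^bsub>M\<^esub> x \<in> carrier Q"
  by (simp add: Q_carrier)

lemma Q_E: assumes "X \<in> carrier Q" obtains x where "x \<in> carrier M" "X = ker +>\<^bsub>M\<^esub> x"
  using assms by (auto simp: Q_carrier)

lemma QH_add: "X \<in> carrier Q \<Longrightarrow> Y \<in> carrier Q \<Longrightarrow> QH (X \<oplus>\<^bsub>Q\<^esub> Y) = QH X + QH Y \<and> X \<oplus>\<^bsub>Q\<^esub> Y \<in> carrier Q"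
  by (elim Q_E) (simp add: Q_add h_add coset_in_Q)
lemma QH_smult: "X \<in> carrier Q \<Longrightarrow> QH (c \<odot>\<^bsub>Q\<^esub> X) = scl c (QH X) \<and> c \<odot>\<^bsub>Q\<^esub> X \<in> carrier Q"
  by (elim Q_E) (simp add: Q_smult h_sm sm coset_in_Q)
lemma QH_zero: "QH (\<zero>\<^bsub>Q\<^esub>) = 0" "\<zero>\<^bsub>Q\<^esub> \<in> carrier Q"
  by (simp_all add: Q_zero h_zero coset_in_Q)
lemma QH_inj: "X \<in> carrier Q \<Longrightarrow> Y \<in> carrier Q \<Longrightarrow> QH X = QH Y \<Longrightarrow> X = Y"
proof (elim Q_E)
  fix x y assume "x \<in> carrier M" "y \<in> carrier M" "X = ker +>\<^bsub>M\<^esub> x" "Y = ker +>\<^bsub>M\<^esub> y" "QH X = QH Y"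
  moreover from this have "h x = h y" by (metis QH_coset)
  ultimately show "X = Y" by (simp add: coset)
qed
lemma QH_image: "QH ` carrier Q = h ` carrier M"
  by (force simp: Q_carrier)

lemma Q_vs: "vectorspace class_ring Q"
  by (rule pull_vs[where H="\<lambda>_::unit. QH"]) (use QH_add QH_smult QH_zero QH_inj in blast)+

text \<open>Preimages \<open>b i\<close> of the vectors \<open>bas i\<close> form a basis, because
  \<open>QH\<close> is injective and the coefficient at \<open>b i\<close> is read off by
  \<open>lookup\<close> at \<open>i\<close>.\<close>

lemma Q_dim:
  assumes I: "finite I" and im: "h ` carrier M = {v. keys v \<subseteq> I}"
  shows "vectorspace.fin_dim class_ring Q \<and> vectorspace.dim class_ring Q = card I"
proof -
  interpret V: vectorspace class_ring Q by (rule Q_vs)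
  have "\<forall>i\<in>I. \<exists>X\<in>carrier Q. QH X = bas i"
  proof
    fix i assume "i \<in> I"
    then have "bas i \<in> QH ` carrier Q" unfolding QH_image im by simp
    then show "\<exists>X\<in>carrier Q. QH X = bas i" by force
  qed
  then obtain b where b: "\<And>i. i \<in> I \<Longrightarrow> b i \<in> carrier Q" "\<And>i. i \<in> I \<Longrightarrow> QH (b i) = bas i" by metis
  define A where "A = b ` I"
  have injb: "inj_on b I"
    by (rule inj_onI) (metis b(2) inj_single injD lookup_single_eq lookup_single_not_eq zero_neq_one)
  have A: "finite A" "A \<subseteq> carrier Q" "card A = card I"
    using I b(1) injb by (auto simp: A_def card_image)
  have QHl: "finite B \<Longrightarrow> B \<subseteq> carrier Q \<Longrightarrow> QH (V.module.lincomb a B) = (\<Sum>v\<in>B. scl (a v) (QH v)) \<and> V.module.lincomb a B \<in> carrier Q" for a B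
  proof (induction B rule: finite_induct)
    case empty
    then show ?case using QH_zero by (simp add: V.module.lincomb_def)
  next
    case (insert v B)
    have "V.module.lincomb a (insert v B) = (a v \<odot>\<^bsub>Q\<^esub> v) \<oplus>\<^bsub>Q\<^esub> V.module.lincomb a B"
      using insert QH_smult unfolding V.module.lincomb_def by (subst V.module.M.finsum_insert) auto
    then show ?case using insert QH_add QH_smult by simp
  qed
  have "V.basis A"
  proof (subst V.basis_criterion[OF A(1,2)], intro allI impI)
    fix v assume v: "v \<in> carrier Q"
    then have kv: "keys (QH v) \<subseteq> I" using QH_image im by blast
    have sumA: "(\<Sum>x\<in>A. scl (a x) (QH x)) = (\<Sum>i\<in>I. scl (a (b i)) (bas i))" for a
      unfolding A_def using injb b(2) by (simp add: sum.reindex)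
    have lk: "lookup (\<Sum>i\<in>I. scl (c i) (bas i)) j = c j" if "j \<in> I" for c and j
    proof -
      have "lookup (\<Sum>i\<in>I. scl (c i) (bas i)) j = (\<Sum>i\<in>I. if i = j then c j else 0)"
        unfolding lookup_sum by (rule sum.cong) (auto simp: lookup_single when_def)
      also have "\<dots> = c j" using I that by simp
      finally show ?thesis .
    qed
    let ?P = "\<lambda>a. a \<in> A \<rightarrow>\<^sub>E carrier class_ring \<and> V.module.lincomb a A = v"
    define a0 where "a0 = (\<lambda>x\<in>A. lookup (QH v) (the_inv_into I b x))"
    have a0b: "i \<in> I \<Longrightarrow> a0 (b i) = lookup (QH v) i" for i
      using injb by (simp add: a0_def A_def the_inv_into_f_f)
    have "QH (V.module.lincomb a0 A) = QH v"
    proof -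
      have "QH (V.module.lincomb a0 A) = (\<Sum>i\<in>I. scl (lookup (QH v) i) (bas i))"
        using QHl[OF A(1,2)] sumA a0b by (simp cong: sum.cong)
      then show ?thesis using pm_expand_on[OF I kv] by simp
    qed
    then have "?P a0" using QHl[OF A(1,2)] v QH_inj by (auto simp: a0_def)
    moreover have "a = a0" if a: "?P a" for a
    proof
      fix x show "a x = a0 x"
      proof (cases "x \<in> A")
        case True
        then obtain i where i: "i \<in> I" "x = b i" by (auto simp: A_def)
        have qv: "QH v = (\<Sum>i\<in>I. scl (a (b i)) (bas i))" using a QHl[OF A(1,2), of a] sumA[of a] by simp
        have "lookup (QH v) i = a (b i)" unfolding qv by (rule lk[OF i(1)])
        then show ?thesis using a0b[OF i(1)] i(2) by simp
      next
        case False
        then show ?thesis using a by (auto simp: a0_def PiE_def extensional_def)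
      qed
    qed
    ultimately show "\<exists>!a. ?P a" by blast
  qed
  then show ?thesis using V.dim_basis[OF A(1)] A V.basis_def V.fin_dim_def by auto
qed

end

section \<open>The exterior algebra\<close>

definition wm :: "('s list \<Rightarrow>\<^sub>0 'k::field) \<Rightarrow> ('s list \<Rightarrow>\<^sub>0 'k) \<Rightarrow> ('s list \<Rightarrow>\<^sub>0 'k)"
  where "wm x y = lext (\<lambda>u. lext (\<lambda>v. bas (u @ v)) y) x"

lemma lin_wm1: "lin (\<lambda>x. wm x y)" unfolding wm_def by (rule lin_lext0)
lemma lin_lext_param: "(\<And>s. lin (\<phi> s)) \<Longrightarrow> lin (\<lambda>y. lext (\<lambda>s. \<phi> s y) x)"
  unfolding lext_def by (intro lin_sums lin_scale)

lemma lin_wm2: "lin (wm x)"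
  unfolding wm_def[abs_def] by (rule lin_lext_param) (rule lin_lext0)
lemmas wm_simps1 [simp] = lin_rules[OF lin_wm1]
lemmas wm_simps2 [simp] = lin_rules[OF lin_wm2]
lemma lin_wm1' [intro!]: "lin g \<Longrightarrow> lin (\<lambda>x. wm (g x) y)" by (rule lin_comp[OF lin_wm1])
lemma lin_wm2' [intro!]: "lin g \<Longrightarrow> lin (\<lambda>x. wm y (g x))" by (rule lin_comp[OF lin_wm2])
lemma wm_bas [simp]: "wm (bas u) (bas v) = bas (u @ v)" by (simp add: wm_def)

lemma wm_assoc: "wm (wm x y) z = wm x (wm y z)"
proof (rule lin_eqI[where x=x])
  fix u show "wm (wm (bas u) y) z = wm (bas u) (wm y z)"
  proof (rule lin_eqI[where x=y])
    fix v show "wm (wm (bas u) (bas v)) z = wm (bas u) (wm (bas v) z)"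
      by (rule lin_eqI[where x=z]) auto
  qed auto
qed auto

lemma wm_one: "wm (bas []) x = x" "wm x (bas []) = x"
  by (rule lin_eqI[where x=x]; auto)+

lemma fa_simps [simp]:
  "carrier (free_algebra n) = {f. finite {s. f s \<noteq> 0} \<and> {s. f s \<noteq> 0} \<subseteq> lists {1..n}}"
  "zero (free_algebra n) = (\<lambda>s. 0)" "add (free_algebra n) = (\<lambda>f g s. f s + g s)"
  "smult (free_algebra n) = (\<lambda>c f s. c * f s)" "one (free_algebra n) = basis_vec []"
  "monoid.mult (free_algebra n) = (\<lambda>f g w. \<Sum>(u, v) | u @ v = w. f u * g v)"
  by (simp_all add: free_algebra_def free_module_def)

lemma pm_eq_iff: "finite {s. f s \<noteq> 0} \<Longrightarrow> finite {s. g s \<noteq> 0} \<Longrightarrow> pm f = pm g \<longleftrightarrow> f = g"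
  by (metis lookup_pm)

lemma finite_splits: "finite {(u, v). u @ v = w}"
proof (rule finite_subset)
  show "{(u, v). u @ v = w} \<subseteq> (\<lambda>i. (take i w, drop i w)) ` {..length w}"
  proof
    fix x assume "x \<in> {(u, v). u @ v = w}"
    then obtain u v where "x = (u, v)" "w = u @ v" by auto
    then show "x \<in> (\<lambda>i. (take i w, drop i w)) ` {..length w}"
      by (intro image_eqI[of _ _ "length u"]) auto
  qed
qed simp

lemma fa_mult:
  fixes f g :: "'s list \<Rightarrow> 'k::field"
  assumes f: "finite {s. f s \<noteq> 0}" and g: "finite {s. g s \<noteq> 0}"
  defines "fg \<equiv> (\<lambda>w. \<Sum>(u, v) | u @ v = w. f u * g v)"
  shows "finite {s. fg s \<noteq> 0}" "pm fg = wm (pm f) (pm g)" "\<And>w. fg w \<noteq> 0 \<Longrightarrow> \<exists>u v. w = u @ v \<and> f u \<noteq> 0 \<and> g v \<noteq> 0"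
proof -
  show ex: "\<exists>u v. w = u @ v \<and> f u \<noteq> 0 \<and> g v \<noteq> 0" if "fg w \<noteq> 0" for w
  proof (rule ccontr)
    assume n: "\<not> ?thesis"
    have "fg w = 0" unfolding fg_def by (rule sum.neutral) (use n in auto)
    then show False using that by simp
  qed
  have "{s. fg s \<noteq> 0} \<subseteq> (\<lambda>(u, v). u @ v) ` ({s. f s \<noteq> 0} \<times> {s. g s \<noteq> 0})"
    using ex by fastforce
  then show fin: "finite {s. fg s \<noteq> 0}" using f g finite_subset by blast
  show "pm fg = wm (pm f) (pm g)"
  proof (rule poly_mapping_eqI)
    fix w
    let ?K = "keys (pm f) \<times> keys (pm g)"
    have "lookup (wm (pm f) (pm g)) w = (\<Sum>u\<in>keys (pm f). \<Sum>v\<in>keys (pm g). f u * (g v * (if u @ v = w then 1 else 0)))"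
      by (simp add: wm_def lookup_lext lookup_pm[OF f] lookup_pm[OF g] lookup_single when_def sum_distrib_left)
    also have "\<dots> = (\<Sum>(u, v)\<in>?K. if u @ v = w then f u * g v else 0)"
      unfolding sum.cartesian_product by (rule sum.cong) auto
    also have "\<dots> = (\<Sum>(u, v)\<in>?K \<inter> {(u, v). u @ v = w}. f u * g v)"
      by (rule sum.mono_neutral_cong_right) (auto split: if_splits)
    also have "\<dots> = (\<Sum>(u, v)\<in>{(u, v). u @ v = w}. f u * g v)"
      by (rule sum.mono_neutral_left) (auto simp: finite_splits keys_pm[OF f] keys_pm[OF g])
    finally show "lookup (pm fg) w = lookup (wm (pm f) (pm g)) w"
      by (simp add: lookup_pm[OF fin]) (simp add: fg_def)
  qed
qed

lemma fa_closed:
  assumes "f \<in> carrier (free_algebra n)" "g \<in> carrier (free_algebra n)"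
  shows "f \<otimes>\<^bsub>free_algebra n\<^esub> g \<in> carrier (free_algebra n)"
    "pm (f \<otimes>\<^bsub>free_algebra n\<^esub> g) = wm (pm f) (pm g)"
proof -
  have fin: "finite {s. f s \<noteq> 0}" "finite {s. g s \<noteq> 0}" using assms by auto
  note m = fa_mult[OF fin]
  have "w \<in> lists {1..n}" if w: "(\<Sum>(u, v) | u @ v = w. f u * g v) \<noteq> 0" for w
  proof -
    obtain u v where uv: "w = u @ v" "f u \<noteq> 0" "g v \<noteq> 0" using m(3)[OF w] by blast
    have "u \<in> {s. f s \<noteq> 0}" "v \<in> {s. g s \<noteq> 0}" using uv by auto
    then have "u \<in> lists {1..n}" "v \<in> lists {1..n}" using assms unfolding fa_simps by blast+
    then show ?thesis using uv by simp
  qed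
  then show "f \<otimes>\<^bsub>free_algebra n\<^esub> g \<in> carrier (free_algebra n)" using m(1) by auto
  show "pm (f \<otimes>\<^bsub>free_algebra n\<^esub> g) = wm (pm f) (pm g)" using m(2) by simp
qed

lemma fa_vs: "vectorspace class_ring (free_algebra n :: ('k::field, nat list \<Rightarrow> 'k) module)"
proof (rule pull_vs[where H="\<lambda>_::unit. pm"])
  interpret V: vectorspace class_ring "free_module (lists {1..n}) :: ('k, nat list \<Rightarrow> 'k) module" by (rule free_module_vs)
  fix f g :: "nat list \<Rightarrow> 'k" and c
  assume f: "f \<in> carrier (free_algebra n)"
  show "c \<odot>\<^bsub>free_algebra n\<^esub> f \<in> carrier (free_algebra n)" using f V.module.smult_closed[of c f] by simp
  show "pm (c \<odot>\<^bsub>free_algebra n\<^esub> f) = scl c (pm f)" using f by (simp only: fa_simps mem_Collect_eq pm_smult)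
  assume g: "g \<in> carrier (free_algebra n)"
  show "f \<oplus>\<^bsub>free_algebra n\<^esub> g \<in> carrier (free_algebra n)" using f g V.module.M.add.m_closed[of f g] by simp
  show "pm (f \<oplus>\<^bsub>free_algebra n\<^esub> g) = pm f + pm g" using f g by (simp add: pm_add)
  show "f = g" if e: "\<And>i::unit. pm f = pm g" using pm_eq_iff[of f g] e f g by simp
qed auto

lemma pm_inj_fa: "f \<in> carrier (free_algebra n) \<Longrightarrow> g \<in> carrier (free_algebra n) \<Longrightarrow> pm f = pm g \<Longrightarrow> f = g"
  using pm_eq_iff[of f g] by simp

lemma fa_pm_add: "f \<in> carrier (free_algebra n) \<Longrightarrow> g \<in> carrier (free_algebra n) \<Longrightarrow> pm (f \<oplus>\<^bsub>free_algebra n\<^esub> g) = pm f + pm g"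
  by (simp add: pm_add)

lemma fa_basis: "w \<in> lists {1..n} \<Longrightarrow> basis_vec w \<in> carrier (free_algebra n :: ('k::field, nat list \<Rightarrow> 'k) module)"
  using basis_vec_carrier[of w "lists {1..n}", where 'k='k] by simp

lemma fa_ring: "ring (free_algebra n :: ('k::field, nat list \<Rightarrow> 'k) module)"
proof -
  let ?F = "free_algebra n :: ('k, nat list \<Rightarrow> 'k) module"
  interpret V: vectorspace class_ring ?F by (rule fa_vs)
  have ab: "abelian_group ?F" by (rule V.module.M.abelian_group_axioms)
  have one: "\<one>\<^bsub>?F\<^esub> \<in> carrier ?F" using fa_basis[of "[]" n] by simp
  have pm1: "pm (\<one>\<^bsub>?F\<^esub>) = (bas [] :: nat list \<Rightarrow>\<^sub>0 'k)" by simp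
  note inj = pm_inj_fa[of _ n]
  note c = fa_closed V.module.M.add.m_closed
  have c2: "x \<oplus>\<^bsub>?F\<^esub> y \<in> carrier ?F" if "x \<in> carrier ?F" "y \<in> carrier ?F" for x y
    using that by (rule V.module.M.add.m_closed)
  show ?thesis
  proof (rule ringI[OF ab monoidI])
    fix x y z assume x: "x \<in> carrier ?F" and y: "y \<in> carrier ?F" and z: "z \<in> carrier ?F"
    show "x \<otimes>\<^bsub>?F\<^esub> y \<otimes>\<^bsub>?F\<^esub> z = x \<otimes>\<^bsub>?F\<^esub> (y \<otimes>\<^bsub>?F\<^esub> z)"
      by (rule inj) (simp_all only: fa_closed x y z wm_assoc)
    show "(x \<oplus>\<^bsub>?F\<^esub> y) \<otimes>\<^bsub>?F\<^esub> z = x \<otimes>\<^bsub>?F\<^esub> z \<oplus>\<^bsub>?F\<^esub> y \<otimes>\<^bsub>?F\<^esub> z"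
      by (rule inj) (simp_all only: fa_closed c2 x y z fa_pm_add wm_simps1)
    show "z \<otimes>\<^bsub>?F\<^esub> (x \<oplus>\<^bsub>?F\<^esub> y) = z \<otimes>\<^bsub>?F\<^esub> x \<oplus>\<^bsub>?F\<^esub> z \<otimes>\<^bsub>?F\<^esub> y"
      by (rule inj) (simp_all only: fa_closed c2 x y z fa_pm_add wm_simps2)
  next
    fix x y assume x: "x \<in> carrier ?F" and y: "y \<in> carrier ?F"
    show "x \<otimes>\<^bsub>?F\<^esub> y \<in> carrier ?F" using x y by (rule fa_closed)
  next
    fix x assume x: "x \<in> carrier ?F"
    show "\<one>\<^bsub>?F\<^esub> \<otimes>\<^bsub>?F\<^esub> x = x"
      by (rule inj) (simp_all only: fa_closed one x pm1 wm_one)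
    show "x \<otimes>\<^bsub>?F\<^esub> \<one>\<^bsub>?F\<^esub> = x"
      by (rule inj) (simp_all only: fa_closed one x pm1 wm_one)
  qed (rule one)
qed

context grass
begin

abbreviation FA :: "('k, nat list \<Rightarrow> 'k) module" where "FA \<equiv> free_algebra n"

definition mul :: "(nat set \<Rightarrow>\<^sub>0 'k) \<Rightarrow> (nat set \<Rightarrow>\<^sub>0 'k) \<Rightarrow> (nat set \<Rightarrow>\<^sub>0 'k)"
  where "mul x y = lext (\<lambda>S. lext (\<lambda>T. scl (cc S T) (bas (S \<union> T))) y) x"

lemma lin_mul1: "lin (\<lambda>x. mul x y)" unfolding mul_def by (rule lin_lext0)
lemma lin_mul2: "lin (mul x)"
  unfolding mul_def[abs_def] by (rule lin_lext_param) (rule lin_lext0)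
lemmas mul_simps1 [simp] = lin_rules[OF lin_mul1]
lemmas mul_simps2 [simp] = lin_rules[OF lin_mul2]
lemma lin_mul1' [intro!]: "lin g \<Longrightarrow> lin (\<lambda>x. mul (g x) y)" by (rule lin_comp[OF lin_mul1])
lemma lin_mul2' [intro!]: "lin g \<Longrightarrow> lin (\<lambda>x. mul y (g x))" by (rule lin_comp[OF lin_mul2])
lemma mul_bas [simp]: "mul (bas u) (bas v) = scl (cc u v) (bas (u \<union> v))" by (simp add: mul_def)

lemma mul_assoc: "mul (mul x y) z = mul x (mul y z)"
proof (rule lin_eqI[where x=x])
  fix u show "mul (mul (bas u) y) z = mul (bas u) (mul y z)"
  proof (rule lin_eqI[where x=y])
    fix v show "mul (mul (bas u) (bas v)) z = mul (bas u) (mul (bas v) z)"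
      by (rule lin_eqI[where x=z]) (auto simp: cc_assoc mult.commute Un_assoc)
  qed auto
qed auto

lemma mul_one: "mul (bas {}) x = x"
  by (rule lin_eqI[where x=x]) auto

fun ew :: "nat list \<Rightarrow> (nat set \<Rightarrow>\<^sub>0 'k)" where
  "ew [] = bas {}"
| "ew (i # w) = mul (bas {i}) (ew w)"

lemma ew_append: "ew (u @ v) = mul (ew u) (ew v)"
  by (induction u) (auto simp: mul_one mul_assoc)

lemma lext_ew_wm: "lext ew (wm x y) = mul (lext ew x) (lext ew y)"
proof (rule lin_eqI[where x=x])
  fix u show "lext ew (wm (bas u) y) = mul (lext ew (bas u)) (lext ew y)"
    by (rule lin_eqI[where x=y]) (auto simp: ew_append)
qed auto

lemma keys_mul:
  assumes "keys x \<subseteq> Pow {1..n}" "keys y \<subseteq> Pow {1..n}"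
  shows "keys (mul x y) \<subseteq> Pow {1..n}"
proof -
  have k: "keys (mul (bas S) (bas T)) \<subseteq> Pow {1..n}" if "S \<subseteq> {1..n}" "T \<subseteq> {1..n}" for S T
    unfolding mul_bas by (intro keysI) (use that in simp)
  have l: "keys (mul (bas S) y) \<subseteq> Pow {1..n}" if "S \<subseteq> {1..n}" for S
    by (rule lin_keys[OF lin_mul2], rule k[OF that]) (use assms(2) in blast)
  show ?thesis by (rule lin_keys[OF lin_mul1], rule l) (use assms(1) in blast)
qed

lemma keys_ew: "w \<in> lists {1..n} \<Longrightarrow> keys (ew w) \<subseteq> Pow {1..n}"
proof (induction w)
  case (Cons i w)
  then have "keys (bas {i} :: nat set \<Rightarrow>\<^sub>0 'k) \<subseteq> Pow {1..n}" by (intro keysI) simp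
  then show ?case using Cons by (simp only: ew.simps) (intro keys_mul; simp)
qed simp

lemma cc_less: "(\<And>t. t \<in> T \<Longrightarrow> i < t) \<Longrightarrow> cc {i} T = 1"
proof -
  assume a: "\<And>t. t \<in> T \<Longrightarrow> i < t"
  have "{p \<in> ({i} \<inter> {1..n}) \<times> (T \<inter> {1..n}). snd p < fst p} = {}" using a by fastforce
  then have "invs {i} T = 0" by (simp only: invs_def card.empty)
  moreover have "{i} \<inter> T = {}" using a by auto
  ultimately show ?thesis by (simp add: cc_def)
qed

lemma ew_sorted: "sorted_wrt (<) w \<Longrightarrow> ew w = bas (set w)"
  by (induction w) (auto simp: cc_less)

text \<open>The algebra map from words to the span of the \<open>e_S\<close> that sends
  \<open>x_i\<close> to \<open>e_i\<close>; it exhibits the exterior algebra as that span.\<close>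

definition hE :: "(nat list \<Rightarrow> 'k) \<Rightarrow> (nat set \<Rightarrow>\<^sub>0 'k)" where "hE f = lext ew (pm f)"

lemma linq_hE: "linq FA hE"
proof (rule linq.intro)
  interpret V: vectorspace class_ring FA by (rule fa_vs)
  show "abelian_group FA" by (rule V.module.M.abelian_group_axioms)
next
  fix x y :: "nat list \<Rightarrow> 'k" and c
  assume x: "x \<in> carrier FA"
  interpret V: vectorspace class_ring FA by (rule fa_vs)
  show "c \<odot>\<^bsub>FA\<^esub> x \<in> carrier FA" using V.module.smult_closed[of c x] x by simp
  show "hE (c \<odot>\<^bsub>FA\<^esub> x) = scl c (hE x)" using x pm_smult[of x c] by (simp add: hE_def)
  assume y: "y \<in> carrier FA"
  show "hE (x \<oplus>\<^bsub>FA\<^esub> y) = hE x + hE y" using x y by (simp add: hE_def fa_pm_add del: fa_simps)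
qed

sublocale QA: linq FA hE by (rule linq_hE)

lemma hE_mult: "f \<in> carrier FA \<Longrightarrow> g \<in> carrier FA \<Longrightarrow> hE (f \<otimes>\<^bsub>FA\<^esub> g) = mul (hE f) (hE g)"
  unfolding hE_def by (simp only: fa_closed lext_ew_wm)

definition rel :: "(nat list \<Rightarrow> 'k) set" where "rel = exterior_relations n"

lemma gen_carrier: "i \<in> {1..n} \<Longrightarrow> gen i \<in> carrier FA"
  unfolding gen_def by (rule fa_basis) simp

lemma hE_gen: "hE (gen i) = bas {i}"
  by (simp add: hE_def gen_def)

lemma rel_carrier: "rel \<subseteq> carrier FA"
proof -
  interpret R: ring FA by (rule fa_ring)
  show ?thesis unfolding rel_def exterior_relations_def Let_def
    using gen_carrier R.m_closed R.a_closed by (auto simp del: fa_simps)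
qed

lemma ideal_ker: "ideal QA.ker FA"
proof (rule idealI[OF fa_ring])
  interpret R: ring FA by (rule fa_ring)
  show "subgroup QA.ker (add_monoid FA)"
  proof (rule R.add.subgroupI)
    show "QA.ker \<subseteq> carrier FA" by (auto simp: QA.ker_def)
    show "QA.ker \<noteq> {}" using QA.h_zero R.zero_closed unfolding QA.ker_def by blast
    fix a assume "a \<in> QA.ker"
    then show "\<ominus>\<^bsub>FA\<^esub> a \<in> QA.ker" using QA.h_inv[of a] R.a_inv_closed[of a] by (simp add: QA.ker_def del: fa_simps)
    fix b assume "b \<in> QA.ker"
    then show "a \<oplus>\<^bsub>FA\<^esub> b \<in> QA.ker" using \<open>a \<in> QA.ker\<close> QA.h_add[of a b] R.a_closed[of a b] by (simp add: QA.ker_def del: fa_simps)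
  qed
  fix a x assume "a \<in> QA.ker" "x \<in> carrier FA"
  then show "x \<otimes>\<^bsub>FA\<^esub> a \<in> QA.ker" "a \<otimes>\<^bsub>FA\<^esub> x \<in> QA.ker"
    by (simp_all add: QA.ker_def hE_mult fa_closed(1) del: fa_simps)
qed

lemma rel_ker: "rel \<subseteq> QA.ker"
proof
  interpret R: ring FA by (rule fa_ring)
  fix r assume r: "r \<in> rel"
  then have rc: "r \<in> carrier FA" using rel_carrier by blast
  have "hE r = 0"
    using r unfolding rel_def exterior_relations_def Let_def
  proof (elim UnE CollectE exE conjE)
    fix i assume i: "r = gen i \<otimes>\<^bsub>FA\<^esub> gen i" "1 \<le> i" "i \<le> n"
    have "i \<in> {1..n}" using i by simp
    then show "hE r = 0" unfolding i(1) by (simp only: hE_mult gen_carrier hE_gen mul_bas) (simp add: cc_z)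
  next
    fix i j assume i: "r = (gen i \<otimes>\<^bsub>FA\<^esub> gen j) \<oplus>\<^bsub>FA\<^esub> (gen j \<otimes>\<^bsub>FA\<^esub> gen i)" "1 \<le> i" "i < j" "j \<le> n"
    have ij: "i \<in> {1..n}" "j \<in> {1..n}" using i by simp_all
    have "hE r = scl (cc {i} {j}) (bas ({i} \<union> {j})) + scl (cc {j} {i}) (bas ({j} \<union> {i}))"
      unfolding i(1) using ij by (simp only: QA.h_add hE_mult gen_carrier hE_gen mul_bas fa_closed(1))
    also have "cc {j} {i} = - (cc {i} {j} :: 'k)" using cc_swap[of "{j}" "{i}"] cd_single[OF ij(1)] cd_single[OF ij(2)] by simp
    finally show "hE r = 0" by (simp add: insert_commute)
  qed
  then show "r \<in> QA.ker" using rc by (simp add: QA.ker_def)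
qed

text \<open>One inclusion holds because the kernel is an ideal containing the relations. For the
  other, insertion sort shows each word congruent modulo the ideal to the signed sorted word that
  its image prescribes; hence an element with image 0 lies in the ideal.\<close>

lemma ker_eq: "QA.ker = Idl\<^bsub>FA\<^esub> rel"
proof
  interpret R: ring FA by (rule fa_ring)
  show "Idl\<^bsub>FA\<^esub> rel \<subseteq> QA.ker" by (rule R.genideal_minimal[OF ideal_ker rel_ker])
  interpret I: ideal "Idl\<^bsub>FA\<^esub> rel" FA by (rule R.genideal_ideal[OF rel_carrier])
  \<comment> \<open>The ideal, carried over to finitely supported functions, where the calculus of
    \<open>lin\<close> is available.\<close>
  define J where "J = pm ` (Idl\<^bsub>FA\<^esub> rel)"
  have Ic: "x \<in> Idl\<^bsub>FA\<^esub> rel \<Longrightarrow> x \<in> carrier FA" for x by (rule I.a_Hcarr)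
  have J0: "0 \<in> J" unfolding J_def using I.zero_closed by (intro image_eqI[of _ _ "\<zero>\<^bsub>FA\<^esub>"]) auto
  have Jadd: "x + y \<in> J" if xy: "x \<in> J" "y \<in> J" for x y
  proof -
    obtain f g where "x = pm f" "y = pm g" "f \<in> Idl\<^bsub>FA\<^esub> rel" "g \<in> Idl\<^bsub>FA\<^esub> rel" using xy by (auto simp: J_def)
    then show ?thesis unfolding J_def using fa_pm_add[of f n g] Ic I.a_closed[of f g]
      by (intro image_eqI[of _ _ "f \<oplus>\<^bsub>FA\<^esub> g"]) (auto simp del: fa_simps)
  qed
  have Jl: "wm y x \<in> J" and Jr: "wm x y \<in> J" if xJ: "x \<in> J" and y: "keys y \<subseteq> lists {1..n}" for x y
  proof -
    obtain f where f: "x = pm f" "f \<in> Idl\<^bsub>FA\<^esub> rel" using xJ by (auto simp: J_def)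
    have yc: "lookup y \<in> carrier FA" using y by (auto simp: in_keys_iff)
    have yp: "pm (lookup y) = y" by (rule poly_mapping_eqI) (simp add: lookup_pm)
    show "wm y x \<in> J" unfolding J_def
      by (rule image_eqI[of _ _ "lookup y \<otimes>\<^bsub>FA\<^esub> f"]) (simp_all only: fa_closed(2) yc Ic f yp I.I_l_closed)
    show "wm x y \<in> J" unfolding J_def
      by (rule image_eqI[of _ _ "f \<otimes>\<^bsub>FA\<^esub> lookup y"]) (simp_all only: fa_closed(2) yc Ic f yp I.I_r_closed)
  qed
  have Jscl: "scl c x \<in> J" if "x \<in> J" for c x
  proof -
    have "keys (scl c (bas [] :: nat list \<Rightarrow>\<^sub>0 'k)) \<subseteq> lists {1..n}" by (intro keysI) simp
    then have "wm (scl c (bas [])) x \<in> J" using Jl[OF that] by blast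
    then show ?thesis by (simp add: wm_one)
  qed
  have Jdiff: "x - y \<in> J" if "x \<in> J" "y \<in> J" for x y
    using Jadd[OF that(1) Jscl[OF that(2), of "-1"]] by simp
  have Jsum: "(\<Sum>i\<in>A. f i) \<in> J" if "\<And>i. i \<in> A \<Longrightarrow> f i \<in> J" for A and f :: "nat set \<Rightarrow> _"
    using that by (induction A rule: infinite_finite_induct) (auto simp: J0 Jadd)
  have Jsum': "(\<Sum>i\<in>A. f i) \<in> J" if "\<And>i. i \<in> A \<Longrightarrow> f i \<in> J" for A and f :: "nat list \<Rightarrow> _"
    using that by (induction A rule: infinite_finite_induct) (auto simp: J0 Jadd)
  have relJ: "pm r \<in> J" if "r \<in> rel" for r unfolding J_def using R.genideal_self[OF rel_carrier] that by blast
  have sq: "bas [i, i] \<in> J" if i: "i \<in> {1..n}" for i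
  proof -
    have "gen i \<otimes>\<^bsub>FA\<^esub> gen i \<in> rel" using i unfolding rel_def exterior_relations_def Let_def by auto
    then have "pm (gen i \<otimes>\<^bsub>FA\<^esub> gen i) \<in> J" by (rule relJ)
    then show ?thesis using fa_closed(2)[OF gen_carrier[OF i] gen_carrier[OF i]] by (simp add: gen_def del: fa_simps)
  qed
  have an: "bas [i, j] + bas [j, i] \<in> J" if i: "i \<in> {1..n}" "j \<in> {1..n}" "i < j" for i j
  proof -
    have "(gen i \<otimes>\<^bsub>FA\<^esub> gen j) \<oplus>\<^bsub>FA\<^esub> (gen j \<otimes>\<^bsub>FA\<^esub> gen i) \<in> rel"
      using i unfolding rel_def exterior_relations_def Let_def by auto
    then have "pm ((gen i \<otimes>\<^bsub>FA\<^esub> gen j) \<oplus>\<^bsub>FA\<^esub> (gen j \<otimes>\<^bsub>FA\<^esub> gen i)) \<in> J" by (rule relJ)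
    then show ?thesis using gen_carrier i(1,2)
      by (simp add: fa_pm_add fa_closed gen_def del: fa_simps)
  qed
  \<comment> \<open>Insertion of one letter into an increasing word: nothing to do if it is smaller
    than the first letter, a square if they are equal, and otherwise one exchange followed by
    insertion into the tail.\<close>
  have ins: "bas (i # w) - scl (cc {i} (set w)) (bas (sorted_list_of_set (insert i (set w)))) \<in> J"
    if i: "i \<in> {1..n}" and w: "sorted_wrt (<) w" "w \<in> lists {1..n}" for i w
    using w
  proof (induction w)
    case Nil
    then show ?case using J0 by simp
  next
    case (Cons j w)
    have j: "j \<in> {1..n}" "j \<notin> set w" "w \<in> lists {1..n}" "sorted_wrt (<) w" "\<forall>t\<in>set w. j < t" using Cons(2,3) by auto
    have sl: "sorted_list_of_set (insert i (set (j # w))) = L"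
      if "sorted_wrt (<) L" "set L = insert i (set (j # w))" for L
      using that by (metis sorted_list_of_set.idem_if_sorted_distinct strict_sorted_iff)
    consider "i < j" | "i = j" | "j < i" by linarith
    then show ?case
    proof cases
      case 1
      then have "sorted_list_of_set (insert i (set (j # w))) = i # j # w"
        using Cons(2) j by (intro sl) auto
      moreover have "cc {i} (set (j # w)) = (1 :: 'k)" by (rule cc_less) (use 1 j in auto)
      ultimately show ?thesis using J0 by simp
    next
      case 2
      have "wm (bas [i, i]) (bas w) \<in> J" by (rule Jr[OF sq[OF i]]) (use j in simp)
      then show ?thesis using 2 by (simp add: cc_z)
    next
      case 3
      let ?S = "insert i (set w)"
      have S: "j # sorted_list_of_set ?S = sorted_list_of_set (insert i (set (j # w)))"
      proof (rule sl[symmetric])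
        have S0: "sorted_wrt (<) (sorted_list_of_set ?S)" "set (sorted_list_of_set ?S) = ?S"
          by (rule strict_sorted_list_of_set) (rule set_sorted_list_of_set, simp)
        show "sorted_wrt (<) (j # sorted_list_of_set ?S)" unfolding sorted_wrt.simps S0(2) using S0(1) 3 j(5) by blast
        show "set (j # sorted_list_of_set ?S) = insert i (set (j # w))" unfolding list.set S0(2) by blast
      qed
      have c: "cc {i} (set (j # w)) = (- cc {i} (set w) :: 'k)"
      proof -
        have "cc {i} ({j} \<union> set w) = (cc {i} {j} * cc {i} (set w) :: 'k)" by (rule cc_Un_right) (use j in auto)
        moreover have "cc {j} {i} = (1 :: 'k)" by (rule cc_less) (use 3 in simp)
        moreover have "cc {i} {j} = - (cc {j} {i} :: 'k)" using cc_swap[of "{i}" "{j}"] cd_single[OF i] cd_single[OF j(1)] by simp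
        ultimately show ?thesis by simp
      qed
      have 1: "wm (bas [j, i] + bas [i, j]) (bas w) \<in> J" by (rule Jr[OF an[OF j(1) i 3]]) (use j in simp)
      have IH: "bas (i # w) - scl (cc {i} (set w)) (bas (sorted_list_of_set ?S)) \<in> J" by (rule Cons.IH[OF j(4,3)])
      have "wm (bas [j]) (bas (i # w) - scl (cc {i} (set w)) (bas (sorted_list_of_set ?S))) \<in> J"
        by (rule Jl[OF IH]) (use j in simp)
      then have 2: "bas (j # i # w) - scl (cc {i} (set w)) (bas (j # sorted_list_of_set ?S)) \<in> J" by simp
      have "wm (bas [j, i] + bas [i, j]) (bas w) - (bas (j # i # w) - scl (cc {i} (set w)) (bas (j # sorted_list_of_set ?S))) \<in> J"
        by (rule Jdiff[OF 1 2])
      then show ?thesis unfolding c S by simp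
    qed
  qed
  let ?R = "lext (\<lambda>S. bas (sorted_list_of_set S)) :: (nat set \<Rightarrow>\<^sub>0 'k) \<Rightarrow> (nat list \<Rightarrow>\<^sub>0 'k)"
  \<comment> \<open>\<open>?R\<close> writes a set as its increasing word, so this is congruence to
    the normal form, with one insertion per letter.\<close>
  have w: "bas w - ?R (ew w) \<in> J" if "w \<in> lists {1..n}" for w
    using that
  proof (induction w)
    case Nil
    then show ?case using J0 by simp
  next
    case (Cons i w)
    then have i: "i \<in> {1..n}" "w \<in> lists {1..n}" by auto
    have 1: "wm (bas [i]) (bas w - ?R (ew w)) \<in> J" by (rule Jl[OF Cons.IH]) (use i in simp)
    have "wm (bas [i]) (?R (bas S)) - ?R (mul (bas {i}) (bas S)) \<in> J" if S: "S \<in> keys (ew w)" for S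
    proof -
      have "S \<subseteq> {1..n}" using keys_ew[OF i(2)] S by blast
      then have "finite S" by (rule finite_subset) simp
      moreover from this have "sorted_list_of_set S \<in> lists {1..n}"
        using \<open>S \<subseteq> {1..n}\<close> by (simp add: lists_eq_set del: atLeastAtMost_iff)
      ultimately have "finite S" "sorted_list_of_set S \<in> lists {1..n}" by blast+
      then show ?thesis using ins[OF i(1), of "sorted_list_of_set S"] by (simp add: strict_sorted_list_of_set)
    qed
    then have sum: "(\<Sum>S\<in>keys (ew w). scl (lookup (ew w) S) (wm (bas [i]) (?R (bas S)) - ?R (mul (bas {i}) (bas S)))) \<in> J"
      by (intro Jsum Jscl)
    have l: "lin (\<lambda>x. wm (bas [i]) (?R x) - ?R (mul (bas {i}) x))"
      by (intro lin_sub lin_wm2' lin_lext lin_mul2' lin_id)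
    have 2: "wm (bas [i]) (?R (ew w)) - ?R (mul (bas {i}) (ew w)) \<in> J"
      by (subst lin_expand[OF l, of "ew w"]) (rule sum)
    have "wm (bas [i]) (bas w - ?R (ew w)) + (wm (bas [i]) (?R (ew w)) - ?R (mul (bas {i}) (ew w))) \<in> J"
      by (rule Jadd[OF 1 2])
    then show ?case by simp
  qed
  show "QA.ker \<subseteq> Idl\<^bsub>FA\<^esub> rel"
  proof
    fix f assume "f \<in> QA.ker"
    then have f: "f \<in> carrier FA" "lext ew (pm f) = 0" by (auto simp: QA.ker_def hE_def)
    have kf: "keys (pm f) \<subseteq> lists {1..n}" using f(1) keys_pm[of f] by simp
    have sum: "(\<Sum>w\<in>keys (pm f). scl (lookup (pm f) w) (bas w - ?R (lext ew (bas w)))) \<in> J"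
      using w kf by (intro Jsum' Jscl) auto
    have l: "lin (\<lambda>x. x - ?R (lext ew x))" by (intro lin_sub lin_lext lin_id)
    have "pm f - ?R (lext ew (pm f)) \<in> J"
      by (subst lin_expand[OF l, of "pm f"]) (rule sum)
    then have "pm f \<in> J" using f(2) by simp
    then obtain g where g: "pm f = pm g" "g \<in> Idl\<^bsub>FA\<^esub> rel" by (auto simp: J_def)
    then show "f \<in> Idl\<^bsub>FA\<^esub> rel" using pm_inj_fa[OF f(1) Ic[OF g(2)] g(1)] by simp
  qed
qed

abbreviation XA :: "('k, (nat list \<Rightarrow> 'k) set) module" where "XA \<equiv> exterior_algebra n"

lemma XA_eq: "XA = QA.Q"
  unfolding exterior_algebra_def ker_eq rel_def ..

lemma hE_image: "hE ` carrier FA = {v. keys v \<subseteq> Pow {1..n}}"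
proof (intro equalityI subsetI)
  fix v assume "v \<in> hE ` carrier FA"
  then obtain f where f: "f \<in> carrier FA" "v = hE f" by blast
  have "keys (pm f) \<subseteq> lists {1..n}" using f(1) keys_pm[of f] by simp
  then have "keys (hE f) \<subseteq> Pow {1..n}" unfolding hE_def by (intro keys_lext keys_ew) blast
  then show "v \<in> {v. keys v \<subseteq> Pow {1..n}}" using f by simp
next
  fix v :: "nat set \<Rightarrow>\<^sub>0 'k" assume v: "v \<in> {v. keys v \<subseteq> Pow {1..n}}"
  let ?x = "lext (\<lambda>S. bas (sorted_list_of_set S)) v :: nat list \<Rightarrow>\<^sub>0 'k"
  have fin: "S \<in> keys v \<Longrightarrow> finite S \<and> S \<subseteq> {1..n}" for S using v finite_subset by blast
  have l: "S \<in> keys v \<Longrightarrow> sorted_list_of_set S \<in> lists {1..n}" for S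
    using fin[of S] by (simp add: lists_eq_set del: atLeastAtMost_iff)
  have "keys ?x \<subseteq> lists {1..n}" by (intro keys_lext keysI) (use l in simp)
  then have c: "lookup ?x \<in> carrier FA" by (auto simp: in_keys_iff)
  have "pm (lookup ?x) = ?x" by (rule poly_mapping_eqI) (simp add: lookup_pm)
  then have "hE (lookup ?x) = lext ew ?x" by (simp add: hE_def)
  also have "\<dots> = v"
    by (rule lin_eq_on[of "\<lambda>v. lext ew (lext (\<lambda>S. bas (sorted_list_of_set S)) v)" "\<lambda>v. v"])
      (use fin in \<open>auto simp: ew_sorted strict_sorted_list_of_set\<close>)
  finally show "v \<in> hE ` carrier FA" using c by (intro image_eqI[of _ _ "lookup ?x"]) simp_all
qed

lemma XA_mult:
  assumes "U \<in> carrier XA" "V \<in> carrier XA"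
  shows "U \<otimes>\<^bsub>XA\<^esub> V \<in> carrier XA \<and> QA.QH (U \<otimes>\<^bsub>XA\<^esub> V) = mul (QA.QH U) (QA.QH V)"
proof -
  obtain x where x: "x \<in> carrier FA" "U = QA.ker +>\<^bsub>FA\<^esub> x" using assms(1) unfolding XA_eq by (rule QA.Q_E)
  obtain y where y: "y \<in> carrier FA" "V = QA.ker +>\<^bsub>FA\<^esub> y" using assms(2) unfolding XA_eq by (rule QA.Q_E)
  have "U \<otimes>\<^bsub>XA\<^esub> V = rcoset_mult FA QA.ker U V" unfolding XA_eq QA.Q_simps ..
  also have "\<dots> = (\<Union>a\<in>U. \<Union>b\<in>V. QA.ker +>\<^bsub>FA\<^esub> (x \<otimes>\<^bsub>FA\<^esub> y))"
    unfolding rcoset_mult_def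
  proof (intro SUP_cong refl)
    fix a b assume "a \<in> U" "b \<in> V"
    then have a: "a \<in> carrier FA" "hE a = hE x" and b: "b \<in> carrier FA" "hE b = hE y"
      using x y QA.coset by (auto simp del: fa_simps)
    show "QA.ker +>\<^bsub>FA\<^esub> (a \<otimes>\<^bsub>FA\<^esub> b) = QA.ker +>\<^bsub>FA\<^esub> (x \<otimes>\<^bsub>FA\<^esub> y)"
      using a b x y by (simp only: QA.coset fa_closed(1) hE_mult)
  qed
  also have "\<dots> = QA.ker +>\<^bsub>FA\<^esub> (x \<otimes>\<^bsub>FA\<^esub> y)"
  proof -
    have "x \<in> U" "y \<in> V" using x y QA.coset by (auto simp del: fa_simps)
    then show ?thesis by auto
  qed
  finally have e: "U \<otimes>\<^bsub>XA\<^esub> V = QA.ker +>\<^bsub>FA\<^esub> (x \<otimes>\<^bsub>FA\<^esub> y)" .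
  show ?thesis unfolding e using x y
    by (simp only: QA.QH_coset fa_closed(1) hE_mult XA_eq QA.coset_in_Q)
qed

end

declare free_module_simps [simp del] fa_simps [simp del]

section \<open>Tensor powers\<close>

lemma pm_lookup [simp]: "pm (lookup z) = z"
  by (rule poly_mapping_eqI) (simp add: lookup_pm)

lemma FM_lookup: "keys z \<subseteq> S \<Longrightarrow> lookup z \<in> carrier (free_module S)"
  by (auto simp: free_module_simps in_keys_iff)
lemma FM_keys: "f \<in> carrier (free_module S) \<Longrightarrow> keys (pm f) \<subseteq> S"
  by (simp add: free_module_simps keys_pm)
lemma FM_eq: "f \<in> carrier (free_module S) \<Longrightarrow> lookup (pm f) = f"
  by (simp add: free_module_simps lookup_pm)
lemma FM_pm_add: "f \<in> carrier (free_module S) \<Longrightarrow> g \<in> carrier (free_module S) \<Longrightarrow>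
    pm (f \<oplus>\<^bsub>free_module S\<^esub> g) = pm f + pm g"
  by (simp add: free_module_simps pm_add)
lemma FM_pm_smult: "f \<in> carrier (free_module S) \<Longrightarrow> pm (c \<odot>\<^bsub>free_module S\<^esub> f) = scl c (pm f)"
  by (simp only: free_module_simps pm_smult mem_Collect_eq)
lemma FM_pm_zero: "pm (\<zero>\<^bsub>free_module S\<^esub>) = 0"
  by (simp add: free_module_simps)

lemma linq_free:
  assumes "lin g"
  shows "linq (free_module S :: ('k::field, 's \<Rightarrow> 'k) module) (\<lambda>f. g (pm f))"
proof (rule linq.intro)
  interpret V: vectorspace class_ring "free_module S :: ('k, 's \<Rightarrow> 'k) module" by (rule free_module_vs)
  show "abelian_group (free_module S :: ('k, 's \<Rightarrow> 'k) module)" by (rule V.module.M.abelian_group_axioms)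
next
  interpret V: vectorspace class_ring "free_module S :: ('k, 's \<Rightarrow> 'k) module" by (rule free_module_vs)
  fix x y :: "'s \<Rightarrow> 'k" and c :: 'k
  assume x: "x \<in> carrier (free_module S)"
  show "c \<odot>\<^bsub>free_module S\<^esub> x \<in> carrier (free_module S)" using V.module.smult_closed[of c x] x by simp
  show "g (pm (c \<odot>\<^bsub>free_module S\<^esub> x)) = scl c (g (pm x))" using x by (simp add: FM_pm_smult lin_scl[OF assms])
  assume y: "y \<in> carrier (free_module S)"
  show "g (pm (x \<oplus>\<^bsub>free_module S\<^esub> y)) = g (pm x) + g (pm y)" using x y by (simp add: FM_pm_add lin_add[OF assms])
qed

definition pm_subspace :: "('s \<Rightarrow>\<^sub>0 'k::field) set \<Rightarrow> bool"
  where "pm_subspace J \<longleftrightarrow> 0 \<in> J \<and> (\<forall>x\<in>J. \<forall>y\<in>J. x + y \<in> J) \<and> (\<forall>c. \<forall>x\<in>J. scl c x \<in> J)"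

lemma pm_subspace_zero: "pm_subspace J \<Longrightarrow> 0 \<in> J" by (simp add: pm_subspace_def)
lemma pm_subspace_add: "pm_subspace J \<Longrightarrow> x \<in> J \<Longrightarrow> y \<in> J \<Longrightarrow> x + y \<in> J" by (simp add: pm_subspace_def)
lemma pm_subspace_scl: "pm_subspace J \<Longrightarrow> x \<in> J \<Longrightarrow> scl c x \<in> J" by (simp add: pm_subspace_def)
lemma pm_subspace_sum: "pm_subspace J \<Longrightarrow> (\<And>i. i \<in> A \<Longrightarrow> f i \<in> J) \<Longrightarrow> (\<Sum>i\<in>A. f i) \<in> J"
  by (induction A rule: infinite_finite_induct) (auto simp: pm_subspace_zero pm_subspace_add)

lemma pm_subspace_lin:
  assumes "pm_subspace J" "lin g" "\<And>s. s \<in> keys x \<Longrightarrow> g (bas s) \<in> J"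
  shows "g x \<in> J"
  by (subst lin_expand[OF assms(2), of x]) (intro pm_subspace_sum pm_subspace_scl assms(1,3))

lemma pm_subspace_span:
  assumes S: "R \<subseteq> carrier (free_module S :: ('k::field, 's \<Rightarrow> 'k) module)"
  shows "pm_subspace (pm ` LinearCombinations.module.span class_ring (free_module S) R)"
    "LinearCombinations.module.span class_ring (free_module S) R \<subseteq> carrier (free_module S)"
    "R \<subseteq> LinearCombinations.module.span class_ring (free_module S) R"
proof -
  let ?V = "free_module S :: ('k, 's \<Rightarrow> 'k) module"
  interpret V: vectorspace class_ring ?V by (rule free_module_vs)
  have s: "submodule class_ring (V.span R) ?V" by (rule V.span_is_submodule[OF S])
  show c: "V.span R \<subseteq> carrier ?V" by (rule V.span_is_subset2[OF S])
  show "R \<subseteq> V.span R" by (rule V.in_own_span[OF S])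
  show "pm_subspace (pm ` V.span R)"
    unfolding pm_subspace_def
  proof (intro conjI ballI allI)
    show "0 \<in> pm ` V.span R" using submodule.zero_closed[OF s] FM_pm_zero by (metis image_eqI)
    fix x y c assume "x \<in> pm ` V.span R"
    then obtain f where f: "x = pm f" "f \<in> V.span R" by blast
    show "scl c x \<in> pm ` V.span R"
      using submodule.smult_closed[OF s, of c f] f c FM_pm_smult[of f S c]
      by (intro image_eqI[of _ _ "c \<odot>\<^bsub>?V\<^esub> f"]) auto
    assume "y \<in> pm ` V.span R"
    then obtain g where g: "y = pm g" "g \<in> V.span R" by blast
    show "x + y \<in> pm ` V.span R"
      using submodule.m_closed[OF s, of f g] f g FM_pm_add[OF subsetD[OF c f(2)] subsetD[OF c g(2)]]
      by (intro image_eqI[of _ _ "f \<oplus>\<^bsub>?V\<^esub> g"]) auto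
  qed
qed

lemma submodule_ker:
  assumes "lin g"
  shows "submodule class_ring (linq.ker (free_module S) (\<lambda>f. g (pm f))) (free_module S :: ('k::field, 's \<Rightarrow> 'k) module)"
proof (rule submodule.intro)
  let ?V = "free_module S :: ('k, 's \<Rightarrow> 'k) module"
  interpret V: vectorspace class_ring ?V by (rule free_module_vs)
  interpret L: linq ?V "\<lambda>f. g (pm f)" by (rule linq_free[OF assms])
  show "Module.module class_ring ?V" by (rule V.module_axioms)
  show "L.ker \<subseteq> carrier ?V" by (auto simp: L.ker_def)
  show "\<zero>\<^bsub>?V\<^esub> \<in> L.ker" by (simp add: L.ker_def L.h_zero)
  show "v \<oplus>\<^bsub>?V\<^esub> w \<in> L.ker" if "v \<in> L.ker" "w \<in> L.ker" for v w
    using that by (simp add: L.ker_def L.h_add)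
  show "c \<odot>\<^bsub>?V\<^esub> v \<in> L.ker" if "v \<in> L.ker" for c v
    using that L.sm L.h_sm by (simp add: L.ker_def)
qed

lemma span_in_ker:
  assumes "lin g" "R \<subseteq> carrier (free_module S :: ('k::field, 's \<Rightarrow> 'k) module)" "\<And>f. f \<in> R \<Longrightarrow> g (pm f) = 0"
  shows "LinearCombinations.module.span class_ring (free_module S) R \<subseteq> linq.ker (free_module S) (\<lambda>f. g (pm f))"
proof -
  let ?V = "free_module S :: ('k, 's \<Rightarrow> 'k) module"
  interpret V: vectorspace class_ring ?V by (rule free_module_vs)
  interpret L: linq ?V "\<lambda>f. g (pm f)" by (rule linq_free[OF assms(1)])
  show ?thesis
    by (rule V.span_is_subset[OF _ submodule_ker[OF assms(1)]]) (use assms(2,3) in \<open>auto simp: L.ker_def\<close>)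
qed

lemma tuples_iff: "us @ vs \<in> tuples M r \<longleftrightarrow> us \<in> lists (carrier M) \<and> vs \<in> lists (carrier M) \<and> length us + length vs = r"
  "a # vs \<in> tuples M r \<longleftrightarrow> a \<in> carrier M \<and> vs \<in> lists (carrier M) \<and> Suc (length vs) = r"
  by (auto simp: tuples_def)

lemma tensor_relations_eq:
  "tensor_relations M r =
    {lookup (bas (us @ (a \<oplus>\<^bsub>M\<^esub> b) # vs) - bas (us @ a # vs) - bas (us @ b # vs))
      | us a b vs. us @ a # vs \<in> tuples M r \<and> b \<in> carrier M} \<union>
    {lookup (bas (us @ (c \<odot>\<^bsub>M\<^esub> a) # vs) - scl c (bas (us @ a # vs)))
      | us c a vs. us @ a # vs \<in> tuples M r}" for M :: "('k::field, 'a, 'm) module_scheme"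
proof -
  have e1: "(\<lambda>t. basis_vec A t - basis_vec B t - basis_vec C t) = lookup (bas A - bas B - bas C :: 'a list \<Rightarrow>\<^sub>0 'k)" for A B C
    by (rule ext) (simp add: basis_vec_def lookup_minus lookup_single when_def eq_commute)
  have e2: "(\<lambda>t. basis_vec A t - c * basis_vec B t) = lookup (bas A - scl c (bas B) :: 'a list \<Rightarrow>\<^sub>0 'k)" for A B c
    by (rule ext) (simp add: basis_vec_def lookup_minus lookup_single when_def eq_commute)
  show ?thesis unfolding tensor_relations_def e1 e2 ..
qed

context grass
begin

abbreviation EA :: "(nat list \<Rightarrow> 'k) set \<Rightarrow> (nat set \<Rightarrow>\<^sub>0 'k)" where "EA \<equiv> QA.QH"

lemma EA_add: "a \<in> carrier XA \<Longrightarrow> b \<in> carrier XA \<Longrightarrow> EA (a \<oplus>\<^bsub>XA\<^esub> b) = EA a + EA b"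
  and XA_add: "a \<in> carrier XA \<Longrightarrow> b \<in> carrier XA \<Longrightarrow> a \<oplus>\<^bsub>XA\<^esub> b \<in> carrier XA"
  using QA.QH_add unfolding XA_eq by blast+
lemma EA_smult: "a \<in> carrier XA \<Longrightarrow> EA (c \<odot>\<^bsub>XA\<^esub> a) = scl c (EA a)"
  and XA_smult: "a \<in> carrier XA \<Longrightarrow> c \<odot>\<^bsub>XA\<^esub> a \<in> carrier XA"
  using QA.QH_smult unfolding XA_eq by blast+
lemma EA_inj: "a \<in> carrier XA \<Longrightarrow> b \<in> carrier XA \<Longrightarrow> EA a = EA b \<Longrightarrow> a = b"
  using QA.QH_inj unfolding XA_eq by blast
lemma EA_image: "EA ` carrier XA = {v. keys v \<subseteq> Pow {1..n}}"
  unfolding XA_eq QA.QH_image hE_image ..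
lemma EA_keys: "a \<in> carrier XA \<Longrightarrow> keys (EA a) \<subseteq> Pow {1..n}"
  using EA_image by blast

definition av :: "(nat set \<Rightarrow>\<^sub>0 'k) \<Rightarrow> (nat list \<Rightarrow> 'k) set"
  where "av v = (SOME a. a \<in> carrier XA \<and> EA a = v)"

lemma av: assumes "keys v \<subseteq> Pow {1..n}" shows "av v \<in> carrier XA" "EA (av v) = v"
proof -
  have "v \<in> EA ` carrier XA" unfolding EA_image using assms by simp
  then have "\<exists>a. a \<in> carrier XA \<and> EA a = v" by blast
  then have "av v \<in> carrier XA \<and> EA (av v) = v" unfolding av_def by (rule someI_ex)
  then show "av v \<in> carrier XA" "EA (av v) = v" by auto
qed

lemma av_EA: "a \<in> carrier XA \<Longrightarrow> av (EA a) = a"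
  using av[OF EA_keys] EA_inj by blast

abbreviation eS :: "nat set \<Rightarrow> (nat list \<Rightarrow> 'k) set" where "eS S \<equiv> av (bas S)"

lemma eS: "S \<subseteq> {1..n} \<Longrightarrow> eS S \<in> carrier XA" "S \<subseteq> {1..n} \<Longrightarrow> EA (eS S) = bas S"
  by (rule av; simp)+

lemma map_eS: "set L \<subseteq> Pow {1..n} \<Longrightarrow> map eS L \<in> lists (carrier XA)"
proof -
  assume L: "set L \<subseteq> Pow {1..n}"
  have "eS S \<in> carrier XA" if "S \<in> set L" for S using L that by (intro eS(1)) blast
  then show ?thesis by auto
qed

abbreviation e1 :: "(nat set \<Rightarrow>\<^sub>0 'k) \<Rightarrow> (nat set list \<Rightarrow>\<^sub>0 'k)" where "e1 \<equiv> lext (\<lambda>S. bas [S])"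

text \<open>The multilinear expansion of an elementary tensor in tensors of basis vectors;
  concatenation takes the place of the tensor product.\<close>

fun Tb :: "(nat list \<Rightarrow> 'k) set list \<Rightarrow> (nat set list \<Rightarrow>\<^sub>0 'k)" where
  "Tb [] = bas []"
| "Tb (a # L) = wm (e1 (EA a)) (Tb L)"

lemma Tb_append: "Tb (us @ vs) = wm (Tb us) (Tb vs)"
  by (induction us) (auto simp: wm_one wm_assoc)

lemma Tb_eS: "set L \<subseteq> Pow {1..n} \<Longrightarrow> Tb (map eS L) = bas L"
  by (induction L) (auto simp: eS(2) simp del: One_nat_def)

lemma keys_wm:
  assumes "keys x \<subseteq> A" "keys y \<subseteq> B" "\<And>u v. u \<in> A \<Longrightarrow> v \<in> B \<Longrightarrow> u @ v \<in> C"
  shows "keys (wm x y) \<subseteq> C"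
  unfolding wm_def by (intro keys_lext keysI) (use assms in blast)

lemma keys_Tb: "xs \<in> lists (carrier XA) \<Longrightarrow> keys (Tb xs) \<subseteq> Bs (length xs)"
proof (induction xs)
  case (Cons a L)
  have "keys (e1 (EA a)) \<subseteq> Bs 1"
    by (intro keys_lext keysI) (use EA_keys[of a] Cons in \<open>auto simp: Bs_def simp del: One_nat_def atLeastAtMost_iff\<close>)
  moreover have "keys (Tb L) \<subseteq> Bs (length L)" using Cons by simp
  ultimately show ?case unfolding Tb.simps
    by (rule keys_wm) (auto simp: Bs_def simp del: One_nat_def atLeastAtMost_iff)
qed (simp add: Bs_def)

abbreviation FM :: "nat \<Rightarrow> ('k, (nat list \<Rightarrow> 'k) set list \<Rightarrow> 'k) module" where "FM r \<equiv> free_module (tuples XA r)"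

abbreviation T :: "((nat list \<Rightarrow> 'k) set list \<Rightarrow> 'k) \<Rightarrow> (nat set list \<Rightarrow>\<^sub>0 'k)" where "T \<equiv> \<lambda>F. lext Tb (pm F)"

lemma linq_T: "linq (FM r) T"
  by (rule linq_free) (rule lin_lext0)

abbreviation kerT :: "nat \<Rightarrow> ((nat list \<Rightarrow> 'k) set list \<Rightarrow> 'k) set" where "kerT r \<equiv> linq.ker (FM r) T"

lemma rel_tuples:
  assumes "us @ a # vs \<in> tuples XA r"
  shows "b \<in> carrier XA \<Longrightarrow> us @ b # vs \<in> tuples XA r" "a \<in> carrier XA"
    "us @ (c \<odot>\<^bsub>XA\<^esub> a) # vs \<in> tuples XA r"
  using assms XA_smult[of a c] by (auto simp: tuples_iff)

lemma rels_carrier: "tensor_relations XA r \<subseteq> carrier (FM r)"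
proof
  fix f assume "f \<in> tensor_relations XA r"
  then consider us a b vs where "us @ a # vs \<in> tuples XA r" "b \<in> carrier XA"
      "f = lookup (bas (us @ (a \<oplus>\<^bsub>XA\<^esub> b) # vs) - bas (us @ a # vs) - bas (us @ b # vs))"
    | us a c vs where "us @ a # vs \<in> tuples XA r"
      "f = lookup (bas (us @ (c \<odot>\<^bsub>XA\<^esub> a) # vs) - scl c (bas (us @ a # vs)))"
    unfolding tensor_relations_eq by blast
  then show "f \<in> carrier (FM r)"
  proof cases
    case 1
    show ?thesis unfolding 1(3)
      by (intro FM_lookup keys_diffI keys_basI rel_tuples(1)[OF 1(1)] XA_add[OF rel_tuples(2)[OF 1(1)] 1(2)] 1(1,2))
  next
    case 2
    show ?thesis unfolding 2(2)
      by (intro FM_lookup keys_diffI keys_sclI keys_basI rel_tuples(3)[OF 2(1)] 2(1))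
  qed
qed

lemma rels_T: "f \<in> tensor_relations XA r \<Longrightarrow> T f = 0"
proof -
  assume "f \<in> tensor_relations XA r"
  then consider us a b vs where "us @ a # vs \<in> tuples XA r" "b \<in> carrier XA"
      "f = lookup (bas (us @ (a \<oplus>\<^bsub>XA\<^esub> b) # vs) - bas (us @ a # vs) - bas (us @ b # vs))"
    | us a c vs where "us @ a # vs \<in> tuples XA r"
      "f = lookup (bas (us @ (c \<odot>\<^bsub>XA\<^esub> a) # vs) - scl c (bas (us @ a # vs)))"
    unfolding tensor_relations_eq by blast
  then show "T f = 0"
    by cases (simp_all add: Tb_append EA_add EA_smult rel_tuples(2))
qed

definition nullP :: "nat \<Rightarrow> ((nat list \<Rightarrow> 'k) set list \<Rightarrow>\<^sub>0 'k) set" where "nullP r = pm ` tensor_null XA r"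

lemma pm_subspace_nullP: "pm_subspace (nullP r)"
  unfolding nullP_def tensor_null_def by (rule pm_subspace_span(1)[OF rels_carrier])

lemma nullP_rel: "f \<in> tensor_relations XA r \<Longrightarrow> pm f \<in> nullP r"
  unfolding nullP_def tensor_null_def using pm_subspace_span(3)[OF rels_carrier, of r] by blast

lemma nullP_add:
  assumes "us @ a # vs \<in> tuples XA r" "b \<in> carrier XA"
  shows "bas (us @ (a \<oplus>\<^bsub>XA\<^esub> b) # vs) - bas (us @ a # vs) - bas (us @ b # vs) \<in> nullP r"
proof -
  have "lookup (bas (us @ (a \<oplus>\<^bsub>XA\<^esub> b) # vs) - bas (us @ a # vs) - bas (us @ b # vs)) \<in> tensor_relations XA r"
    unfolding tensor_relations_eq using assms by blast
  then show ?thesis using nullP_rel by fastforce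
qed

lemma nullP_scl:
  assumes "us @ a # vs \<in> tuples XA r"
  shows "bas (us @ (c \<odot>\<^bsub>XA\<^esub> a) # vs) - scl c (bas (us @ a # vs)) \<in> nullP r"
proof -
  have "lookup (bas (us @ (c \<odot>\<^bsub>XA\<^esub> a) # vs) - scl c (bas (us @ a # vs))) \<in> tensor_relations XA r"
    unfolding tensor_relations_eq using assms by blast
  then show ?thesis using nullP_rel by fastforce
qed

text \<open>Additivity and homogeneity in one place, transported along the section \<open>av\<close>
  of \<open>EA\<close>, expand that entry in the basis modulo the relations.\<close>

lemma slot:
  assumes us: "us \<in> lists (carrier XA)" "vs \<in> lists (carrier XA)" "length us + Suc (length vs) = r"
    and v: "keys v \<subseteq> Pow {1..n}"
  shows "bas (us @ av v # vs) - lext (\<lambda>S. bas (us @ eS S # vs)) v \<in> nullP r"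
proof -
  let ?P = "\<lambda>v. bas (us @ av v # vs) - lext (\<lambda>S. bas (us @ eS S # vs)) v"
  note J = pm_subspace_nullP[of r]
  have tup: "us @ av v # vs \<in> tuples XA r" if "keys v \<subseteq> Pow {1..n}" for v
    using us av(1)[OF that] by (simp add: tuples_iff)
  have S: "?P (scl c v) \<in> nullP r" if v: "keys v \<subseteq> Pow {1..n}" and P: "?P v \<in> nullP r" for c v
  proof -
    have "av (scl c v) = c \<odot>\<^bsub>XA\<^esub> av v"
      using av[OF v] av[OF keys_sclI[OF v]] by (intro EA_inj) (auto simp: EA_smult XA_smult)
    then have "bas (us @ av (scl c v) # vs) - scl c (bas (us @ av v # vs)) \<in> nullP r"
      using nullP_scl[OF tup[OF v], of c] by simp
    from pm_subspace_add[OF J this pm_subspace_scl[OF J P, of c]] show ?thesis by simp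
  qed
  have A: "?P (v + w) \<in> nullP r" if v: "keys v \<subseteq> Pow {1..n}" and w: "keys w \<subseteq> Pow {1..n}"
    and P: "?P v \<in> nullP r" "?P w \<in> nullP r" for v w
  proof -
    have "av (v + w) = av v \<oplus>\<^bsub>XA\<^esub> av w"
      using av[OF v] av[OF w] av[OF keys_addI[OF v w]] by (intro EA_inj) (auto simp: EA_add XA_add)
    then have "bas (us @ av (v + w) # vs) - bas (us @ av v # vs) - bas (us @ av w # vs) \<in> nullP r"
      using nullP_add[OF tup[OF v] av(1)[OF w]] by simp
    from pm_subspace_add[OF J this pm_subspace_add[OF J P]] show ?thesis by (simp add: algebra_simps)
  qed
  have B: "?P (bas S) \<in> nullP r" for S using pm_subspace_zero[OF J] by simp
  have "?P (\<Sum>S\<in>A. scl (lookup v S) (bas S)) \<in> nullP r" if A': "finite A" "A \<subseteq> Pow {1..n}" for A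
    using A'
  proof (induction A)
    case empty
    have "?P (scl 0 (bas {})) \<in> nullP r" by (rule S[OF _ B]) simp
    then show ?case by simp
  next
    case (insert S F)
    have k: "keys (scl (lookup v S) (bas S)) \<subseteq> Pow {1..n}" "keys (\<Sum>S\<in>F. scl (lookup v S) (bas S)) \<subseteq> Pow {1..n}"
      using insert by (intro keysI; blast)+
    have "?P (scl (lookup v S) (bas S)) \<in> nullP r" by (rule S[OF _ B]) (use insert in simp)
    moreover have "?P (\<Sum>S\<in>F. scl (lookup v S) (bas S)) \<in> nullP r" using insert by blast
    ultimately show ?case unfolding sum.insert[OF insert(1,2)] using k by (intro A)
  qed
  from this[of "keys v"] v show ?thesis by (simp only: pm_expand[of v, symmetric] finite_keys simp_thms)
qed

abbreviation RR :: "(nat set list \<Rightarrow>\<^sub>0 'k) \<Rightarrow> ((nat list \<Rightarrow> 'k) set list \<Rightarrow>\<^sub>0 'k)"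
  where "RR \<equiv> lext (\<lambda>L. bas (map eS L))"

text \<open>The entries are expanded one at a time from the left; \<open>L\<close> records those
  that are already basis vectors.\<close>

lemma reduce:
  assumes "ws \<in> lists (carrier XA)" "set L \<subseteq> Pow {1..n}" "length L + length ws = r"
  shows "bas (map eS L @ ws) - RR (wm (bas L) (Tb ws)) \<in> nullP r"
  using assms
proof (induction ws arbitrary: L)
  case Nil
  then show ?case using pm_subspace_zero[OF pm_subspace_nullP] by simp
next
  case (Cons a ws)
  note J = pm_subspace_nullP[of r]
  have a: "a \<in> carrier XA" "ws \<in> lists (carrier XA)" "length L + Suc (length ws) = r" using Cons by auto
  have mL: "map eS L \<in> lists (carrier XA)" by (rule map_eS[OF Cons.prems(1)])
  have 1: "bas (map eS L @ a # ws) - lext (\<lambda>S. bas (map eS L @ eS S # ws)) (EA a) \<in> nullP r"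
    using slot[OF mL a(2) _ EA_keys[OF a(1)], of r] a by (simp add: av_EA)
  let ?g = "\<lambda>v. lext (\<lambda>S. bas (map eS L @ eS S # ws)) v - RR (wm (bas L) (wm (e1 v) (Tb ws)))"
  have "?g (EA a) \<in> nullP r"
  proof (rule pm_subspace_lin[where g="?g" and x="EA a", OF J])
    show "lin ?g" by (intro lin_sub lin_lext lin_wm2' lin_wm1' lin_id)
    fix S assume "S \<in> keys (EA a)"
    then have "S \<subseteq> {1..n}" using EA_keys[OF a(1)] by blast
    then have "bas (map eS (L @ [S]) @ ws) - RR (wm (bas (L @ [S])) (Tb ws)) \<in> nullP r"
      using Cons by (intro Cons.IH) auto
    then show "?g (bas S) \<in> nullP r" by (simp add: wm_assoc[symmetric])
  qed
  with 1 have "bas (map eS L @ a # ws) - lext (\<lambda>S. bas (map eS L @ eS S # ws)) (EA a) + ?g (EA a) \<in> nullP r"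
    by (rule pm_subspace_add[OF J])
  then show ?case by simp
qed

text \<open>The relations vanish under multilinear expansion. Conversely every tuple is congruent to
  its expansion by \<open>reduce\<close>, so an element whose expansion is 0 is itself a combination
  of relations.\<close>

lemma null_eq: "tensor_null XA r = kerT r"
proof
  interpret L: linq "FM r" T by (rule linq_T)
  show "tensor_null XA r \<subseteq> L.ker"
    unfolding tensor_null_def by (rule span_in_ker[OF lin_lext0 rels_carrier rels_T])
  show "L.ker \<subseteq> tensor_null XA r"
  proof
    fix f assume "f \<in> L.ker"
    then have f: "f \<in> carrier (FM r)" "T f = 0" by (auto simp: L.ker_def)
    have "pm f - RR (lext Tb (pm f)) \<in> nullP r"
    proof (rule pm_subspace_lin[where g="\<lambda>x. x - RR (lext Tb x)" and x="pm f", OF pm_subspace_nullP])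
      show "lin (\<lambda>x. x - RR (lext Tb x))" by (intro lin_sub lin_lext lin_id)
      fix xs assume "xs \<in> keys (pm f)"
      then have "xs \<in> tuples XA r" using FM_keys[OF f(1)] by blast
      then show "bas xs - RR (lext Tb (bas xs)) \<in> nullP r"
        using reduce[of xs "[]" r] by (simp add: wm_one tuples_def)
    qed
    then have "pm f \<in> nullP r" using f(2) by simp
    then obtain g where g: "pm f = pm g" "g \<in> tensor_null XA r" unfolding nullP_def by blast
    have "g \<in> carrier (FM r)" using g(2) pm_subspace_span(2)[OF rels_carrier, of r] unfolding tensor_null_def by blast
    then have "f = g" using FM_eq[OF f(1)] FM_eq[of g] g(1) by metis
    then show "f \<in> tensor_null XA r" using g by simp
  qed
qed

lemma T_image: "T ` carrier (FM r) = {v. keys v \<subseteq> Bs r}"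
proof (intro equalityI subsetI)
  fix v assume "v \<in> T ` carrier (FM r)"
  then obtain f where f: "f \<in> carrier (FM r)" "v = T f" by blast
  have "keys (T f) \<subseteq> Bs r"
  proof (rule keys_lext)
    fix xs assume "xs \<in> keys (pm f)"
    then have "xs \<in> tuples XA r" using FM_keys[OF f(1)] by blast
    then show "keys (Tb xs) \<subseteq> Bs r" using keys_Tb[of xs] by (simp add: tuples_def)
  qed
  then show "v \<in> {v. keys v \<subseteq> Bs r}" using f by simp
next
  fix v :: "nat set list \<Rightarrow>\<^sub>0 'k" assume "v \<in> {v. keys v \<subseteq> Bs r}"
  then have v: "length L = r" "set L \<subseteq> Pow {1..n}" if "L \<in> keys v" for L using that by (auto simp: Bs_def)
  have "map eS L \<in> tuples XA r" if "L \<in> keys v" for L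
    using v(1)[OF that] map_eS[OF v(2)[OF that]] by (simp add: tuples_def)
  then have "lookup (RR v) \<in> carrier (FM r)" by (intro FM_lookup keys_lext keysI)
  moreover have "lext Tb (RR v) = v"
    by (rule lin_eq_on[of "\<lambda>v. lext Tb (RR v)" "\<lambda>v. v"]) (use v(2) Tb_eS in auto)
  ultimately show "v \<in> T ` carrier (FM r)" by (intro image_eqI[of _ _ "lookup (RR v)"]) simp_all
qed

abbreviation TP :: "nat \<Rightarrow> ('k, ((nat list \<Rightarrow> 'k) set list \<Rightarrow> 'k) set) module" where "TP r \<equiv> tensor_power XA r"

lemma TP_eq: "TP r = quotient_module (FM r) (kerT r)"
  unfolding tensor_power_def null_eq ..

abbreviation tQ :: "((nat list \<Rightarrow> 'k) set list \<Rightarrow> 'k) set \<Rightarrow> (nat set list \<Rightarrow>\<^sub>0 'k)" where "tQ \<equiv> linq.QH T"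

lemma tQ_add: "x \<in> carrier (TP r) \<Longrightarrow> y \<in> carrier (TP r) \<Longrightarrow> tQ (x \<oplus>\<^bsub>TP r\<^esub> y) = tQ x + tQ y"
  and TP_add: "x \<in> carrier (TP r) \<Longrightarrow> y \<in> carrier (TP r) \<Longrightarrow> x \<oplus>\<^bsub>TP r\<^esub> y \<in> carrier (TP r)"
  and tQ_smult: "x \<in> carrier (TP r) \<Longrightarrow> tQ (c \<odot>\<^bsub>TP r\<^esub> x) = scl c (tQ x)"
  and TP_smult: "x \<in> carrier (TP r) \<Longrightarrow> c \<odot>\<^bsub>TP r\<^esub> x \<in> carrier (TP r)"
  and tQ_zero: "tQ (\<zero>\<^bsub>TP r\<^esub>) = 0" and TP_zero: "\<zero>\<^bsub>TP r\<^esub> \<in> carrier (TP r)"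
  and tQ_inj: "x \<in> carrier (TP r) \<Longrightarrow> y \<in> carrier (TP r) \<Longrightarrow> tQ x = tQ y \<Longrightarrow> x = y"
  using linq.QH_add[OF linq_T[of r]] linq.QH_smult[OF linq_T[of r]] linq.QH_zero[OF linq_T[of r]] linq.QH_inj[OF linq_T[of r]]
  unfolding TP_eq by blast+

lemma tQ_image: "tQ ` carrier (TP r) = {v. keys v \<subseteq> Bs r}"
  unfolding TP_eq linq.QH_image[OF linq_T] T_image ..

text \<open>The union over a coset is a single coset because \<open>T (f F)\<close> depends only on
  \<open>T F\<close>.\<close>

lemma tensor_map_tQ:
  assumes f: "\<And>F. F \<in> carrier (FM s) \<Longrightarrow> f F \<in> carrier (FM r)" "\<And>F. F \<in> carrier (FM s) \<Longrightarrow> T (f F) = g (T F)"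
    and x: "x \<in> carrier (TP s)"
  shows "tensor_map XA r f x \<in> carrier (TP r) \<and> tQ (tensor_map XA r f x) = g (tQ x)"
proof -
  interpret S: linq "FM s" T by (rule linq_T)
  interpret R: linq "FM r" T by (rule linq_T)
  obtain F where F: "F \<in> carrier (FM s)" "x = S.ker +>\<^bsub>FM s\<^esub> F" using x unfolding TP_eq by (rule S.Q_E)
  have "tensor_map XA r f x = (\<Union>G\<in>x. R.ker +>\<^bsub>FM r\<^esub> f F)"
    unfolding tensor_map_def null_eq
  proof (intro SUP_cong refl)
    fix G assume "G \<in> x"
    then have "G \<in> carrier (FM s)" "T G = T F" using F S.coset by auto
    then show "R.ker +>\<^bsub>FM r\<^esub> f G = R.ker +>\<^bsub>FM r\<^esub> f F" using f F by (simp add: R.coset)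
  qed
  also have "\<dots> = R.ker +>\<^bsub>FM r\<^esub> f F"
  proof -
    have "F \<in> x" using F S.coset by auto
    then show ?thesis by auto
  qed
  finally have e: "tensor_map XA r f x = R.ker +>\<^bsub>FM r\<^esub> f F" .
  show ?thesis unfolding e TP_eq using F(1) f R.coset_in_Q[of "f F"] by (simp add: F(2))
qed

end

section \<open>The cyclic bicomplex\<close>

lemma linear_ext_pm:
  fixes F :: "'s \<Rightarrow> 'k::field" and f :: "'i \<Rightarrow> 's \<Rightarrow> 't"
  assumes "finite {s. F s \<noteq> 0}"
  shows "linear_ext (\<lambda>xs ys. \<Sum>i\<in>I. c i * basis_vec (f i xs) ys) F
    = lookup (lext (\<lambda>xs. \<Sum>i\<in>I. scl (c i) (bas (f i xs))) (pm F))"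
proof
  fix ys :: 't
  have b: "basis_vec y ys = (lookup (bas y) ys :: 'k)" for y
    by (simp add: basis_vec_def lookup_single when_def eq_commute)
  show "linear_ext (\<lambda>xs ys. \<Sum>i\<in>I. c i * basis_vec (f i xs) ys) F ys
    = lookup (lext (\<lambda>xs. \<Sum>i\<in>I. scl (c i) (bas (f i xs))) (pm F)) ys"
    unfolding linear_ext_def lookup_lext keys_pm[OF assms] lookup_pm[OF assms] b
    by (simp add: lookup_sum)
qed

lemma face_0: "face A 0 (a # b # L) = (a \<otimes>\<^bsub>A\<^esub> b) # L"
  by (simp add: face_def)
lemma face_Suc: "Suc i < length L \<Longrightarrow> face A (Suc i) (a # L) = a # face A i L"
  by (simp add: face_def)
lemma face_last: "Suc i \<ge> length L + 2 \<Longrightarrow> face A i (a # L @ [z]) = (z \<otimes>\<^bsub>A\<^esub> a) # L"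
  by (simp add: face_def)

lemma wm_bas_left: "wm (bas u) y = lext (\<lambda>v. bas (u @ v)) y"
  by (simp add: wm_def)

context grass
begin

text \<open>The common pattern of \<open>b\<close>, \<open>b'\<close> and \<open>t\<close>: a signed
  sum of operations on tuples descends to tensors, and it suffices to compare expansions of
  elementary tensors.\<close>

lemma op_T:
  assumes u: "u \<in> carrier (FM s)"
    and f: "\<And>i xs. i \<in> I \<Longrightarrow> xs \<in> tuples XA s \<Longrightarrow> f i xs \<in> tuples XA r"
    and g: "lin g" "\<And>xs. xs \<in> tuples XA s \<Longrightarrow> (\<Sum>i\<in>I. scl (c i) (Tb (f i xs))) = g (Tb xs)"
  defines "w \<equiv> linear_ext (\<lambda>xs ys. \<Sum>i\<in>I. c i * basis_vec (f i xs) ys) u"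
  shows "w \<in> carrier (FM r) \<and> T w = g (T u)"
proof -
  have "finite {s. u s \<noteq> 0}" using u by (simp add: free_module_simps)
  then have we: "w = lookup (lext (\<lambda>xs. \<Sum>i\<in>I. scl (c i) (bas (f i xs))) (pm u))"
    unfolding w_def by (rule linear_ext_pm)
  have "keys (lext (\<lambda>xs. \<Sum>i\<in>I. scl (c i) (bas (f i xs))) (pm u) :: _ \<Rightarrow>\<^sub>0 'k) \<subseteq> tuples XA r"
    by (intro keys_lext keysI f) (use FM_keys[OF u] in auto)
  then have "w \<in> carrier (FM r)" unfolding we by (rule FM_lookup)
  moreover have "T w = g (T u)" unfolding we pm_lookup
  proof (rule lin_eq_on[where x="pm u"])
    show "lin (\<lambda>x. g (lext Tb x))" by (rule lin_comp[OF g(1) lin_lext0])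
    fix xs assume "xs \<in> keys (pm u)"
    then have "xs \<in> tuples XA s" using FM_keys[OF u] by blast
    then show "lext Tb (lext (\<lambda>xs. \<Sum>i\<in>I. scl (c i) (bas (f i xs))) (bas xs)) = g (lext Tb (bas xs))"
      by (simp add: g(2))
  qed (intro lin_lext lin_id)
  ultimately show ?thesis by blast
qed

text \<open>The recursion of \<open>beta_b\<close>, extended by linearity in all three arguments, so
  that it applies to entries that are not basis vectors.\<close>

lemma beta_wm2: "beta (wm (e1 u) (wm (e1 v) y)) = wm (e1 (mul u v)) y - wm (e1 u) (beta (wm (e1 v) y))"
proof (rule lin_eqI[where x=u])
  fix S show "beta (wm (e1 (bas S)) (wm (e1 v) y)) = wm (e1 (mul (bas S) v)) y - wm (e1 (bas S)) (beta (wm (e1 v) y))"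
  proof (rule lin_eqI[where x=v])
    fix R show "beta (wm (e1 (bas S)) (wm (e1 (bas R)) y)) = wm (e1 (mul (bas S) (bas R))) y - wm (e1 (bas S)) (beta (wm (e1 (bas R)) y))"
      by (rule lin_eqI[where x=y]) (auto simp: wm_bas_left[of "[S]" "beta_b _"])
  qed (intro lin_sub lin_wm1' lin_wm2' lin_lext lin_mul2' lin_id)+
qed (intro lin_sub lin_wm1' lin_wm2' lin_lext lin_mul1' lin_id)+

lemma W_wm:
  assumes "hom k y"
  shows "W (wm (e1 u) (wm y (e1 v))) = scl ((-1) ^ Suc k) (wm (e1 (mul v u)) y)"
proof (rule lin_eqI[where x=u])
  fix S show "W (wm (e1 (bas S)) (wm y (e1 v))) = scl ((-1) ^ Suc k) (wm (e1 (mul v (bas S))) y)"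
  proof (rule lin_eqI[where x=v])
    fix Z show "W (wm (e1 (bas S)) (wm y (e1 (bas Z)))) = scl ((-1) ^ Suc k) (wm (e1 (mul (bas Z) (bas S))) y)"
    proof (rule lin_eq_on[where x=y])
      fix L assume "L \<in> keys y"
      then have "length L = k" using assms by (auto simp: hom_def)
      then show "W (wm (e1 (bas S)) (wm (bas L) (e1 (bas Z)))) = scl ((-1) ^ Suc k) (wm (e1 (mul (bas Z) (bas S))) (bas L))"
        using W_b_simps(2)[of "S # L" Z] by simp
    qed (intro lin_scale lin_wm1' lin_wm2' lin_lext lin_id)+
  qed (intro lin_scale lin_wm1' lin_wm2' lin_lext lin_mul1' lin_id)+
qed (intro lin_scale lin_wm1' lin_wm2' lin_lext lin_mul2' lin_id)+

lemma t_wm: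
  assumes "hom k y"
  shows "tt (wm y (e1 v)) = scl ((-1) ^ k) (wm (e1 v) y)"
proof (rule lin_eqI[where x=v])
  fix Z show "tt (wm y (e1 (bas Z))) = scl ((-1) ^ k) (wm (e1 (bas Z)) y)"
  proof (rule lin_eq_on[where x=y])
    fix L assume "L \<in> keys y"
    then have "length L = k" using assms by (auto simp: hom_def)
    then show "tt (wm (bas L) (e1 (bas Z))) = scl ((-1) ^ k) (wm (e1 (bas Z)) (bas L))" by simp
  qed (intro lin_scale lin_wm1' lin_wm2' lin_lext lin_id)+
qed (intro lin_scale lin_wm1' lin_wm2' lin_lext lin_id)+

lemma hom_Tb: "xs \<in> lists (carrier XA) \<Longrightarrow> hom (length xs) (Tb xs)"
  by (rule Bs_hom[OF keys_Tb])

lemma beta_e1: "beta (e1 v) = 0"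
  by (rule lin_eqI[where x=v]) auto

lemma Tb_mult: "a \<in> carrier XA \<Longrightarrow> b \<in> carrier XA \<Longrightarrow> Tb ((a \<otimes>\<^bsub>XA\<^esub> b) # L) = wm (e1 (mul (EA a) (EA b))) (Tb L)"
  using XA_mult[of a b] by simp

lemma faces_beta:
  "set xs \<subseteq> carrier XA \<Longrightarrow> (\<Sum>i<length xs - 1. scl ((-1) ^ i) (Tb (face XA i xs))) = beta (Tb xs)"
proof (induction xs rule: induct_list012)
  case (3 a b L)
  have ab: "a \<in> carrier XA" "b \<in> carrier XA" using 3 by auto
  have IH: "(\<Sum>i<length L. scl ((-1) ^ i) (Tb (face XA i (b # L)))) = beta (Tb (b # L))" using 3 by simp
  have "(\<Sum>i<length (a # b # L) - 1. scl ((-1) ^ i) (Tb (face XA i (a # b # L))))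
    = Tb ((a \<otimes>\<^bsub>XA\<^esub> b) # L) + (\<Sum>i<length L. scl ((-1) ^ Suc i) (Tb (face XA (Suc i) (a # b # L))))"
    by (simp add: sum.lessThan_Suc_shift face_0 del: sum.lessThan_Suc Tb.simps)
  also have "(\<Sum>i<length L. scl ((-1) ^ Suc i) (Tb (face XA (Suc i) (a # b # L))))
    = (\<Sum>i<length L. - wm (e1 (EA a)) (scl ((-1) ^ i) (Tb (face XA i (b # L)))))"
    by (rule sum.cong) (auto simp: face_Suc)
  also have "\<dots> = - wm (e1 (EA a)) (beta (Tb (b # L)))" unfolding IH[symmetric] by (simp add: sum_negf)
  also have "Tb ((a \<otimes>\<^bsub>XA\<^esub> b) # L) + - wm (e1 (EA a)) (beta (Tb (b # L))) = beta (Tb (a # b # L))"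
    using Tb_mult[OF ab, of L] beta_wm2[of "EA a" "EA b" "Tb L"] by simp
  finally show ?case .
qed (auto simp: beta_e1 wm_one)

lemma face_W:
  assumes "set (a # L @ [z]) \<subseteq> carrier XA"
  shows "scl ((-1) ^ Suc (length L)) (Tb (face XA (Suc (length L)) (a # L @ [z]))) = W (Tb (a # L @ [z]))"
proof -
  have m: "a \<in> carrier XA" "z \<in> carrier XA" "L \<in> lists (carrier XA)" using assms by auto
  show ?thesis
    using W_wm[OF hom_Tb[OF m(3)], of "EA a" "EA z"] conjunct2[OF XA_mult[OF m(2,1)]] by (simp add: face_last Tb_append wm_one)
qed

text \<open>For a tuple of length 1 the last face would square the only entry and keep the length,
  hence the condition on \<open>r\<close>.\<close>

lemma face_tuples: "xs \<in> tuples XA (Suc r) \<Longrightarrow> r \<noteq> 0 \<Longrightarrow> face XA i xs \<in> tuples XA r"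
proof -
  assume xs: "xs \<in> tuples XA (Suc r)" and r: "r \<noteq> 0"
  then have c: "set xs \<subseteq> carrier XA" and l: "length xs = Suc r" by (auto simp: tuples_def)
  then have xs0: "xs \<noteq> []" by auto
  show ?thesis
  proof (cases "Suc i < length xs")
    case True
    then have "xs ! i \<in> carrier XA" "xs ! Suc i \<in> carrier XA" using c by (meson Suc_lessD nth_mem subsetD)+
    then have "xs ! i \<otimes>\<^bsub>XA\<^esub> xs ! Suc i \<in> carrier XA" using XA_mult by blast
    moreover have "set (take i xs) \<subseteq> carrier XA" "set (drop (i + 2) xs) \<subseteq> carrier XA"
      using c by (meson set_take_subset set_drop_subset subset_trans)+
    ultimately show ?thesis using True l by (auto simp: face_def tuples_def)
  next
    case False
    have "last xs \<in> carrier XA" "hd xs \<in> carrier XA" using c xs0 by auto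
    then have "last xs \<otimes>\<^bsub>XA\<^esub> hd xs \<in> carrier XA" using XA_mult by blast
    moreover have "set (butlast (tl xs)) \<subseteq> carrier XA"
      using c by (cases xs) (auto dest: in_set_butlastD)
    ultimately show ?thesis using False l r by (auto simp: face_def tuples_def)
  qed
qed

lemma bar_T: "q \<noteq> 0 \<Longrightarrow> u \<in> carrier (FM (Suc q)) \<Longrightarrow> bar_b XA q u \<in> carrier (FM q) \<and> T (bar_b XA q u) = beta (T u)"
  unfolding bar_b_def
proof (rule op_T)
  fix xs assume "xs \<in> tuples XA (Suc q)"
  then have "set xs \<subseteq> carrier XA" "length xs - 1 = q" by (auto simp: tuples_def)
  then show "(\<Sum>i<q. scl ((-1) ^ i) (Tb (face XA i xs))) = beta (Tb xs)" using faces_beta[of xs] by simp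
qed (auto intro: face_tuples)

lemma hochschild_T: "q \<noteq> 0 \<Longrightarrow> u \<in> carrier (FM (Suc q)) \<Longrightarrow> hochschild_b XA q u \<in> carrier (FM q) \<and> T (hochschild_b XA q u) = bb (T u)"
  unfolding hochschild_b_def
proof (rule op_T[where g="\<lambda>x. bb x"])
  fix xs assume q: "q \<noteq> 0" and xs: "xs \<in> tuples XA (Suc q)"
  then have c: "set xs \<subseteq> carrier XA" "length xs - 1 = q" "length xs = Suc q" by (auto simp: tuples_def)
  obtain a L z where e: "xs = a # L @ [z]"
    using c(3) q by (cases xs; cases "tl xs" rule: rev_cases) auto
  then have L: "Suc (length L) = q" using c by simp
  have 1: "(\<Sum>i<q. scl ((-1) ^ i) (Tb (face XA i xs))) = beta (Tb xs)" using faces_beta[OF c(1)] c(2) by simp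
  have 2: "scl ((-1) ^ q) (Tb (face XA q xs)) = W (Tb xs)" using face_W[of a L z] c(1) unfolding e L by blast
  have s: "{..q} = insert q {..<q}" by auto
  show "(\<Sum>i\<le>q. scl ((-1) ^ i) (Tb (face XA i xs))) = bb (Tb xs)"
    unfolding s using 1 2 by (simp add: add.commute)
qed (auto intro: face_tuples)

lemma cyclic_t_T: "u \<in> carrier (FM (Suc q)) \<Longrightarrow> cyclic_t q u \<in> carrier (FM (Suc q)) \<and> T (cyclic_t q u) = tt (T u)"
proof -
  assume u: "u \<in> carrier (FM (Suc q))"
  \<comment> \<open>Written as a sum with one term in order to fit \<open>op_T\<close>.\<close>
  have e: "cyclic_t q u = linear_ext (\<lambda>xs ys. \<Sum>i\<in>{0::nat}. (-1) ^ q * basis_vec (last xs # butlast xs) ys) u"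
    by (simp add: cyclic_t_def)
  show ?thesis unfolding e
  proof (rule op_T[OF u])
    fix xs assume "xs \<in> tuples XA (Suc q)"
    then have c: "set xs \<subseteq> carrier XA" "length xs = Suc q" by (auto simp: tuples_def)
    then obtain L z where e: "xs = L @ [z]" by (cases xs rule: rev_cases) auto
    have L: "L \<in> lists (carrier XA)" "length L = q" using c e by auto
    show "last xs # butlast xs \<in> tuples XA (Suc q)" using c L by (simp add: e tuples_def)
    show "(\<Sum>i\<in>{0::nat}. scl ((-1) ^ q) (Tb (last xs # butlast xs))) = tt (Tb xs)"
      using t_wm[OF hom_Tb[OF L(1)], of "EA z"] L by (simp add: e Tb_append wm_one)
  qed (rule lin_lext0)
qed

lemma cyclic_tpow_T: "u \<in> carrier (FM (Suc q)) \<Longrightarrow>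
    (cyclic_t q ^^ i) u \<in> carrier (FM (Suc q)) \<and> T ((cyclic_t q ^^ i) u) = (tt ^^ i) (T u)"
  by (induction i) (auto simp: cyclic_t_T)

lemma keys_T: "u \<in> carrier (FM r) \<Longrightarrow> keys (T u) \<subseteq> Bs r"
  using T_image by blast

lemma cyclic_N_T: "u \<in> carrier (FM (Suc q)) \<Longrightarrow> cyclic_N q u \<in> carrier (FM (Suc q)) \<and> T (cyclic_N q u) = NN (T u)"
proof -
  assume u: "u \<in> carrier (FM (Suc q))"
  note P = cyclic_tpow_T[OF u]
  have e: "cyclic_N q u = lookup (\<Sum>i\<le>q. pm ((cyclic_t q ^^ i) u))"
    unfolding cyclic_N_def by (rule ext) (simp add: lookup_sum FM_eq[OF conjunct1[OF P]])
  have "keys (\<Sum>i\<le>q. pm ((cyclic_t q ^^ i) u)) \<subseteq> tuples XA (Suc q)"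
    by (intro keysI FM_keys conjunct1[OF P])
  then have 1: "cyclic_N q u \<in> carrier (FM (Suc q))" unfolding e by (rule FM_lookup)
  have "T (cyclic_N q u) = (\<Sum>i\<le>q. (tt ^^ i) (T u))" unfolding e using P by simp
  also have "\<dots> = NN (T u)"
    unfolding NN_hom[OF Bs_hom[OF keys_T[OF u]]] lessThan_Suc_atMost ..
  finally show ?thesis using 1 by blast
qed

lemma diff_T: "u \<in> carrier (FM r) \<Longrightarrow> w \<in> carrier (FM r) \<Longrightarrow>
    (\<lambda>ys. u ys - w ys) \<in> carrier (FM r) \<and> T (\<lambda>ys. u ys - w ys) = T u - T w"
proof -
  assume u: "u \<in> carrier (FM r)" and w: "w \<in> carrier (FM r)"
  have e: "(\<lambda>ys. u ys - w ys) = lookup (pm u - pm w)"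
    by (rule ext) (simp add: lookup_minus FM_eq[OF u] FM_eq[OF w])
  show ?thesis unfolding e using FM_lookup[OF keys_diffI[OF FM_keys[OF u] FM_keys[OF w]]] by simp
qed

lemma neg_T: "u \<in> carrier (FM r) \<Longrightarrow> (\<lambda>ys. - u ys) \<in> carrier (FM r) \<and> T (\<lambda>ys. - u ys) = - T u"
proof -
  assume u: "u \<in> carrier (FM r)"
  have e: "(\<lambda>ys. - u ys) = lookup (- pm u)" by (rule ext) (simp add: FM_eq[OF u])
  show ?thesis unfolding e using FM_lookup[OF keys_uminusI[OF FM_keys[OF u]]] by simp
qed

lemma CC_vert_tQ:
  assumes q: "q \<noteq> 0" and x: "x \<in> carrier (TP (Suc q))"
  shows "CC_vert XA p q x \<in> carrier (TP q) \<and> tQ (CC_vert XA p q x) = (if even p then bb (tQ x) else - beta (tQ x))"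
proof (cases "even p")
  case True
  then show ?thesis
    using tensor_map_tQ[of "Suc q" "hochschild_b XA q" q "\<lambda>x. bb x", OF _ _ x] hochschild_T[OF q] by (simp add: CC_vert_def)
next
  case False
  have b: "(\<lambda>ys. - bar_b XA q u ys) \<in> carrier (FM q)" "T (\<lambda>ys. - bar_b XA q u ys) = - beta (T u)"
    if "u \<in> carrier (FM (Suc q))" for u
    using neg_T[OF conjunct1[OF bar_T[OF q that]]] bar_T[OF q that] by auto
  show ?thesis
    using tensor_map_tQ[of "Suc q" "\<lambda>f ys. - bar_b XA q f ys" q "\<lambda>x. - beta x", OF b x] False by (simp add: CC_vert_def)
qed

lemma CC_horiz_tQ:
  assumes x: "x \<in> carrier (TP (Suc q))"
  shows "CC_horiz XA p q x \<in> carrier (TP (Suc q)) \<and> tQ (CC_horiz XA p q x) = (if odd p then tQ x - tt (tQ x) else NN (tQ x))"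
proof (cases "odd p")
  case True
  then show ?thesis
    using tensor_map_tQ[of "Suc q" "\<lambda>f ys. f ys - cyclic_t q f ys" "Suc q" "\<lambda>x. x - tt x", OF _ _ x] cyclic_t_T diff_T by (simp add: CC_horiz_def)
next
  case False
  then show ?thesis
    using tensor_map_tQ[of "Suc q" "cyclic_N q" "Suc q" NN, OF _ _ x] cyclic_N_T by (simp add: CC_horiz_def)
qed

section \<open>The total complex in coordinates, and its homology\<close>

abbreviation "DC m \<equiv> Tot_CC XA m"
abbreviation "dC m \<equiv> Tot_CC_diff XA m"

definition gr :: "nat \<Rightarrow> (nat \<Rightarrow> ((nat list \<Rightarrow> 'k) set list \<Rightarrow> 'k) set) \<Rightarrow> nat \<Rightarrow> (nat set list \<Rightarrow>\<^sub>0 'k)"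
  where "gr m x p = (if p \<le> m then tQ (x p) else 0)"

lemma DC_simps:
  "carrier (DC m) = (\<Pi>\<^sub>E p\<in>{..m}. carrier (TP (Suc (m - p))))"
  "zero (DC m) = (\<lambda>p\<in>{..m}. \<zero>\<^bsub>TP (Suc (m - p))\<^esub>)"
  "add (DC m) = (\<lambda>x y. \<lambda>p\<in>{..m}. x p \<oplus>\<^bsub>TP (Suc (m - p))\<^esub> y p)"
  "smult (DC m) = (\<lambda>c x. \<lambda>p\<in>{..m}. c \<odot>\<^bsub>TP (Suc (m - p))\<^esub> x p)"
  by (simp_all add: Tot_CC_def Let_def)

lemma DC_mem: "x \<in> carrier (DC m) \<Longrightarrow> p \<le> m \<Longrightarrow> x p \<in> carrier (TP (Suc (m - p)))"
  unfolding DC_simps by (rule PiE_mem) auto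

lemma gr_TC: "x \<in> carrier (DC m) \<Longrightarrow> gr m x \<in> TC m"
proof (rule TC_I)
  fix p assume "x \<in> carrier (DC m)" "p \<le> m"
  then have "tQ (x p) \<in> tQ ` carrier (TP (Suc (m - p)))" using DC_mem by blast
  then show "keys (gr m x p) \<subseteq> Bs (Suc (m - p))" unfolding tQ_image using \<open>p \<le> m\<close> by (simp add: gr_def)
qed (simp add: gr_def)

lemma gr_inj:
  assumes "x \<in> carrier (DC m)" "y \<in> carrier (DC m)" "\<And>p. gr m x p = gr m y p"
  shows "x = y"
proof (rule PiE_ext)
  show "x \<in> (\<Pi>\<^sub>E p\<in>{..m}. carrier (TP (Suc (m - p))))" "y \<in> (\<Pi>\<^sub>E p\<in>{..m}. carrier (TP (Suc (m - p))))"
    using assms(1,2) unfolding DC_simps by auto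
  fix p assume p: "p \<in> {..m}"
  then have "tQ (x p) = tQ (y p)" using assms(3)[of p] by (simp add: gr_def)
  then show "x p = y p" using p tQ_inj[OF DC_mem[OF assms(1), of p] DC_mem[OF assms(2), of p]] by simp
qed

lemma gr_surj:
  assumes v: "v \<in> TC m" obtains x where "x \<in> carrier (DC m)" "gr m x = v"
proof -
  define f where "f p = (SOME w. w \<in> carrier (TP (Suc (m - p))) \<and> tQ w = v p)" for p
  have f: "f p \<in> carrier (TP (Suc (m - p))) \<and> tQ (f p) = v p" if p: "p \<le> m" for p
  proof -
    have "v p \<in> tQ ` carrier (TP (Suc (m - p)))" unfolding tQ_image using TC_D[OF v p] by simp
    then obtain w where w: "v p = tQ w" "w \<in> carrier (TP (Suc (m - p)))" by (rule imageE)
    show ?thesis unfolding f_def by (rule someI[of _ w]) (rule conjI[OF w(2) w(1)[symmetric]])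
  qed
  show thesis
  proof (rule that)
    show "restrict f {..m} \<in> carrier (DC m)" unfolding DC_simps using f by (intro restrict_PiE_iff[THEN iffD2]) simp
    show "gr m (restrict f {..m}) = v" using f TC_0[OF v] by (auto simp: gr_def fun_eq_iff)
  qed
qed

lemma DC_add: "x \<in> carrier (DC m) \<Longrightarrow> y \<in> carrier (DC m) \<Longrightarrow> x \<oplus>\<^bsub>DC m\<^esub> y \<in> carrier (DC m) \<and> gr m (x \<oplus>\<^bsub>DC m\<^esub> y) = (\<lambda>p. gr m x p + gr m y p)"
proof -
  assume x: "x \<in> carrier (DC m)" and y: "y \<in> carrier (DC m)"
  have "x \<oplus>\<^bsub>DC m\<^esub> y \<in> carrier (DC m)"
    unfolding DC_simps by (intro restrict_PiE_iff[THEN iffD2] ballI TP_add DC_mem[OF x] DC_mem[OF y]) auto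
  moreover have "gr m (x \<oplus>\<^bsub>DC m\<^esub> y) = (\<lambda>p. gr m x p + gr m y p)"
    using DC_mem[OF x] DC_mem[OF y] by (auto simp: gr_def fun_eq_iff DC_simps tQ_add)
  ultimately show ?thesis by blast
qed

lemma DC_smult: "x \<in> carrier (DC m) \<Longrightarrow> c \<odot>\<^bsub>DC m\<^esub> x \<in> carrier (DC m) \<and> gr m (c \<odot>\<^bsub>DC m\<^esub> x) = (\<lambda>p. scl c (gr m x p))"
proof -
  assume x: "x \<in> carrier (DC m)"
  have "c \<odot>\<^bsub>DC m\<^esub> x \<in> carrier (DC m)"
    unfolding DC_simps by (intro restrict_PiE_iff[THEN iffD2] ballI TP_smult DC_mem[OF x]) auto
  moreover have "gr m (c \<odot>\<^bsub>DC m\<^esub> x) = (\<lambda>p. scl c (gr m x p))"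
    using DC_mem[OF x] by (auto simp: gr_def fun_eq_iff DC_simps tQ_smult)
  ultimately show ?thesis by blast
qed

lemma DC_zero: "\<zero>\<^bsub>DC m\<^esub> \<in> carrier (DC m) \<and> gr m (\<zero>\<^bsub>DC m\<^esub>) = (\<lambda>p. 0)"
proof -
  have "\<zero>\<^bsub>DC m\<^esub> \<in> carrier (DC m)"
    unfolding DC_simps by (intro restrict_PiE_iff[THEN iffD2] ballI TP_zero)
  moreover have "gr m (\<zero>\<^bsub>DC m\<^esub>) = (\<lambda>p. 0)" by (auto simp: gr_def fun_eq_iff DC_simps tQ_zero)
  ultimately show ?thesis by blast
qed

lemma dC_gr:
  assumes x: "x \<in> carrier (DC (Suc m))"
  shows "dC (Suc m) x \<in> carrier (DC m) \<and> gr m (dC (Suc m) x) = CD (gr (Suc m) x)"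
proof -
  have v: "CC_vert XA p (Suc m - p) (x p) \<in> carrier (TP (Suc (m - p))) \<and>
      tQ (CC_vert XA p (Suc m - p) (x p)) = (if even p then bb (gr (Suc m) x p) else - beta (gr (Suc m) x p))" if p: "p \<le> m" for p
    using CC_vert_tQ[of "Suc (m - p)" "x p" p] DC_mem[OF x, of p] p by (simp add: gr_def Suc_diff_le)
  have h: "CC_horiz XA (Suc p) (Suc m - Suc p) (x (Suc p)) \<in> carrier (TP (Suc (m - p))) \<and>
      tQ (CC_horiz XA (Suc p) (Suc m - Suc p) (x (Suc p)))
        = (if even p then gr (Suc m) x (Suc p) - tt (gr (Suc m) x (Suc p)) else NN (gr (Suc m) x (Suc p)))" if p: "p \<le> m" for p
    using CC_horiz_tQ[of "x (Suc p)" "m - p" "Suc p"] DC_mem[OF x, of "Suc p"] p by (simp add: gr_def)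
  have e: "dC (Suc m) x p = CC_vert XA p (Suc m - p) (x p) \<oplus>\<^bsub>TP (Suc (m - p))\<^esub> CC_horiz XA (Suc p) (Suc m - Suc p) (x (Suc p))"
    if p: "p \<le> m" for p using p by (simp add: Tot_CC_diff_def Suc_diff_le)
  have c: "dC (Suc m) x \<in> carrier (DC m)"
    unfolding DC_simps
  proof (rule PiE_I)
    fix p assume "p \<in> {..m}"
    then show "dC (Suc m) x p \<in> carrier (TP (Suc (m - p)))" using e v h by (simp add: TP_add)
  qed (auto simp: Tot_CC_diff_def)
  have "gr m (dC (Suc m) x) p = CD (gr (Suc m) x) p" for p
  proof (cases "p \<le> m")
    case True
    then show ?thesis using v[OF True] h[OF True] unfolding gr_def[of m] e[OF True] by (simp add: tQ_add CD_def)
  next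
    case False
    then show ?thesis using TC_0[OF CD_TC[OF gr_TC[OF x]], of p] by (simp add: gr_def)
  qed
  then show ?thesis using c by auto
qed

text \<open>In column \<open>m\<close> the bottom row is reached, where \<open>b\<close> and
  \<open>b'\<close> vanish, and beyond it there is nothing. So in degree 0 every chain is a cycle
  for \<open>CD\<close> as well.\<close>

lemma CD_top:
  assumes "z \<in> TC m" "m \<le> p" shows "CD z p = 0"
proof -
  have "z (Suc p) = 0" using TC_0[OF assms(1)] assms(2) by simp
  moreover have "keys (z p) \<subseteq> Bs (Suc 0)" using TC_0[OF assms(1), of p] TC_D[OF assms(1), of p] assms(2) by (cases "p = m") auto
  ultimately show ?thesis using bb_Bs1[of "z p"] beta_Bs1[of "z p"] by (simp add: CD_def)
qed

abbreviation "ZC m \<equiv> cycles (Tot_CC XA) (Tot_CC_diff XA) m"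

lemma ZC: "x \<in> ZC m \<longleftrightarrow> x \<in> carrier (DC m) \<and> (\<forall>p. CD (gr m x) p = 0)"
proof (cases m)
  case 0
  have "CD (gr 0 x) p = 0" if "x \<in> carrier (DC 0)" for p using CD_top[OF gr_TC[OF that], of p] by simp
  then show ?thesis unfolding 0 cycles_def by auto
next
  case (Suc k)
  have "dC (Suc k) x = \<zero>\<^bsub>DC k\<^esub> \<longleftrightarrow> (\<forall>p. CD (gr (Suc k) x) p = 0)" if x: "x \<in> carrier (DC (Suc k))"
  proof
    assume "dC (Suc k) x = \<zero>\<^bsub>DC k\<^esub>"
    then show "\<forall>p. CD (gr (Suc k) x) p = 0" using dC_gr[OF x] DC_zero[of k] by (metis (no_types))
  next
    assume "\<forall>p. CD (gr (Suc k) x) p = 0"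
    then show "dC (Suc k) x = \<zero>\<^bsub>DC k\<^esub>" using dC_gr[OF x] DC_zero[of k] by (intro gr_inj[of _ k]) auto
  qed
  then show ?thesis unfolding Suc cycles_def by auto
qed

text \<open>The complete invariant of a total cycle: the coordinates of the exact form
  \<open>Th z\<close>, and in even degrees the coefficient of the unit in the last column, stored at
  \<open>None\<close>.\<close>

definition co :: "nat \<Rightarrow> (nat \<Rightarrow> (nat set list \<Rightarrow>\<^sub>0 'k)) \<Rightarrow> (idx option \<Rightarrow>\<^sub>0 'k)"
  where "co m z = (\<Sum>s\<in>IX m. scl (lookup (Th z) s) (bas (Some s)))
    + (if even m then scl (lookup (z m) [{}]) (bas None) else 0)"

lemma finite_IX: "finite (IX m)"
  unfolding IX_def by (rule finite_Int) (simp add: finite_KBP)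

lemma co_add: "co m (\<lambda>p. y p + z p) = co m y + co m z"
  by (simp add: co_def Th_add lookup_add sum.distrib scl_add_left)
lemma co_scl: "co m (\<lambda>p. scl c (z p)) = scl c (co m z)"
  unfolding co_def Th_scl by (simp add: scl_sum)

lemma co_lookup: "lookup (co m z) (Some s) = (if s \<in> IX m then lookup (Th z) s else 0)"
  "lookup (co m z) None = (if even m then lookup (z m) [{}] else 0)"
  by (simp_all add: co_def lookup_add lookup_sum lookup_single when_def finite_IX if_distrib cong: if_cong)

definition ID :: "nat \<Rightarrow> idx option set"
  where "ID m = Some ` IX m \<union> (if even m then {None} else {})"

lemma card_ID: "finite (ID m)" "card (ID m) = card (IX m) + (if even m then 1 else 0)"
  unfolding ID_def using finite_IX[of m] by (auto simp: card_image)

abbreviation "MZ m \<equiv> (DC m)\<lparr>carrier := ZC m\<rparr>"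

lemma MZ_closed:
  "x \<in> ZC m \<Longrightarrow> y \<in> ZC m \<Longrightarrow> x \<oplus>\<^bsub>DC m\<^esub> y \<in> ZC m" "x \<in> ZC m \<Longrightarrow> c \<odot>\<^bsub>DC m\<^esub> x \<in> ZC m" "\<zero>\<^bsub>DC m\<^esub> \<in> ZC m"
  unfolding ZC using DC_add[of x m y] DC_smult[of x m c] DC_zero[of m]
  by (auto simp: CD_add CD_scl) (simp add: CD_def)

lemma linq_MZ: "linq (MZ m) (\<lambda>x. co m (gr m x))"
proof (rule linq.intro)
  have "vectorspace class_ring (MZ m)"
  proof (rule pull_vs[where H="\<lambda>p x. gr m x p"])
    fix x y c assume x: "x \<in> carrier (MZ m)"
    then have x': "x \<in> ZC m" "x \<in> carrier (DC m)" by (auto simp: ZC)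
    show "c \<odot>\<^bsub>MZ m\<^esub> x \<in> carrier (MZ m)" using MZ_closed(2)[OF x'(1)] by simp
    show "gr m (c \<odot>\<^bsub>MZ m\<^esub> x) p = scl c (gr m x p)" for p using DC_smult[OF x'(2)] by simp
    assume y: "y \<in> carrier (MZ m)"
    then have y': "y \<in> ZC m" "y \<in> carrier (DC m)" by (auto simp: ZC)
    show "x \<oplus>\<^bsub>MZ m\<^esub> y \<in> carrier (MZ m)" using MZ_closed(1)[OF x'(1) y'(1)] by simp
    show "gr m (x \<oplus>\<^bsub>MZ m\<^esub> y) p = gr m x p + gr m y p" for p using DC_add[OF x'(2) y'(2)] by simp
    show "x = y" if "\<And>p. gr m x p = gr m y p" using gr_inj[OF x'(2) y'(2) that] .
  next
    show "\<zero>\<^bsub>MZ m\<^esub> \<in> carrier (MZ m)" using MZ_closed(3) by simp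
    show "gr m (\<zero>\<^bsub>MZ m\<^esub>) p = 0" for p using DC_zero[of m] by simp
  qed
  then interpret V: vectorspace class_ring "MZ m" .
  show "abelian_group (MZ m)" by (rule V.module.M.abelian_group_axioms)
next
  fix x y c assume x: "x \<in> carrier (MZ m)"
  then have x': "x \<in> ZC m" "x \<in> carrier (DC m)" by (auto simp: ZC)
  show "c \<odot>\<^bsub>MZ m\<^esub> x \<in> carrier (MZ m)" using MZ_closed(2)[OF x'(1)] by simp
  show "co m (gr m (c \<odot>\<^bsub>MZ m\<^esub> x)) = scl c (co m (gr m x))" using DC_smult[OF x'(2)] by (simp add: co_scl)
  assume y: "y \<in> carrier (MZ m)"
  then have "y \<in> carrier (DC m)" by (simp add: ZC)
  then show "co m (gr m (x \<oplus>\<^bsub>MZ m\<^esub> y)) = co m (gr m x) + co m (gr m y)" using DC_add[OF x'(2)] by (simp add: co_add)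
qed

text \<open>If the invariants vanish, then \<open>Th_zero_iff\<close> and \<open>tot_kernel\<close>
  produce a bounding chain; boundaries have vanishing invariants by \<open>Th_CD\<close> and
  \<open>pt_CD\<close>.\<close>

lemma ker_MZ: "linq.ker (MZ m) (\<lambda>x. co m (gr m x)) = dC (Suc m) ` carrier (DC (Suc m))"
proof -
  interpret L: linq "MZ m" "\<lambda>x. co m (gr m x)" by (rule linq_MZ)
  show ?thesis
  proof (intro equalityI subsetI)
    fix x assume "x \<in> L.ker"
    then have x: "x \<in> carrier (DC m)" "\<And>p. CD (gr m x) p = 0" and k: "co m (gr m x) = 0" by (auto simp: L.ker_def ZC)
    have "Th (gr m x) = 0"
    proof (rule Th_zero_iff[OF gr_TC[OF x(1)]])
      fix s assume "s \<in> IX m" then show "lookup (Th (gr m x)) s = 0" using co_lookup(1)[of m "gr m x" s] k by simp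
    qed
    moreover have "even m \<Longrightarrow> lookup (gr m x m) [{}] = 0" using co_lookup(2)[of m "gr m x"] k by simp
    ultimately obtain y where y: "y \<in> TC (Suc m)" "\<And>p. CD y p = gr m x p" using tot_kernel[OF gr_TC[OF x(1)] x(2)] by blast
    obtain w where w: "w \<in> carrier (DC (Suc m))" "gr (Suc m) w = y" using gr_surj[OF y(1)] by blast
    have "x = dC (Suc m) w" using dC_gr[OF w(1)] y(2) w(2) by (intro gr_inj[OF x(1)]) auto
    then show "x \<in> dC (Suc m) ` carrier (DC (Suc m))" using w(1) by blast
  next
    fix x assume "x \<in> dC (Suc m) ` carrier (DC (Suc m))"
    then obtain w where w: "w \<in> carrier (DC (Suc m))" "x = dC (Suc m) w" by blast
    have g: "gr m x = CD (gr (Suc m) w)" and x: "x \<in> carrier (DC m)" using dC_gr[OF w(1)] w(2) by auto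
    have "co m (gr m x) = 0"
      unfolding g co_def using Th_CD[OF gr_TC[OF w(1)]] pt_CD[OF gr_TC[OF w(1)]] by simp
    then show "x \<in> L.ker" using x g by (simp add: L.ker_def ZC)
  qed
qed

text \<open>The image is a subspace, and \<open>tot_surj\<close> and \<open>tot_point\<close> hit
  the basis vectors.\<close>

lemma im_MZ: "(\<lambda>x. co m (gr m x)) ` carrier (MZ m) = {v. keys v \<subseteq> ID m}"
proof (intro equalityI subsetI)
  fix v assume "v \<in> (\<lambda>x. co m (gr m x)) ` carrier (MZ m)"
  then obtain x where v: "v = co m (gr m x)" by blast
  have "s \<in> ID m" if "s \<in> keys v" for s
    using that by (cases s) (auto simp: v in_keys_iff co_lookup ID_def split: if_splits)
  then show "v \<in> {v. keys v \<subseteq> ID m}" by blast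
next
  let ?J = "(\<lambda>x. co m (gr m x)) ` carrier (MZ m)"
  interpret L: linq "MZ m" "\<lambda>x. co m (gr m x)" by (rule linq_MZ)
  have J: "pm_subspace ?J"
    unfolding pm_subspace_def
  proof (intro conjI ballI allI)
    show "0 \<in> ?J" using L.h_zero MZ_closed(3)[of m] by (intro image_eqI[of _ _ "\<zero>\<^bsub>MZ m\<^esub>"]) auto
    fix u c assume "u \<in> ?J"
    then obtain x where x: "u = co m (gr m x)" "x \<in> carrier (MZ m)" by blast
    show "scl c u \<in> ?J" unfolding x(1) using L.h_sm[OF x(2), of c] L.sm[OF x(2), of c]
      by (intro image_eqI[of _ _ "c \<odot>\<^bsub>MZ m\<^esub> x"]) simp_all
    fix w assume "w \<in> ?J"
    then obtain y where y: "w = co m (gr m y)" "y \<in> carrier (MZ m)" by blast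
    have "x \<oplus>\<^bsub>MZ m\<^esub> y \<in> carrier (MZ m)" using x(2) y(2) MZ_closed(1)[of x m y] by simp
    then show "u + w \<in> ?J" unfolding x(1) y(1) using L.h_add[OF x(2) y(2)]
      by (intro image_eqI[of _ _ "x \<oplus>\<^bsub>MZ m\<^esub> y"]) simp_all
  qed
  have mem: "co m z \<in> ?J" if z: "z \<in> TC m" "\<And>p. CD z p = 0" for z
  proof -
    obtain x where x: "x \<in> carrier (DC m)" "gr m x = z" using gr_surj[OF z(1)] by blast
    then have "x \<in> ZC m" using z(2) by (simp add: ZC)
    then show ?thesis using x(2) by auto
  qed
  fix v :: "idx option \<Rightarrow>\<^sub>0 'k" assume v: "v \<in> {v. keys v \<subseteq> ID m}"
  show "v \<in> ?J"
  proof (rule pm_subspace_lin[where g="\<lambda>x. x" and x=v, OF J lin_id])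
    fix i assume "i \<in> keys v"
    then have i: "i \<in> ID m" using v by blast
    show "bas i \<in> ?J"
    proof (cases i)
      case None
      then have "even m" using i by (auto simp: ID_def split: if_splits)
      then obtain z where z: "z \<in> TC m" "\<And>p. CD z p = 0" "Th z = 0" "lookup (z m) [{}] = 1" using tot_point by blast
      have "co m z = bas i" using z \<open>even m\<close> by (simp add: co_def None)
      then show ?thesis using mem[OF z(1,2)] by metis
    next
      case (Some s)
      then have s: "s \<in> IX m" using i by (auto simp: ID_def split: if_splits)
      then obtain z where z: "z \<in> TC m" "\<And>p. CD z p = 0" "lookup (z m) [{}] = 0"
        and t: "\<And>t. t \<in> IX m \<Longrightarrow> lookup (Th z) t = (if t = s then 1 else 0)" using tot_surj by blast
      have "co m z = bas i"
      proof (rule poly_mapping_eqI)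
        fix j show "lookup (co m z) j = lookup (bas i) j"
          by (cases j) (use z(3) t s in \<open>auto simp: co_lookup Some lookup_single when_def\<close>)
      qed
      then show ?thesis using mem[OF z(1,2)] by metis
    qed
  qed
qed

lemma HC_dim:
  "vectorspace.fin_dim class_ring (cyclic_homology XA m) \<and>
   vectorspace.dim class_ring (cyclic_homology XA m) = card (IX m) + (if even m then 1 else 0)"
  using linq.Q_dim[OF linq_MZ card_ID(1) im_MZ, of m]
  unfolding cyclic_homology_def homology_def ker_MZ card_ID(2) .

end

theorem corollary1:
  fixes n m :: nat
  assumes "n \<ge> 2"
  shows "vectorspace.fin_dim class_ring
           (cyclic_homology (exterior_algebra n :: ('k::field_char_0, (nat list \<Rightarrow> 'k) set) module) m)
       \<and> int (vectorspace.dim class_ring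
           (cyclic_homology (exterior_algebra n :: ('k, (nat list \<Rightarrow> 'k) set) module) m))
         = (\<Sum>i=0..m. (-1) ^ (m - i) * 2 ^ (n - 1) * int ((n + i - 1) choose (n - 1)))
           + (if even m then 1 else 0)"
proof -
  interpret grass n "TYPE('k)" .
  show ?thesis using HC_dim[of m] card_IX[of m] assms by simp
qed

end
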